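(* Let $T$ be a maximal torus of $H$. The map $$\beta: G/T\times T_r\to G_{\varepsilon rs},\qquad \beta(gT,\gamma)=g\,S(\gamma)^{-1}g^{\vdash},$$ is a finite map, i.e. all of its fibers are finite.
   Context: $F$ is a $p$-adic field of characteristic zero; all groups are considered with their points over an algebraic closure $\overline F$. Let $m\ge 1$, $n=2m$, $G=GL_n$. There are two cases. (Orthogonal) Let $\Lambda$ be an invertible symmetric $2\times2$ matrix over $F$, $w$ the $n\times n$ permutation matrix with $1$'s on the antidiagonal, and $J=\begin{pmatrix} & & w_{m-1}\\ &\Lambda& \\ w_{m-1}& & \end{pmatrix}$ of size $n$ ($w_{m-1}$ the antidiagonal permutation matrix of size $m-1$). Put $H^+=\{h\in G: hJ\,{}^th=J\}$, $H=(H^+)^\circ$, $g^{\vdash}=w\,{}^tg\,w^{-1}$, and $S(\gamma)=wJ^{-1}(\gamma-I)$. (Symplectic) Let $u$ be the $n\times n$ antidiagonal matrix with entries $u_{i,n+1-i}=(-1)^{i+1}$. Put $H^+=H=\{h\in G: hu\,{}^th=u\}$, $g^{\vdash}=u\,{}^tg\,u^{-1}$, and $S(\gamma)=\gamma-I$. In both cases $\varepsilon(g)=(g^{-1})^{\vdash}$. $T_r$ is the set of regular elements of $T$, i.e. those $\gamma\in T$ whose centralizer in $H^+$ is $T$; for these $\gamma-I$ is invertible. $G_{\varepsilon rs}$ is the set of $\varepsilon$-regular $\varepsilon$-semisimple elements of $G$ in the sense of Kottwitz–Shelstad: $\delta\in G$ such that the automorphism $\mathrm{Ad}(\delta)\circ\varepsilon$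 of $G$ is semisimple (quasi-semisimple) and the identity component of the twisted centralizer $\{g: g\delta g^{\vdash}=\delta\}$ is a torus. The map $\beta$ is well defined since $T$ is contained in the twisted centralizer of $S(\gamma)^{-1}$. *)

theory Defs
  imports
    "Jordan_Normal_Form.Determinant"
    "HOL-Algebra.Algebraic_Closure_Type"
    "HOL-Algebra.Left_Coset"
    "HOL-Analysis.Abstract_Topology_2"
begin

section \<open>$p$-adic fields\<close>

text \<open>
  A $p$-adic field of characteristic zero is a non-archimedean local field of characteristic zero:
  it carries an absolute value that is ultrametric, nontrivial and discrete (the maximal ideal of
  the valuation ring is principal), complete, and has finite residue field. Equivalently, it is a
  finite extension of some $\mathbb{Q}_p$.
\<close>

definition p_adic_abs :: "('f::field_char_0 \<Rightarrow> real) \<Rightarrow> bool" where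
  "p_adic_abs v \<longleftrightarrow>
     (\<forall>x. 0 \<le> v x) \<and> (\<forall>x. v x = 0 \<longleftrightarrow> x = 0) \<and>
     (\<forall>x y. v (x * y) = v x * v y) \<and> (\<forall>x y. v (x + y) \<le> max (v x) (v y)) \<and>
     (\<exists>\<pi>. 0 < v \<pi> \<and> v \<pi> < 1 \<and> (\<forall>x. v x < 1 \<longrightarrow> v x \<le> v \<pi>)) \<and>
     (\<forall>a :: nat \<Rightarrow> 'f. (\<forall>e>0. \<exists>N. \<forall>i\<ge>N. \<forall>j\<ge>N. v (a i - a j) < e)
         \<longrightarrow> (\<exists>L. (\<lambda>i. v (a i - L)) \<longlonglongrightarrow> 0)) \<and>
     (\<exists>R. finite R \<and> (\<forall>x. v x \<le> 1 \<longrightarrow> (\<exists>r\<in>R. v (x - r) < 1)))"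

definition p_adic_field :: "'f::field_char_0 itself \<Rightarrow> bool" where
  "p_adic_field _ \<longleftrightarrow> (\<exists>v :: 'f \<Rightarrow> real. p_adic_abs v)"

section \<open>Linear algebraic groups inside $GL_n$\<close>

definition GL :: "nat \<Rightarrow> 'a::field mat monoid" where
  "GL n = units_of (ring_mat TYPE('a) n ())"

inductive_set poly_funs :: "nat \<Rightarrow> ('a::field mat \<Rightarrow> 'a) set" for n :: nat where
  const: "(\<lambda>_. c) \<in> poly_funs n"
| coord: "i < n \<Longrightarrow> j < n \<Longrightarrow> (\<lambda>A. A $$ (i, j)) \<in> poly_funs n"
| add: "P \<in> poly_funs n \<Longrightarrow> Q \<in> poly_funs n \<Longrightarrow> (\<lambda>A. P A + Q A) \<in> poly_funs n"
| mult: "P \<in> poly_funs n \<Longrightarrow> Q \<in> poly_funs n \<Longrightarrow> (\<lambda>A. P A * Q A) \<in> poly_funs n"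

text \<open>
  Powers of the determinant may be cleared, so the zero loci of polynomials in the matrix entries
  are all the Zariski closed subsets of $GL_n$.
\<close>

definition zariski_closed :: "nat \<Rightarrow> 'a::field mat set \<Rightarrow> bool" where
  "zariski_closed n Z \<longleftrightarrow>
     (\<exists>\<P> \<subseteq> poly_funs n. Z = {A \<in> carrier (GL n). \<forall>P\<in>\<P>. P A = 0})"

definition zariski_GL :: "nat \<Rightarrow> 'a::field mat topology" where
  "zariski_GL n =
     topology (\<lambda>U. U \<subseteq> carrier (GL n) \<and> zariski_closed n (carrier (GL n) - U))"

lemma openin_zariski_GL:
  "openin (zariski_GL n) U \<longleftrightarrow>
     U \<subseteq> carrier (GL n) \<and> zariski_closed n (carrier (GL n) - U)"
proof -
  let ?G = "carrier (GL n) :: 'a mat set"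
  have Un: "zariski_closed n (Y \<union> Z)" if "zariski_closed n Y" "zariski_closed n Z"
    for Y Z :: "'a mat set"
  proof -
    from that(1) obtain \<P> where \<P>: "\<P> \<subseteq> poly_funs n"
      and Y: "Y = {A \<in> ?G. \<forall>P\<in>\<P>. P A = 0}"
      unfolding zariski_closed_def by (elim exE conjE)
    from that(2) obtain \<Q> where \<Q>: "\<Q> \<subseteq> poly_funs n"
      and Z: "Z = {A \<in> ?G. \<forall>P\<in>\<Q>. P A = 0}"
      unfolding zariski_closed_def by (elim exE conjE)
    let ?R = "{(\<lambda>A. P A * Q A) | P Q. P \<in> \<P> \<and> Q \<in> \<Q>}"
    have "?R \<subseteq> poly_funs n"
    proof
      fix R assume "R \<in> ?R"
      then obtain P Q where "R = (\<lambda>A. P A * Q A)" "P \<in> \<P>" "Q \<in> \<Q>"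
        by (elim CollectE exE conjE)
      then show "R \<in> poly_funs n" using \<P> \<Q> by (simp add: poly_funs.mult subsetD)
    qed
    moreover have "Y \<union> Z = {A \<in> ?G. \<forall>R\<in>?R. R A = 0}"
    proof (rule Set.set_eqI)
      fix A
      have "(\<forall>R\<in>?R. R A = 0) \<longleftrightarrow> (\<forall>P\<in>\<P>. \<forall>Q\<in>\<Q>. P A * Q A = 0)"
      proof (intro iffI ballI)
        fix P Q assume *: "\<forall>R\<in>?R. R A = 0" and PQ: "P \<in> \<P>" "Q \<in> \<Q>"
        have "(\<lambda>A. P A * Q A) \<in> ?R"
          by (rule CollectI, rule exI[of _ P], rule exI[of _ Q]) (simp add: PQ)
        then show "P A * Q A = 0" by (rule bspec[OF *])
      next
        fix R assume *: "\<forall>P\<in>\<P>. \<forall>Q\<in>\<Q>. P A * Q A = 0" and "R \<in> ?R"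
        then obtain P Q where R: "R = (\<lambda>A. P A * Q A)" and P: "P \<in> \<P>" and Q: "Q \<in> \<Q>"
          by (elim CollectE exE conjE)
        show "R A = 0" unfolding R by (rule bspec[OF bspec[OF * P] Q])
      qed
      also have "\<dots> \<longleftrightarrow> (\<forall>P\<in>\<P>. P A = 0) \<or> (\<forall>Q\<in>\<Q>. Q A = 0)"
        unfolding mult_eq_0_iff by metis
      finally show "A \<in> Y \<union> Z \<longleftrightarrow> A \<in> {A \<in> ?G. \<forall>R\<in>?R. R A = 0}"
        unfolding Y Z Un_iff mem_Collect_eq by (simp only: conj_disj_distribL)
    qed
    ultimately show ?thesis
      unfolding zariski_closed_def by (intro exI conjI)
  qed
  have Inter: "zariski_closed n (?G \<inter> \<Inter>\<Z>)" if cl: "\<forall>Z\<in>\<Z>. zariski_closed n Z"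
    for \<Z> :: "'a mat set set"
  proof -
    have "\<forall>Z. \<exists>\<P>. Z \<in> \<Z> \<longrightarrow>
        \<P> \<subseteq> poly_funs n \<and> Z = {A \<in> ?G. \<forall>P\<in>\<P>. P A = 0}"
      using cl unfolding zariski_closed_def by auto
    then obtain \<P> where P: "\<forall>Z. Z \<in> \<Z> \<longrightarrow>
        \<P> Z \<subseteq> poly_funs n \<and> Z = {A \<in> ?G. \<forall>P\<in>\<P> Z. P A = 0}"
      by (rule choice[THEN exE])
    have sub: "\<P> Z \<subseteq> poly_funs n" if "Z \<in> \<Z>" for Z
      using P that by simp
    have mem: "A \<in> Z \<longleftrightarrow> (\<forall>P\<in>\<P> Z. P A = 0)" if "Z \<in> \<Z>" "A \<in> ?G" for Z A
    proof -
      have "Z = {A \<in> ?G. \<forall>P\<in>\<P> Z. P A = 0}" using P that(1) by simp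
      then have "A \<in> Z \<longleftrightarrow> A \<in> {A \<in> ?G. \<forall>P\<in>\<P> Z. P A = 0}" by (rule arg_cong)
      then show ?thesis using that(2) by simp
    qed
    have "(\<Union>Z\<in>\<Z>. \<P> Z) \<subseteq> poly_funs n"
      by (rule UN_least) (rule sub)
    moreover have "?G \<inter> \<Inter>\<Z> = {A \<in> ?G. \<forall>P\<in>(\<Union>Z\<in>\<Z>. \<P> Z). P A = 0}"
      by (rule Set.set_eqI) (simp add: mem cong: conj_cong)
    ultimately show ?thesis
      unfolding zariski_closed_def by (intro exI conjI)
  qed
  have "istopology (\<lambda>U. U \<subseteq> ?G \<and> zariski_closed n (?G - U))"
    unfolding istopology_def
  proof (intro conjI allI impI)
    fix S T :: "'a mat set"
    assume S: "S \<subseteq> ?G \<and> zariski_closed n (?G - S)"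
      and T: "T \<subseteq> ?G \<and> zariski_closed n (?G - T)"
    show "S \<inter> T \<subseteq> ?G" using S by blast
    show "zariski_closed n (?G - S \<inter> T)"
      using Un[of "?G - S" "?G - T"] S T by (simp add: Diff_Int)
  next
    fix \<K> :: "'a mat set set"
    assume K: "\<forall>K\<in>\<K>. K \<subseteq> ?G \<and> zariski_closed n (?G - K)"
    show "\<Union>\<K> \<subseteq> ?G" using K by blast
    have "?G - \<Union>\<K> = ?G \<inter> \<Inter>((\<lambda>K. ?G - K) ` \<K>)" by blast
    then show "zariski_closed n (?G - \<Union>\<K>)"
      using Inter[of "(\<lambda>K. ?G - K) ` \<K>"] K by simp
  qed
  then show ?thesis
    unfolding zariski_GL_def by (simp add: topology_inverse')
qed

definition identity_component :: "nat \<Rightarrow> 'a::field mat set \<Rightarrow> 'a mat set" where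
  "identity_component n V = connected_component_of_set (subtopology (zariski_GL n) V) (1\<^sub>m n)"

text \<open>
  For closed \<open>V\<close>, the coordinate ring of \<open>V\<close> consists of the restrictions to \<open>V\<close> of
  polynomials in the matrix entries and the inverse of the determinant.
\<close>

definition regular_fun :: "nat \<Rightarrow> 'a::field mat set \<Rightarrow> ('a mat \<Rightarrow> 'a) \<Rightarrow> bool" where
  "regular_fun n V f \<longleftrightarrow> (\<exists>P\<in>poly_funs n. \<exists>k. \<forall>A\<in>V. f A = P A / det A ^ k)"

definition regular_map ::
  "nat \<Rightarrow> 'a::field mat set \<Rightarrow> nat \<Rightarrow> ('a mat \<Rightarrow> 'a mat) \<Rightarrow> bool" where
  "regular_map n V r \<phi> \<longleftrightarrow>
     \<phi> ` V \<subseteq> carrier (GL r) \<and> (\<forall>i<r. \<forall>j<r. regular_fun n V (\<lambda>A. \<phi> A $$ (i, j)))"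

text \<open>The group $D_r \cong \mathbb{G}_m^r$:\<close>

definition diag_group :: "nat \<Rightarrow> 'a::field mat set" where
  "diag_group r = {A \<in> carrier (GL r). diagonal_mat A}"

definition is_torus :: "nat \<Rightarrow> 'a::field mat set \<Rightarrow> bool" where
  "is_torus n T \<longleftrightarrow>
     subgroup T (GL n) \<and> closedin (zariski_GL n) T \<and>
     (\<exists>r \<phi>. \<phi> \<in> iso (GL r\<lparr>carrier := diag_group r\<rparr>) (GL n\<lparr>carrier := T\<rparr>) \<and>
        regular_map r (diag_group r) n \<phi> \<and>
        regular_map n T r (inv_into (diag_group r) \<phi>))"

definition maximal_torus :: "nat \<Rightarrow> 'a::field mat set \<Rightarrow> 'a mat set \<Rightarrow> bool" where
  "maximal_torus n H T \<longleftrightarrow>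
     is_torus n T \<and> T \<subseteq> H \<and> (\<forall>T'. is_torus n T' \<and> T \<subseteq> T' \<and> T' \<subseteq> H \<longrightarrow> T' = T)"

text \<open>
  An automorphism \<open>\<sigma>\<close> of the algebraic group \<open>V\<close> is semisimple if its comorphism
  \<open>f \<mapsto> f \<circ> \<sigma>\<close> is diagonalizable on the coordinate ring, that is, if every regular function is
  a finite sum of regular eigenfunctions.
\<close>

definition semisimple_aut :: "nat \<Rightarrow> 'a::field mat set \<Rightarrow> ('a mat \<Rightarrow> 'a mat) \<Rightarrow> bool" where
  "semisimple_aut n V \<sigma> \<longleftrightarrow>
     (\<forall>f. regular_fun n V f \<longrightarrow>
        (\<exists>E. finite E \<and>
           (\<forall>h\<in>E. regular_fun n V h \<and> (\<exists>c. \<forall>A\<in>V. h (\<sigma> A) = c * h A)) \<and>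
           (\<forall>A\<in>V. f A = (\<Sum>h\<in>E. h A))))"

section \<open>The orthogonal and symplectic cases\<close>

text \<open>
  Rows and columns are numbered from 0. The parameter of \<open>Orthogonal\<close> is the matrix
  \<open>\<Lambda>\<close> over the base field \<open>'f\<close>; the groups live over its algebraic closure.
\<close>

datatype 'f case_type = Orthogonal "'f mat" | Symplectic

definition wf_case :: "'f::field case_type \<Rightarrow> bool" where
  "wf_case c \<longleftrightarrow>
     (case c of Orthogonal \<Lambda> \<Rightarrow> \<Lambda> \<in> carrier (GL 2) \<and> transpose_mat \<Lambda> = \<Lambda> | Symplectic \<Rightarrow> True)"

definition w_mat :: "nat \<Rightarrow> 'a::field mat" where
  "w_mat n = mat n n (\<lambda>(i, j). if i + j + 1 = n then 1 else 0)"

definition u_mat :: "nat \<Rightarrow> 'a::field mat" where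
  "u_mat n = mat n n (\<lambda>(i, j). if i + j + 1 = n then (-1) ^ i else 0)"

text \<open>For \<open>n = 2 m\<close>, the middle block occupies the rows and columns \<open>m - 1\<close> and \<open>m\<close>.\<close>

definition J_mat :: "nat \<Rightarrow> 'a::field mat \<Rightarrow> 'a mat" where
  "J_mat m \<Lambda> = mat (2 * m) (2 * m) (\<lambda>(i, j).
     if i \<in> {m - 1, m} \<and> j \<in> {m - 1, m} then \<Lambda> $$ (i - (m - 1), j - (m - 1))
     else if i + j + 1 = 2 * m then 1 else 0)"

definition form_mat :: "nat \<Rightarrow> 'f::field case_type \<Rightarrow> 'f alg_closure mat" where
  "form_mat m c =
     (case c of Orthogonal \<Lambda> \<Rightarrow> J_mat m (map_mat to_ac \<Lambda>) | Symplectic \<Rightarrow> u_mat (2 * m))"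

definition H_plus :: "nat \<Rightarrow> 'f::field case_type \<Rightarrow> 'f alg_closure mat set" where
  "H_plus m c =
     {h \<in> carrier (GL (2 * m)). h * form_mat m c * transpose_mat h = form_mat m c}"

definition H_group :: "nat \<Rightarrow> 'f::field case_type \<Rightarrow> 'f alg_closure mat set" where
  "H_group m c =
     (case c of Orthogonal \<Lambda> \<Rightarrow> identity_component (2 * m) (H_plus m c)
      | Symplectic \<Rightarrow> H_plus m c)"

definition vdash ::
  "nat \<Rightarrow> 'f::field case_type \<Rightarrow> 'f alg_closure mat \<Rightarrow> 'f alg_closure mat" where
  "vdash m c g =
     (let v = (case c of Orthogonal \<Lambda> \<Rightarrow> w_mat (2 * m) | Symplectic \<Rightarrow> u_mat (2 * m))
      in v * transpose_mat g * inv\<^bsub>GL (2 * m)\<^esub> v)"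

definition eps ::
  "nat \<Rightarrow> 'f::field case_type \<Rightarrow> 'f alg_closure mat \<Rightarrow> 'f alg_closure mat" where
  "eps m c g = vdash m c (inv\<^bsub>GL (2 * m)\<^esub> g)"

definition S_map ::
  "nat \<Rightarrow> 'f::field case_type \<Rightarrow> 'f alg_closure mat \<Rightarrow> 'f alg_closure mat" where
  "S_map m c \<gamma> =
     (case c of
        Orthogonal \<Lambda> \<Rightarrow> w_mat (2 * m) * inv\<^bsub>GL (2 * m)\<^esub> (form_mat m c) * (\<gamma> - 1\<^sub>m (2 * m))
      | Symplectic \<Rightarrow> \<gamma> - 1\<^sub>m (2 * m))"

definition regular_elements ::
  "nat \<Rightarrow> 'f::field case_type \<Rightarrow> 'f alg_closure mat set \<Rightarrow> 'f alg_closure mat set" where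
  "regular_elements m c T = {\<gamma> \<in> T. {h \<in> H_plus m c. h * \<gamma> = \<gamma> * h} = T}"

definition twisted_centralizer ::
  "nat \<Rightarrow> 'f::field case_type \<Rightarrow> 'f alg_closure mat \<Rightarrow> 'f alg_closure mat set" where
  "twisted_centralizer m c \<delta> = {g \<in> carrier (GL (2 * m)). g * \<delta> * vdash m c g = \<delta>}"

definition G_eps_rs :: "nat \<Rightarrow> 'f::field case_type \<Rightarrow> 'f alg_closure mat set" where
  "G_eps_rs m c =
     {\<delta> \<in> carrier (GL (2 * m)).
        semisimple_aut (2 * m) (carrier (GL (2 * m)))
          (\<lambda>g. \<delta> * eps m c g * inv\<^bsub>GL (2 * m)\<^esub> \<delta>) \<and>
        is_torus (2 * m) (identity_component (2 * m) (twisted_centralizer m c \<delta>))}"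

text \<open>
  The map \<open>\<beta>\<close> takes a pair of a coset \<open>C = gT\<close> and an element \<open>\<gamma>\<close> to the common value of
  \<open>g S(\<gamma>)\<^sup>-\<^sup>1 g\<^sup>\<turnstile>\<close> for \<open>g \<in> C\<close>; the definite description is meaningful only when
  this expression does not depend on the choice of \<open>g\<close>.
\<close>

definition beta ::
  "nat \<Rightarrow> 'f::field case_type \<Rightarrow> 'f alg_closure mat set \<times> 'f alg_closure mat
     \<Rightarrow> 'f alg_closure mat" where
  "beta m c = (\<lambda>(C, \<gamma>).
     THE \<delta>. \<forall>g\<in>C. g * inv\<^bsub>GL (2 * m)\<^esub> (S_map m c \<gamma>) * vdash m c g = \<delta>)"

end

theory Submission
  imports Defs
begin

text \<open>
  Let \<open>J\<close> be the form of \<open>H\<^sup>+\<close>, with \<open>J\<^sup>T = e J\<close>, \<open>e = \<plusminus>1\<close>, and let \<open>v\<close> be the matrix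
  with \<open>g\<^sup>\<turnstile> = v g\<^sup>T v\<^sup>-\<^sup>1\<close>. In both cases
  \<open>g S(\<gamma>)\<^sup>-\<^sup>1 g\<^sup>\<turnstile> = (g B g\<^sup>T) v\<^sup>-\<^sup>1\<close> for the bilinear form \<open>B = (\<gamma> - 1)\<^sup>-\<^sup>1 J\<close>. Since
  \<open>B + e B\<^sup>T = - J\<close> and \<open>B = - e \<gamma>\<^sup>-\<^sup>1 B\<^sup>T\<close>, the form \<open>B\<close> determines both \<open>J\<close> and \<open>\<gamma>\<close>, so
  \<open>h\<close> carries \<open>B\<close> for \<open>\<gamma>\<close> to \<open>B\<close> for \<open>\<gamma>'\<close> iff \<open>h \<in> H\<^sup>+\<close> and \<open>h \<gamma> h\<^sup>-\<^sup>1 = \<gamma>'\<close>. For \<open>\<gamma>' = \<gamma>\<close>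
  this identifies the twisted centralizer of \<open>S(\<gamma>)\<^sup>-\<^sup>1\<close> with \<open>T\<close> and shows that \<open>\<gamma>\<close> determines
  \<open>g T\<close> in a fibre. The second components occurring in a fibre are conjugate elements of
  the diagonalizable group \<open>T\<close>, hence finite in number. Finally the square of
  \<open>Ad(\<delta>) \<circ> \<epsilon>\<close> is conjugation by a diagonalizable matrix, which makes \<open>Ad(\<delta>) \<circ> \<epsilon>\<close> semisimple.
\<close>

section \<open>Matrix groups\<close>

text \<open>The form \<open>B\<close> exists only if \<open>g - 1\<close> is invertible, and this
  must be extracted from regularity. If a regular \<open>g\<close> in \<open>T\<close> had
  eigenvalue 1, a rank-one change of the identity along its fixed vectors would be an isometry
  commuting with \<open>g\<close>, hence an element of \<open>T\<close>. For \<open>e = - 1\<close>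
  it is a transvection, which cannot be diagonal in a basis diagonalizing \<open>T\<close>. For
  \<open>e = 1\<close> it is a reflection, which can be diagonal; it is excluded because every
  element of a torus over an algebraically closed field has a square root in that torus, and an
  isometry cannot act by a square root of -1 on a coordinate line where \<open>J\<close> does not
  vanish. A torus is given only as an isomorphic image of a diagonal group, so its diagonalizability
  inside \<open>GL n\<close> has to be derived: along one coordinate of the diagonal group matrix
  entries become Laurent polynomials, and their coefficients supply the weight vectors.
  Semisimplicity is tested on the square because \<open>Ad(delta) o eps\<close> is of the shape
  \<open>A -> D A^-T D^-1\<close>; its square is inner, and the eigenfunctions of an inner
  automorphism can be read off matrix entries.\<close>

lemma carrier_GL_iff: "A \<in> carrier (GL n) \<longleftrightarrow> A \<in> carrier_mat n n \<and> det A \<noteq> 0"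
proof
  assume "A \<in> carrier (GL n)"
  then show "A \<in> carrier_mat n n \<and> det A \<noteq> 0"
    using unit_imp_det_non_zero[of A n "()"]
    by (auto simp: GL_def units_of_def Units_def ring_mat_simps)
next
  assume "A \<in> carrier_mat n n \<and> det A \<noteq> 0"
  then show "A \<in> carrier (GL n)"
    using det_non_zero_imp_unit[of A n "()"] by (simp add: GL_def units_of_def)
qed

lemma mult_GL [simp]: "x \<otimes>\<^bsub>GL n\<^esub> y = x * y"
  by (simp add: GL_def units_of_def ring_mat_simps)

lemma one_GL [simp]: "\<one>\<^bsub>GL n\<^esub> = 1\<^sub>m n"
  by (simp add: GL_def units_of_def ring_mat_simps)

lemma group_GL: "group (GL n)"
proof -
  interpret semiring "ring_mat TYPE('a) n ()" by (rule semiring_mat)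
  show "group (GL n :: 'a mat monoid)"
    unfolding GL_def by (rule units_group)
qed

lemma inv_GL:
  assumes "A \<in> carrier (GL n)"
  shows "inv\<^bsub>GL n\<^esub> A \<in> carrier (GL n)" "inv\<^bsub>GL n\<^esub> A \<in> carrier_mat n n"
    and "A * inv\<^bsub>GL n\<^esub> A = 1\<^sub>m n" "inv\<^bsub>GL n\<^esub> A * A = 1\<^sub>m n"
proof -
  interpret group "GL n :: 'a mat monoid" by (rule group_GL)
  show "inv\<^bsub>GL n\<^esub> A \<in> carrier (GL n)" using assms by simp
  then show "inv\<^bsub>GL n\<^esub> A \<in> carrier_mat n n" by (simp add: carrier_GL_iff)
  show "A * inv\<^bsub>GL n\<^esub> A = 1\<^sub>m n" "inv\<^bsub>GL n\<^esub> A * A = 1\<^sub>m n"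
    using r_inv[OF assms] l_inv[OF assms] by simp_all
qed

lemma GL_carrier_mat: "A \<in> carrier (GL n) \<Longrightarrow> A \<in> carrier_mat n n"
  by (simp add: carrier_GL_iff)

lemma mult_in_GL: "A \<in> carrier (GL n) \<Longrightarrow> B \<in> carrier (GL n) \<Longrightarrow> A * B \<in> carrier (GL n)"
  by (auto simp add: carrier_GL_iff det_mult[of _ n])

lemma transpose_in_GL: "A \<in> carrier (GL n) \<Longrightarrow> A\<^sup>T \<in> carrier (GL n)"
  by (auto simp add: carrier_GL_iff det_transpose[of _ n])

lemma GL_I:
  fixes A :: "'a::field mat"
  assumes "A \<in> carrier_mat n n" "B \<in> carrier_mat n n" "A * B = 1\<^sub>m n"
  shows "A \<in> carrier (GL n)"
proof -
  have "det A * det B = 1" using det_mult[OF assms(1,2)] assms(3) by simp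
  then show ?thesis using assms by (auto simp: carrier_GL_iff)
qed

lemma GL_cancel_left:
  assumes "A \<in> carrier (GL n)" "Z \<in> carrier_mat n k" "Y \<in> carrier_mat n k" "A * Z = A * Y"
  shows "Z = Y"
proof -
  let ?B = "inv\<^bsub>GL n\<^esub> A"
  have "?B * (A * W) = W" if "W \<in> carrier_mat n k" for W
    using that inv_GL[OF assms(1)] GL_carrier_mat[OF assms(1)]
    by (simp add: assoc_mult_mat[of ?B n n A n W k, symmetric] del: assoc_mult_mat)
  from this[OF assms(2)] this[OF assms(3)] show ?thesis using assms(4) by metis
qed

lemma GL_cancel_right:
  assumes "A \<in> carrier (GL n)" "Z \<in> carrier_mat k n" "Y \<in> carrier_mat k n" "Z * A = Y * A"
  shows "Z = Y"
proof -
  let ?B = "inv\<^bsub>GL n\<^esub> A"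
  have "(W * A) * ?B = W" if "W \<in> carrier_mat k n" for W
    using that inv_GL[OF assms(1)] GL_carrier_mat[OF assms(1)]
    by (simp add: assoc_mult_mat[of W k n A n ?B n])
  from this[OF assms(2)] this[OF assms(3)] show ?thesis using assms(4) by metis
qed

lemma inv_GL_unique:
  assumes A: "A \<in> carrier (GL n)" and B: "B \<in> carrier_mat n n" and AB: "A * B = 1\<^sub>m n"
  shows "inv\<^bsub>GL n\<^esub> A = B"
  by (rule GL_cancel_left[where k = n, OF A inv_GL(2)[OF A] B]) (simp only: inv_GL(3)[OF A] AB)

lemma inv_GL_mult:
  assumes A: "A \<in> carrier (GL n)" and Z: "Z \<in> carrier_mat n k"
  shows "inv\<^bsub>GL n\<^esub> A * (A * Z) = Z" "A * (inv\<^bsub>GL n\<^esub> A * Z) = Z"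
proof -
  let ?B = "inv\<^bsub>GL n\<^esub> A"
  have "?B * (A * Z) = (?B * A) * Z"
    by (rule assoc_mult_mat[OF inv_GL(2)[OF A] GL_carrier_mat[OF A] Z, symmetric])
  moreover have "A * (?B * Z) = (A * ?B) * Z"
    by (rule assoc_mult_mat[OF GL_carrier_mat[OF A] inv_GL(2)[OF A] Z, symmetric])
  ultimately show "?B * (A * Z) = Z" "A * (?B * Z) = Z"
    unfolding inv_GL(3,4)[OF A] using Z by simp_all
qed

lemma GL_conj_eq_iff:
  assumes "A \<in> carrier (GL n)" "Z \<in> carrier_mat n n" "Y \<in> carrier_mat n n"
  shows "inv\<^bsub>GL n\<^esub> A * Z * A = Y \<longleftrightarrow> Z = A * Y * inv\<^bsub>GL n\<^esub> A"
proof -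
  note [simp] = inv_GL[OF assms(1)]
  have A [simp]: "A \<in> carrier_mat n n" using assms by (simp add: carrier_GL_iff)
  have l: "inv\<^bsub>GL n\<^esub> A * (A * Z) = Z" "A * (inv\<^bsub>GL n\<^esub> A * Z) = Z" if "Z \<in> carrier_mat n n" for Z
    using that inv_GL[OF assms(1)] A
    by (simp_all add: assoc_mult_mat[of "inv\<^bsub>GL n\<^esub> A" n n A n Z n, symmetric]
        assoc_mult_mat[of A n n "inv\<^bsub>GL n\<^esub> A" n Z n, symmetric] del: assoc_mult_mat)
  show ?thesis using assms(2,3) by (auto simp: l assoc_mult_mat[of _ n n _ n _ n])
qed

lemma GL_conj:
  assumes g: "g \<in> carrier (GL n)"
  defines "c \<equiv> \<lambda>x. g * x * inv\<^bsub>GL n\<^esub> g"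
  shows "x \<in> carrier_mat n n \<Longrightarrow> c x \<in> carrier_mat n n"
    and "x \<in> carrier_mat n n \<Longrightarrow> inv\<^bsub>GL n\<^esub> g * c x * g = x"
    and "x \<in> carrier_mat n n \<Longrightarrow> c (inv\<^bsub>GL n\<^esub> g * x * g) = x"
    and "x \<in> carrier_mat n n \<Longrightarrow> y \<in> carrier_mat n n \<Longrightarrow> c (x * y) = c x * c y"
    and "x \<in> carrier_mat n n \<Longrightarrow> det (c x) = det x"
    and "c (1\<^sub>m n) = 1\<^sub>m n"
    and "x \<in> carrier_mat n n \<Longrightarrow> det (inv\<^bsub>GL n\<^esub> g * x * g) = det x"
proof -
  let ?h = "inv\<^bsub>GL n\<^esub> g"
  have gn: "g \<in> carrier_mat n n" and h: "?h \<in> carrier_mat n n" "g * ?h = 1\<^sub>m n" "?h * g = 1\<^sub>m n"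
    using g inv_GL[OF g] GL_carrier_mat by auto
  note [simp] = gn h assoc_mult_mat[of _ n n _ n _ n] mult_carrier_mat[of _ n n _ n]
  show cn: "c x \<in> carrier_mat n n" if "x \<in> carrier_mat n n" for x
    using that by (simp add: c_def)
  show "?h * c x * g = x" if "x \<in> carrier_mat n n" for x
    using that by (subst GL_conj_eq_iff[OF g cn]) (simp_all only: c_def)
  show c2: "c (?h * x * g) = x" if "x \<in> carrier_mat n n" for x
    using that GL_conj_eq_iff[OF g that, of "?h * x * g"] by (simp only: c_def) simp
  have hg: "?h * (g * x) = x" "g * (?h * x) = x" if "x \<in> carrier_mat n n" for x
    using that assoc_mult_mat[of ?h n n g n x n] assoc_mult_mat[of g n n ?h n x n] by simp_all
  show "c (x * y) = c x * c y" if "x \<in> carrier_mat n n" "y \<in> carrier_mat n n" for x y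
    using that by (simp add: c_def hg)
  show "c (1\<^sub>m n) = 1\<^sub>m n" by (simp only: c_def right_mult_one_mat[OF gn] h)
  have dd: "det g * det ?h = 1" using det_mult[OF gn h(1)] by simp
  show "det (c x) = det x" if "x \<in> carrier_mat n n" for x
    using that dd by (simp add: c_def det_mult[of _ n] mult.commute mult.left_commute del: assoc_mult_mat)
  show "det (?h * x * g) = det x" if "x \<in> carrier_mat n n" for x
    using that dd by (simp add: det_mult[of _ n] mult.commute mult.left_commute del: assoc_mult_mat)
qed

lemma mat_diff_eqD:
  fixes A :: "'a::ab_group_add mat"
  assumes "A \<in> carrier_mat n k" "B \<in> carrier_mat n k" "A - B = C"
  shows "A = C + B"
  using assms by (intro eq_matI) auto

lemma minus_one_mult_mat:
  fixes A B :: "'a::ring_1 mat"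
  assumes "A \<in> carrier_mat n n" "B \<in> carrier_mat n n"
  shows "(A - 1\<^sub>m n) * B = A * B - B" "B * (A - 1\<^sub>m n) = B * A - B"
  using assms by (simp_all add: minus_mult_distrib_mat[of _ n n] mult_minus_distrib_mat[of _ n n _ n])

lemma uminus_mult_mat:
  fixes A B :: "'a::ring_1 mat"
  assumes "A \<in> carrier_mat n n" "B \<in> carrier_mat n n"
  shows "(- A) * B = - (A * B)" "B * (- A) = - (B * A)"
  using assms by simp_all

lemma uminus_diff_mat:
  fixes A B :: "'a::ring_1 mat"
  assumes "A \<in> carrier_mat n k" "B \<in> carrier_mat n k"
  shows "- (A - B) = B - A"
  using assms by (intro eq_matI) auto

lemma smult_mat_mult_vec:
  fixes A :: "'a::comm_semiring_0 mat"
  assumes "A \<in> carrier_mat n k" "v \<in> carrier_vec k"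
  shows "(c \<cdot>\<^sub>m A) *\<^sub>v v = c \<cdot>\<^sub>v (A *\<^sub>v v)"
  using assms by (intro eq_vecI) (auto simp: scalar_prod_def sum_distrib_left mult.assoc)

section \<open>Isometries and twisted isometries\<close>

definition isom_group :: "nat \<Rightarrow> 'a::field mat \<Rightarrow> 'a mat set" where
  "isom_group n J = {h \<in> carrier (GL n). h * J * h\<^sup>T = J}"

lemma isom_groupD:
  assumes "h \<in> isom_group n J"
  shows "h \<in> carrier (GL n)" "h \<in> carrier_mat n n" "h * J * h\<^sup>T = J"
  using assms by (auto simp: isom_group_def carrier_GL_iff)

text \<open>The form \<open>B = (\<gamma> - 1)\<^sup>-\<^sup>1 J\<close> determines \<open>J\<close> through its symmetrization, and
  \<open>\<gamma>\<close> as its asymmetry.\<close>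

lemma sum_transpose_cayley_form:
  fixes J :: "'a::field mat"
  assumes [simp]: "J \<in> carrier_mat n n" and J: "J\<^sup>T = e \<cdot>\<^sub>m J" and e: "e * e = 1"
    and g: "g \<in> isom_group n J" and N: "g - 1\<^sub>m n \<in> carrier (GL n)"
    and B [simp]: "B \<in> carrier_mat n n" and NB: "(g - 1\<^sub>m n) * B = J"
  shows "B + e \<cdot>\<^sub>m B\<^sup>T = - J"
proof -
  let ?N = "g - 1\<^sub>m n"
  note [simp] = assoc_mult_mat[of _ n n _ n _ n] mult_carrier_mat[of _ n n _ n]
  have [simp]: "g \<in> carrier_mat n n" "?N \<in> carrier_mat n n"
    using isom_groupD[OF g] by auto
  have [simp]: "dim_row J = n" "dim_col J = n" "dim_row g = n" "dim_row B = n" "dim_col B = n"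
    using carrier_matD[OF assms(1)] carrier_matD[OF isom_groupD(2)[OF g]] carrier_matD[OF B]
    by simp_all
  have NT: "?N\<^sup>T = g\<^sup>T - 1\<^sub>m n" by (simp add: transpose_minus[of _ n n])
  have gJ: "g * (J * g\<^sup>T) = J" using isom_groupD(3)[OF g] by simp
  have BN: "B\<^sup>T * ?N\<^sup>T = e \<cdot>\<^sub>m J" 
    using NB J transpose_mult[of ?N n n B n] by simp
  \<comment> \<open>Multiplying the claim by \<open>?N\<close> on the left and
    \<open>?N\<^sup>T\<close> on the right eliminates \<open>B\<close>: each of the three terms
    becomes an expression in \<open>g\<close> and \<open>J\<close> alone, and
    \<open>g J g\<^sup>T = J\<close> makes them match.\<close>
  have 1: "?N * (B * ?N\<^sup>T) = J * g\<^sup>T - J"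
  proof -
    have "?N * (B * ?N\<^sup>T) = J * ?N\<^sup>T" unfolding NB[symmetric] by simp
    also have "\<dots> = J * g\<^sup>T - J" unfolding NT by (simp add: minus_one_mult_mat)
    finally show ?thesis .
  qed
  have 2: "?N * ((e \<cdot>\<^sub>m B\<^sup>T) * ?N\<^sup>T) = g * J - J"
  proof -
    have "(e \<cdot>\<^sub>m B\<^sup>T) * ?N\<^sup>T = e \<cdot>\<^sub>m (e \<cdot>\<^sub>m J)"
      using BN by (simp add: mult_smult_assoc_mat[of _ n n _ n])
    also have "\<dots> = J" using e by (intro eq_matI) (auto simp: mult.assoc[symmetric])
    finally show ?thesis by (simp add: minus_one_mult_mat)
  qed
  have 3: "?N * ((- J) * ?N\<^sup>T) = - (J - g * J - J * g\<^sup>T + J)"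
  proof -
    have "(- J) * ?N\<^sup>T = J - J * g\<^sup>T"
    proof -
      have "(- J) * ?N\<^sup>T = - (J * (g\<^sup>T - 1\<^sub>m n))"
        unfolding NT by (rule uminus_mult_mat[of _ n]) auto
      also have "J * (g\<^sup>T - 1\<^sub>m n) = J * g\<^sup>T - J" by (rule minus_one_mult_mat) auto
      also have "- \<dots> = J - J * g\<^sup>T" by (rule uminus_diff_mat[of _ n n]) auto
      finally show ?thesis .
    qed
    then have "?N * ((- J) * ?N\<^sup>T) = (g * J - J) - (J - J * g\<^sup>T)"
      by (simp add: gJ mult_minus_distrib_mat[of _ n n _ n] minus_one_mult_mat)
    also have "\<dots> = - (J - g * J - J * g\<^sup>T + J)"
      by (rule eq_matI) (auto simp del: index_mult_mat(1))
    finally show ?thesis .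
  qed
  have "?N * ((B + e \<cdot>\<^sub>m B\<^sup>T) * ?N\<^sup>T) = ?N * ((- J) * ?N\<^sup>T)"
    unfolding 3 by (simp add: add_mult_distrib_mat[of _ n n _ _ n] mult_add_distrib_mat[of _ n n _ n] 1 2)
      (rule eq_matI, auto simp del: index_mult_mat(1))
  from GL_cancel_left[where k = n, OF N _ _ this]
  have "(B + e \<cdot>\<^sub>m B\<^sup>T) * ?N\<^sup>T = (- J) * ?N\<^sup>T" by simp
  from GL_cancel_right[where k = n, OF transpose_in_GL[OF N] _ _ this] show ?thesis by simp
qed

text \<open>The symmetrization of \<open>B\<close> recovers \<open>J\<close>, so a congruence
  carrying \<open>B1\<close> to \<open>B2\<close> carries \<open>J\<close> to itself. Rewriting
  \<open>(g - 1) B = J\<close> as \<open>g B = J + B\<close> then shows that \<open>h * g1\<close>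
  and \<open>g2 * h\<close> agree after multiplication by the invertible matrix
  \<open>B1 * h\<^sup>T\<close>. Conversely, \<open>h\<close> intertwines \<open>g1 - 1\<close> with
  \<open>g2 - 1\<close>, so \<open>g2 - 1\<close> sends both \<open>h B1 h\<^sup>T\<close> and
  \<open>B2\<close> to \<open>J\<close>.\<close>

lemma cayley_form_equiv_iff:
  fixes J :: "'a::field mat"
  assumes J [simp]: "J \<in> carrier_mat n n" and JT: "J\<^sup>T = e \<cdot>\<^sub>m J" and e: "e * e = 1"
    and J': "J \<in> carrier (GL n)"
    and g1: "g1 \<in> isom_group n J" and N1: "g1 - 1\<^sub>m n \<in> carrier (GL n)"
    and B1 [simp]: "B1 \<in> carrier_mat n n" and NB1: "(g1 - 1\<^sub>m n) * B1 = J"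
    and g2: "g2 \<in> isom_group n J" and N2: "g2 - 1\<^sub>m n \<in> carrier (GL n)"
    and B2 [simp]: "B2 \<in> carrier_mat n n" and NB2: "(g2 - 1\<^sub>m n) * B2 = J"
    and h: "h \<in> carrier (GL n)"
  shows "h * B1 * h\<^sup>T = B2 \<longleftrightarrow> h \<in> isom_group n J \<and> h * g1 = g2 * h"
proof -
  note [simp] = assoc_mult_mat[of _ n n _ n _ n] mult_carrier_mat[of _ n n _ n]
  have [simp]: "g1 \<in> carrier_mat n n" "g2 \<in> carrier_mat n n" "h \<in> carrier_mat n n"
      "g1 - 1\<^sub>m n \<in> carrier_mat n n" "g2 - 1\<^sub>m n \<in> carrier_mat n n"
    using isom_groupD[OF g1] isom_groupD[OF g2] h by (auto simp: carrier_GL_iff)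
  have gB1: "g1 * B1 = J + B1"
    using NB1 by (intro mat_diff_eqD[of _ n n]) (simp_all add: minus_one_mult_mat)
  have gB2: "g2 * B2 = J + B2"
    using NB2 by (intro mat_diff_eqD[of _ n n]) (simp_all add: minus_one_mult_mat)
  have B1GL: "B1 \<in> carrier (GL n)"
    using NB1 J' N1 det_mult[of "g1 - 1\<^sub>m n" n B1] by (auto simp: carrier_GL_iff)
  show ?thesis
  proof
    assume eq: "h * B1 * h\<^sup>T = B2"
    have "(h * B1 * h\<^sup>T)\<^sup>T = h * (B1\<^sup>T * h\<^sup>T)"
      by (simp add: transpose_mult[of _ n n _ n])
    then have eqT: "B2\<^sup>T = h * (B1\<^sup>T * h\<^sup>T)" using eq by simp
    have "- J = B2 + e \<cdot>\<^sub>m B2\<^sup>T"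
      using sum_transpose_cayley_form[OF J JT e g2 N2 B2 NB2] by simp
    also have "\<dots> = h * B1 * h\<^sup>T + e \<cdot>\<^sub>m (h * (B1\<^sup>T * h\<^sup>T))"
      unfolding eq eqT ..
    also have "\<dots> = h * ((B1 + e \<cdot>\<^sub>m B1\<^sup>T) * h\<^sup>T)"
      by (simp add: add_mult_distrib_mat[of _ n n _ _ n] mult_add_distrib_mat[of _ n n _ n]
          mult_smult_assoc_mat[of _ n n _ n] mult_smult_distrib[of _ n n _ n])
    also have "\<dots> = - (h * (J * h\<^sup>T))"
      unfolding sum_transpose_cayley_form[OF J JT e g1 N1 B1 NB1]
      by (simp add: uminus_mult_mat[of _ n])
    finally have "- (- J) = - (- (h * (J * h\<^sup>T)))" by (rule arg_cong)
    then have hJ: "h * (J * h\<^sup>T) = J" unfolding uminus_uminus_mat by (rule sym)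
    then have H: "h \<in> isom_group n J" using h by (simp add: isom_group_def)
    have "h * (g1 * (B1 * h\<^sup>T)) = h * ((J + B1) * h\<^sup>T)"
      by (simp add: gB1[symmetric])
    also have "\<dots> = J + B2"
      using eq hJ by (simp add: add_mult_distrib_mat[of _ n n _ _ n] mult_add_distrib_mat[of _ n n _ n])
    also have "\<dots> = g2 * (h * (B1 * h\<^sup>T))"
      using gB2 eq by simp
    finally have "(h * g1) * (B1 * h\<^sup>T) = (g2 * h) * (B1 * h\<^sup>T)" by simp
    moreover have "B1 * h\<^sup>T \<in> carrier (GL n)" using B1GL h by (intro mult_in_GL transpose_in_GL)
    ultimately have "h * g1 = g2 * h"
      using GL_cancel_right[of "B1 * h\<^sup>T" n "h * g1" n "g2 * h"] by simp
    then show "h \<in> isom_group n J \<and> h * g1 = g2 * h" using H by simp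
  next
    assume *: "h \<in> isom_group n J \<and> h * g1 = g2 * h"
    have hJ: "h * (J * h\<^sup>T) = J" using * isom_groupD(3)[of h n J] by simp
    have "(g2 - 1\<^sub>m n) * (h * B1 * h\<^sup>T) = ((g2 - 1\<^sub>m n) * h) * (B1 * h\<^sup>T)" by simp
    also have "(g2 - 1\<^sub>m n) * h = h * (g1 - 1\<^sub>m n)"
      using * by (simp add: minus_one_mult_mat)
    also have "h * (g1 - 1\<^sub>m n) * (B1 * h\<^sup>T) = h * (((g1 - 1\<^sub>m n) * B1) * h\<^sup>T)"
      by simp
    also have "\<dots> = (g2 - 1\<^sub>m n) * B2" unfolding NB1 NB2 by (rule hJ)
    finally have "(g2 - 1\<^sub>m n) * (h * B1 * h\<^sup>T) = (g2 - 1\<^sub>m n) * B2" .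
    from GL_cancel_left[where k = n, OF N2 _ _ this] show "h * B1 * h\<^sup>T = B2" by simp
  qed
qed

section \<open>Regular functions\<close>

text \<open>Polynomial functions, regular functions on a subset of \<open>GL n\<close>, and spans of
  eigenfunctions all satisfy these axioms, so closure under sums, powers and determinants is proved
  once for all three.\<close>

locale function_algebra =
  fixes F :: "('x \<Rightarrow> 'a::comm_ring_1) set"
  assumes const: "(\<lambda>_. c) \<in> F"
    and add: "f \<in> F \<Longrightarrow> g \<in> F \<Longrightarrow> (\<lambda>x. f x + g x) \<in> F"
    and mult: "f \<in> F \<Longrightarrow> g \<in> F \<Longrightarrow> (\<lambda>x. f x * g x) \<in> F"
begin

lemma sum:
  assumes "\<And>i. i \<in> I \<Longrightarrow> f i \<in> F"
  shows "(\<lambda>x. \<Sum>i\<in>I. f i x) \<in> F"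
  using assms by (induction I rule: infinite_finite_induct) (simp_all add: const add)

lemma prod:
  assumes "\<And>i. i \<in> I \<Longrightarrow> f i \<in> F"
  shows "(\<lambda>x. \<Prod>i\<in>I. f i x) \<in> F"
  using assms by (induction I rule: infinite_finite_induct) (simp_all add: const mult)

lemma power: "f \<in> F \<Longrightarrow> (\<lambda>x. f x ^ k) \<in> F"
  by (induction k) (simp_all add: const mult)

lemma det:
  assumes "\<And>i j. i < k \<Longrightarrow> j < k \<Longrightarrow> f i j \<in> F"
  shows "(\<lambda>x. det (mat k k (\<lambda>(i, j). f i j x))) \<in> F"
proof -
  have eq: "det (mat k k (\<lambda>(i, j). f i j x)) =
      (\<Sum>p\<in>{p. p permutes {0..<k}}. signof p * (\<Prod>i = 0..<k. f i (p i) x))" for x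
    by (subst det_def'[of _ k]) (auto intro!: sum.cong prod.cong arg_cong2[of _ _ _ _ "(*)"]
        simp: permutes_in_image)
  have "p i < k" if "p permutes {0..<k}" "i < k" for p i
    using permutes_in_image[OF that(1), of i] that(2) by simp
  then show ?thesis unfolding eq using assms
    by (intro sum mult const prod) auto
qed

end

lemma function_algebra_poly_funs: "function_algebra (poly_funs n)"
  by standard (auto intro: poly_funs.intros)

text \<open>Members of \<open>poly_funs n\<close> read only entries with indices below
  \<open>n\<close>, whatever the size of the matrix, whereas \<open>det\<close> depends on the
  dimension; hence agreement is claimed on \<open>n\<close> by \<open>n\<close> matrices
  only.\<close>

lemma det_poly_fun: "\<exists>D\<in>poly_funs n. \<forall>A\<in>carrier_mat n n. D A = det (A :: 'a::field mat)"
proof (intro bexI ballI)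
  interpret function_algebra "poly_funs n :: ('a mat \<Rightarrow> 'a) set"
    by (rule function_algebra_poly_funs)
  show "(\<lambda>A. det (mat n n (\<lambda>(i, j). A $$ (i, j)))) \<in> (poly_funs n :: ('a mat \<Rightarrow> 'a) set)"
    by (rule det) (rule poly_funs.coord)
  show "det (mat n n (\<lambda>(i, j). A $$ (i, j))) = det A" if "A \<in> carrier_mat n n" for A :: "'a mat"
    using that by (intro arg_cong[of _ _ det] eq_matI) auto
qed

lemma regular_funI:
  "P \<in> poly_funs n \<Longrightarrow> (\<And>A. A \<in> V \<Longrightarrow> f A = P A / det A ^ k) \<Longrightarrow> regular_fun n V f"
  unfolding regular_fun_def by blast

lemma regular_fun_cong: "(\<And>A. A \<in> V \<Longrightarrow> f A = g A) \<Longrightarrow> regular_fun n V f \<longleftrightarrow> regular_fun n V g"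
  by (simp add: regular_fun_def)

lemma regular_fun_poly: "P \<in> poly_funs n \<Longrightarrow> regular_fun n V P"
  unfolding regular_fun_def by (intro bexI[of _ P] exI[of _ 0]) auto

lemma regular_fun_inverse_det: "regular_fun n V (\<lambda>A. 1 / det A)"
  unfolding regular_fun_def by (intro bexI[of _ "\<lambda>_. 1"] exI[of _ 1]) (auto intro: poly_funs.const)

lemma function_algebra_regular_fun:
  fixes V :: "'a::field mat set"
  assumes V: "V \<subseteq> carrier (GL n)"
  shows "function_algebra {f. regular_fun n V f}"
proof
  interpret P: function_algebra "poly_funs n" by (rule function_algebra_poly_funs)
  obtain D :: "'a mat \<Rightarrow> 'a" where D: "D \<in> poly_funs n" "\<And>A. A \<in> carrier_mat n n \<Longrightarrow> D A = det A"
    using det_poly_fun[of n, where 'a = 'a] by blast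
  fix f g assume "f \<in> {f. regular_fun n V f}" "g \<in> {f. regular_fun n V f}"
  then obtain P k Q l where *: "P \<in> poly_funs n" "\<And>A. A \<in> V \<Longrightarrow> f A = P A / det A ^ k"
    "Q \<in> poly_funs n" "\<And>A. A \<in> V \<Longrightarrow> g A = Q A / det A ^ l"
    unfolding regular_fun_def by blast
  \<comment> \<open>Common denominator \<open>det A ^ (k + l)\<close>. The polynomial
    \<open>D\<close> replaces \<open>det\<close> so that the numerator is a member of
    \<open>poly_funs n\<close>.\<close>
  have "(\<lambda>A. P A * D A ^ l + Q A * D A ^ k) \<in> poly_funs n"
    using * D by (intro P.add P.mult P.power)
  moreover have "f A + g A = (P A * D A ^ l + Q A * D A ^ k) / det A ^ (k + l)" if "A \<in> V" for A
  proof -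
    have "det A \<noteq> 0" "D A = det A" using that V D(2) by (auto simp: carrier_GL_iff)
    then show ?thesis using *(2,4)[OF that] by (simp add: power_add add_divide_distrib)
  qed
  ultimately show "(\<lambda>x. f x + g x) \<in> {f. regular_fun n V f}"
    by (intro CollectI regular_funI)
  have "(\<lambda>A. P A * Q A) \<in> poly_funs n" using * by (intro P.mult)
  moreover have "f A * g A = (P A * Q A) / det A ^ (k + l)" if "A \<in> V" for A
    using *(2,4)[OF that] by (simp add: power_add)
  ultimately show "(\<lambda>x. f x * g x) \<in> {f. regular_fun n V f}"
    by (intro CollectI regular_funI)
qed (auto intro: regular_fun_poly poly_funs.const)

lemma regular_fun_comp_poly:
  assumes V: "V \<subseteq> carrier (GL n)" and P: "P \<in> poly_funs r"
    and f: "\<And>i j. i < r \<Longrightarrow> j < r \<Longrightarrow> regular_fun n V (\<lambda>A. f A $$ (i, j))"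
  shows "regular_fun n V (\<lambda>A. P (f A))"
proof -
  interpret function_algebra "{f. regular_fun n V f}" by (rule function_algebra_regular_fun[OF V])
  show ?thesis
    using P by induction (use f const add mult in auto)
qed

text \<open>Regularity of the entries of \<open>f\<close> takes care of the numerator of
  \<open>g\<close>; the powers of \<open>det (f A)\<close> in its denominator are the reason for the
  separate hypothesis \<open>d\<close>.\<close>

lemma regular_fun_comp:
  assumes V: "V \<subseteq> carrier (GL n)" and g: "regular_fun r W g"
    and f: "\<And>i j. i < r \<Longrightarrow> j < r \<Longrightarrow> regular_fun n V (\<lambda>A. f A $$ (i, j))"
    and fV: "\<And>A. A \<in> V \<Longrightarrow> f A \<in> W"
    and d: "regular_fun n V (\<lambda>A. 1 / det (f A))"
  shows "regular_fun n V (\<lambda>A. g (f A))"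
proof -
  interpret function_algebra "{f. regular_fun n V f}" by (rule function_algebra_regular_fun[OF V])
  obtain P k where P: "P \<in> poly_funs r" "\<And>A. A \<in> W \<Longrightarrow> g A = P A / det A ^ k"
    using g unfolding regular_fun_def by blast
  have "regular_fun n V (\<lambda>A. P (f A) * (1 / det (f A)) ^ k)"
    using mult[of "\<lambda>A. P (f A)"] power[of "\<lambda>A. 1 / det (f A)" k] d
      regular_fun_comp_poly[OF V P(1) f] by simp
  then show ?thesis
    by (subst regular_fun_cong) (simp_all add: P(2) fV power_one_over)
qed

lemma regular_fun_mult_mat:
  assumes V: "V \<subseteq> carrier (GL n)"
    and f: "\<And>i j. i < k \<Longrightarrow> j < k \<Longrightarrow> regular_fun n V (\<lambda>A. f A $$ (i, j))"
      "\<And>A. A \<in> V \<Longrightarrow> f A \<in> carrier_mat k k"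
    and g: "\<And>i j. i < k \<Longrightarrow> j < k \<Longrightarrow> regular_fun n V (\<lambda>A. g A $$ (i, j))"
      "\<And>A. A \<in> V \<Longrightarrow> g A \<in> carrier_mat k k"
    and ij: "i < k" "j < k"
  shows "regular_fun n V (\<lambda>A. (f A * g A) $$ (i, j))"
proof -
  interpret function_algebra "{f. regular_fun n V f}" by (rule function_algebra_regular_fun[OF V])
  have eq: "(f A * g A) $$ (i, j) = (\<Sum>l<k. f A $$ (i, l) * g A $$ (l, j))" if "A \<in> V" for A
    using f(2)[OF that] g(2)[OF that] ij by (simp add: scalar_prod_def lessThan_atLeast0)
  have "(\<lambda>A. \<Sum>l<k. f A $$ (i, l) * g A $$ (l, j)) \<in> {f. regular_fun n V f}"
    using f g ij by (intro sum mult) auto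
  then show ?thesis by (subst regular_fun_cong[OF eq]) simp_all
qed

lemma regular_fun_const: "regular_fun n V (\<lambda>_. c)"
  by (rule regular_fun_poly) (rule poly_funs.const)

lemma regular_fun_coord: "i < n \<Longrightarrow> j < n \<Longrightarrow> regular_fun n V (\<lambda>A. A $$ (i, j))"
  by (rule regular_fun_poly) (rule poly_funs.coord)

lemma regular_fun_conj_index:
  assumes g: "g \<in> carrier_mat n n" and h: "h \<in> carrier_mat n n" and V: "V \<subseteq> carrier (GL r)"
    and f: "\<And>i j. i < n \<Longrightarrow> j < n \<Longrightarrow> regular_fun r V (\<lambda>A. f A $$ (i, j))"
    and fV: "\<And>A. A \<in> V \<Longrightarrow> f A \<in> carrier_mat n n"
    and ij: "i < n" "j < n"
  shows "regular_fun r V (\<lambda>A. (g * f A * h) $$ (i, j))"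
proof -
  note m = mult_carrier_mat[of _ n n _ n]
  have 1: "regular_fun r V (\<lambda>A. (g * f A) $$ (i, j))" if "i < n" "j < n" for i j
    by (rule regular_fun_mult_mat[OF V regular_fun_const _ f fV that]) (simp_all add: g)
  show ?thesis
    by (rule regular_fun_mult_mat[OF V 1 m[OF g fV] regular_fun_const _ ij]) (simp_all add: h)
qed

lemma inv_GL_index:
  assumes A: "A \<in> carrier (GL n)" and ij: "i < n" "j < n"
  shows "(inv\<^bsub>GL n\<^esub> A) $$ (i, j) = cofactor A j i * (1 / det A)"
proof -
  have A': "A \<in> carrier_mat n n" "det A \<noteq> 0" using A by (auto simp: carrier_GL_iff)
  have "A * ((1 / det A) \<cdot>\<^sub>m adj_mat A) = 1\<^sub>m n"
    using adj_mat[OF A'(1)] A' by (simp add: mult_smult_distrib[of _ n n]) (rule eq_matI, auto)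
  then have "A * inv\<^bsub>GL n\<^esub> A = A * ((1 / det A) \<cdot>\<^sub>m adj_mat A)"
    using inv_GL(3)[OF A] by (rule trans[OF _ sym, rotated])
  from GL_cancel_left[where k = n, OF A _ _ this]
  have "inv\<^bsub>GL n\<^esub> A = (1 / det A) \<cdot>\<^sub>m adj_mat A"
    using inv_GL(2)[OF A] adj_mat(1)[OF A'(1)] by simp
  then show ?thesis using A' ij by (simp add: adj_mat_def)
qed

lemma regular_fun_inv_GL:
  assumes ij: "i < n" "j < n"
  shows "regular_fun n (carrier (GL n)) (\<lambda>A. (inv\<^bsub>GL n\<^esub> A) $$ (i, j))"
proof -
  interpret function_algebra "{f. regular_fun n (carrier (GL n)) f}"
    by (rule function_algebra_regular_fun) simp
  let ?m = "n - 1"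
  \<comment> \<open>Cramer's rule, with the minor spelled out entrywise so that closure under
    determinants applies. The conditionals skip row \<open>j\<close> and column
    \<open>i\<close>.\<close>
  have eq: "(inv\<^bsub>GL n\<^esub> A) $$ (i, j) = (- 1) ^ (j + i) *
      det (mat ?m ?m (\<lambda>(a, b). A $$ (if a < j then a else Suc a, if b < i then b else Suc b)))
      * (1 / det A)" if "A \<in> carrier (GL n)" for A
    using inv_GL_index[OF that ij] GL_carrier_mat[OF that]
    by (simp add: cofactor_def mat_delete_def)
  have "(\<lambda>A. det (mat ?m ?m (\<lambda>(a, b). A $$ (if a < j then a else Suc a, if b < i then b else Suc b))))
      \<in> {f. regular_fun n (carrier (GL n)) f}"
    by (rule det) (intro CollectI regular_fun_coord, use ij in auto)
  then have "(\<lambda>A. (- 1) ^ (j + i) * det (mat ?m ?m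
      (\<lambda>(a, b). A $$ (if a < j then a else Suc a, if b < i then b else Suc b))) * (1 / det A))
      \<in> {f. regular_fun n (carrier (GL n)) f}"
    using regular_fun_inverse_det by (intro mult const) auto
  then show ?thesis by (subst regular_fun_cong[OF eq]) simp_all
qed

text \<open>Along a polynomially parametrized curve, questions about functions of matrices become
  questions about polynomials in one variable, where infinitely many points determine everything.
  Both the weight decomposition and the connectedness of tori rest on this.\<close>

lemma poly_funs_on_curve:
  assumes P: "P \<in> poly_funs n"
    and M: "\<And>i j. i < n \<Longrightarrow> j < n \<Longrightarrow> \<exists>q. \<forall>z\<in>Z. M z $$ (i, j) = poly q z"
  shows "\<exists>p. \<forall>z\<in>Z. P (M z) = poly p z"
  using P
proof induction
  case (const c)
  show ?case by (intro exI[of _ "[:c:]"]) simp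
next
  case (coord i j)
  then show ?case by (rule M)
next
  case (add P Q)
  then obtain p q where "\<forall>z\<in>Z. P (M z) = poly p z" "\<forall>z\<in>Z. Q (M z) = poly q z" by blast
  then show ?case by (intro exI[of _ "p + q"]) simp
next
  case (mult P Q)
  then obtain p q where "\<forall>z\<in>Z. P (M z) = poly p z" "\<forall>z\<in>Z. Q (M z) = poly q z" by blast
  then show ?case by (intro exI[of _ "p * q"]) simp
qed

lemma poly_eqI_infinite:
  fixes p q :: "'a::idom poly"
  assumes "infinite Z" "\<And>z. z \<in> Z \<Longrightarrow> poly p z = poly q z"
  shows "p = q"
proof (rule ccontr)
  assume "p \<noteq> q"
  then have "finite {z. poly (p - q) z = 0}" by (intro poly_roots_finite) simp
  moreover have "Z \<subseteq> {z. poly (p - q) z = 0}" using assms(2) by auto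
  ultimately show False using assms(1) finite_subset by blast
qed

section \<open>Tori are diagonalizable\<close>

definition dmat :: "nat \<Rightarrow> (nat \<Rightarrow> 'a) \<Rightarrow> 'a::field mat" where
  "dmat n f = mat n n (\<lambda>(i, j). if i = j then f i else 0)"

lemma dmat_carrier [simp]: "dmat n f \<in> carrier_mat n n"
  and dmat_index: "i < n \<Longrightarrow> j < n \<Longrightarrow> dmat n f $$ (i, j) = (if i = j then f i else 0)"
  and dmat_dim [simp]: "dim_row (dmat n f) = n" "dim_col (dmat n f) = n"
  by (simp_all add: dmat_def)

lemma dmat_mult_index:
  assumes "A \<in> carrier_mat n n" "i < n" "j < n"
  shows "(dmat n f * A) $$ (i, j) = f i * A $$ (i, j)"
    and "(A * dmat n f) $$ (i, j) = A $$ (i, j) * f j"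
proof -
  have "(\<Sum>l = 0..<n. (if i = l then f i else 0) * A $$ (l, j)) = f i * A $$ (i, j)"
    using assms(2) by (subst sum.remove[of _ i]) auto
  moreover have "(\<Sum>l = 0..<n. A $$ (i, l) * (if l = j then f l else 0)) = A $$ (i, j) * f j"
    using assms(3) by (subst sum.remove[of _ j]) auto
  ultimately show "(dmat n f * A) $$ (i, j) = f i * A $$ (i, j)"
    "(A * dmat n f) $$ (i, j) = A $$ (i, j) * f j"
    using assms by (simp_all add: scalar_prod_def dmat_def)
qed

lemma dmat_mult: "dmat n f * dmat n g = dmat n (\<lambda>i. f i * g i)"
proof (rule eq_matI)
  fix i j assume "i < dim_row (dmat n (\<lambda>i. f i * g i))" "j < dim_col (dmat n (\<lambda>i. f i * g i))"
  then show "(dmat n f * dmat n g) $$ (i, j) = dmat n (\<lambda>i. f i * g i) $$ (i, j)"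
    by (simp add: dmat_mult_index dmat_index del: index_mult_mat(1))
qed simp_all

lemma dmat_one: "dmat n (\<lambda>_. 1) = 1\<^sub>m n"
  by (rule eq_matI) (auto simp: dmat_index)

lemma dmat_cong: "(\<And>i. i < n \<Longrightarrow> f i = g i) \<Longrightarrow> dmat n f = dmat n g"
  by (rule eq_matI) (auto simp: dmat_index)

lemma det_dmat: "det (dmat n f) = (\<Prod>i<n. f i)"
proof -
  have "det (dmat n f) = prod_list (diag_mat (dmat n f))"
    by (rule det_upper_triangular[of _ n]) (auto simp: upper_triangular_def dmat_index)
  also have "diag_mat (dmat n f) = map f [0..<n]"
    by (auto simp: diag_mat_def dmat_index intro!: map_cong)
  also have "prod_list (map f [0..<n]) = (\<Prod>i<n. f i)"
    by (simp add: prod.distinct_set_conv_list[symmetric] lessThan_atLeast0)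
  finally show ?thesis .
qed

lemma dmat_in_GL: "dmat n f \<in> carrier (GL n) \<longleftrightarrow> (\<forall>i<n. f i \<noteq> 0)"
  by (auto simp: carrier_GL_iff det_dmat)

lemma diagonal_mat_iff_dmat:
  assumes "A \<in> carrier_mat n n"
  shows "diagonal_mat A \<longleftrightarrow> A = dmat n (\<lambda>i. A $$ (i, i))"
proof
  assume "diagonal_mat A"
  then show "A = dmat n (\<lambda>i. A $$ (i, i))"
    using assms by (intro eq_matI) (auto simp: diagonal_mat_def dmat_index)
next
  assume *: "A = dmat n (\<lambda>i. A $$ (i, i))"
  show "diagonal_mat A"
    by (subst *) (simp add: diagonal_mat_def dmat_index)
qed

lemma diag_groupE:
  assumes "A \<in> diag_group r"
  obtains f where "A = dmat r f" "\<And>i. f i \<noteq> 0"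
proof -
  have A: "A \<in> carrier (GL r)" "diagonal_mat A" using assms by (auto simp: diag_group_def)
  have 1: "A = dmat r (\<lambda>i. A $$ (i, i))"
    using A diagonal_mat_iff_dmat GL_carrier_mat by blast
  then have 2: "A $$ (i, i) \<noteq> 0" if "i < r" for i
    using A(1) dmat_in_GL[of r "\<lambda>i. A $$ (i, i)"] that by simp
  \<comment> \<open>Indices from \<open>r\<close> on are filled with 1, so that \<open>f\<close>
    vanishes nowhere and can be handled without bounds on the index.\<close>
  have "dmat r (\<lambda>i. if i < r then A $$ (i, i) else 1) = dmat r (\<lambda>i. A $$ (i, i))"
    by (rule dmat_cong) simp
  then show ?thesis using 1 2 that[of "\<lambda>i. if i < r then A $$ (i, i) else 1"] by simp
qed

lemma dmat_in_diag_group: "(\<And>i. i < r \<Longrightarrow> f i \<noteq> 0) \<Longrightarrow> dmat r f \<in> diag_group r"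
  by (simp add: diag_group_def dmat_in_GL diagonal_mat_def dmat_index)

lemma diag_group_subset_GL: "diag_group r \<subseteq> carrier (GL r)"
  by (auto simp: diag_group_def)

text \<open>The columns of an invertible matrix are exchanged one by one; as a function of a single
  column the determinant is a nonzero linear functional, given by the cofactors.\<close>

lemma separating_set_contains_basis:
  fixes E :: "'a::field vec set"
  assumes E: "E \<subseteq> carrier_vec n"
    and sep: "\<And>w. w \<in> carrier_vec n \<Longrightarrow> w \<noteq> 0\<^sub>v n \<Longrightarrow> \<exists>v\<in>E. w \<bullet> v \<noteq> 0"
  shows "\<exists>P\<in>carrier (GL n). \<forall>j<n. col P j \<in> E"
proof -
  have "\<exists>P\<in>carrier (GL n). \<forall>j<k. col P j \<in> E" if "k \<le> n" for k
    using that
  proof (induction k)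
    case 0
    show ?case by (intro bexI[of _ "1\<^sub>m n"]) (simp_all add: carrier_GL_iff)
  next
    case (Suc k)
    then obtain P where P: "P \<in> carrier (GL n)" "\<And>j. j < k \<Longrightarrow> col P j \<in> E" by auto
    have Pn: "P \<in> carrier_mat n n" "det P \<noteq> 0" and k: "k < n"
      using P Suc by (auto simp: carrier_GL_iff)
    define w where "w = vec n (\<lambda>i. cofactor P i k)"
    have "w \<noteq> 0\<^sub>v n"
    proof
      assume "w = 0\<^sub>v n"
      then have "cofactor P i k = 0" if "i < n" for i
        using that by (metis w_def index_vec index_zero_vec(1))
      then show False using Pn laplace_expansion_column[OF Pn(1) k] by simp
    qed
    then obtain v where v: "v \<in> E" "w \<bullet> v \<noteq> 0" using sep[of w] by (auto simp: w_def)
    have vn: "v \<in> carrier_vec n" using v E by auto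
    define Q where "Q = mat n n (\<lambda>(i, j). if j = k then v $ i else P $$ (i, j))"
    have Q: "Q \<in> carrier_mat n n" by (simp add: Q_def)
    have "mat_delete Q i k = mat_delete P i k" if "i < n" for i
      using Pn(1) that k by (intro eq_matI) (auto simp: mat_delete_def Q_def)
    then have "det Q = (\<Sum>i<n. v $ i * cofactor P i k)"
      using laplace_expansion_column[OF Q k] k by (simp add: cofactor_def Q_def)
    also have "\<dots> = w \<bullet> v"
      using vn by (simp add: scalar_prod_def w_def lessThan_atLeast0 mult.commute)
    finally have "Q \<in> carrier (GL n)" using v Q by (simp add: carrier_GL_iff)
    moreover have "col Q j \<in> E" if "j < Suc k" for j
    proof (cases "j = k")
      case True
      have "col Q k = v" using k vn by (intro eq_vecI) (auto simp: Q_def)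
      then show ?thesis using v True by simp
    next
      case False
      then have "col Q j = col P j" using that k Pn(1) by (intro eq_vecI) (auto simp: Q_def)
      then show ?thesis using P(2)[of j] that False by simp
    qed
    ultimately show ?case by blast
  qed
  then show ?thesis by blast
qed

section \<open>Weight vectors of one-parameter subgroups\<close>

lemma poly_eq_sum_atMost:
  fixes p :: "'a::comm_semiring_1 poly"
  assumes "Polynomial.degree p \<le> d"
  shows "poly p x = (\<Sum>i\<le>d. Polynomial.coeff p i * x ^ i)"
  unfolding poly_altdef
  by (rule sum.mono_neutral_left) (use assms in \<open>auto simp: Polynomial.coeff_eq_0\<close>)

text \<open>Writing \<open>M z = z\<^sup>-\<^sup>K (\<Sum>l\<le>d. z\<^sup>l A l)\<close>, comparison of coefficients in
  \<open>M (z w) = M w M z\<close> shows that the image of \<open>A l\<close> is a weight space.\<close>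

lemma one_parameter_weights:
  fixes M :: "'a::field \<Rightarrow> 'a mat"
  assumes inf: "infinite (UNIV :: 'a set)"
    and M: "\<And>z. z \<noteq> 0 \<Longrightarrow> M z \<in> carrier_mat n n"
    and one: "M 1 = 1\<^sub>m n"
    and hom: "\<And>z w. z \<noteq> 0 \<Longrightarrow> w \<noteq> 0 \<Longrightarrow> M (z * w) = M w * M z"
    and q: "\<And>z a b. z \<noteq> 0 \<Longrightarrow> a < n \<Longrightarrow> b < n \<Longrightarrow> z ^ K * M z $$ (a, b) = poly (q a b) z"
  shows "\<exists>(A :: nat \<Rightarrow> 'a mat) d. (\<forall>l. A l \<in> carrier_mat n n) \<and>
    (\<forall>a b. a < n \<longrightarrow> b < n \<longrightarrow> (\<Sum>l\<le>d. A l $$ (a, b)) = 1\<^sub>m n $$ (a, b)) \<and>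
    (\<forall>w l. w \<noteq> 0 \<longrightarrow> M w * A l = (w ^ l / w ^ K) \<cdot>\<^sub>m A l) \<and>
    (\<forall>Y l. Y \<in> carrier_mat n n \<longrightarrow> (\<forall>z. z \<noteq> 0 \<longrightarrow> Y * M z = M z * Y) \<longrightarrow> Y * A l = A l * Y)"
proof -
  define A where "A l = mat n n (\<lambda>(a, b). Polynomial.coeff (q a b) l)" for l
  \<comment> \<open>Any common bound for the degrees will do, and the sum is one. With it,
    evaluation at \<open>z = 1\<close> turns \<open>M 1 = 1\<close> into the statement that the
    \<open>A l\<close> add up to the identity.\<close>
  define d where "d = (\<Sum>a<n. \<Sum>b<n. Polynomial.degree (q a b))"
  have inf': "infinite (UNIV - {0 :: 'a})" using inf by simp
  have A [simp]: "A l \<in> carrier_mat n n" "dim_row (A l) = n" "dim_col (A l) = n" for l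
    by (simp_all add: A_def)
  have idx: "A l $$ (a, b) = Polynomial.coeff (q a b) l" if "a < n" "b < n" for a b l
    using that by (simp add: A_def)
  have mi: "(Y * Z) $$ (a, b) = (\<Sum>c<n. Y $$ (a, c) * Z $$ (c, b))"
    if "Y \<in> carrier_mat n n" "Z \<in> carrier_mat n n" "a < n" "b < n" for Y Z :: "'a mat" and a b
    using that by (simp add: scalar_prod_def lessThan_atLeast0)
  have 1: "(\<Sum>l\<le>d. A l $$ (a, b)) = 1\<^sub>m n $$ (a, b)" if ab: "a < n" "b < n" for a b
  proof -
    have "Polynomial.degree (q a b) \<le> (\<Sum>b<n. Polynomial.degree (q a b))"
      using ab by (intro member_le_sum) auto
    also have "\<dots> \<le> d"
      unfolding d_def using ab by (intro member_le_sum[of a "{..<n}" "\<lambda>a. \<Sum>b<n. Polynomial.degree (q a b)"]) auto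
    finally have "poly (q a b) 1 = (\<Sum>l\<le>d. Polynomial.coeff (q a b) l)"
      by (simp add: poly_eq_sum_atMost)
    then show ?thesis using q[of 1 a b] one ab by (simp add: idx)
  qed
  have 2: "M w * A l = (w ^ l / w ^ K) \<cdot>\<^sub>m A l" if w: "w \<noteq> 0" for w l
  proof (rule eq_matI)
    fix a b assume "a < dim_row ((w ^ l / w ^ K) \<cdot>\<^sub>m A l)" "b < dim_col ((w ^ l / w ^ K) \<cdot>\<^sub>m A l)"
    then have ab: "a < n" "b < n" by auto
    \<comment> \<open>For fixed \<open>w\<close>, both sides are polynomials in \<open>z\<close>
      that express \<open>M w * M z = M (z * w)\<close> with denominators cleared. Composition with
      \<open>[:0, w:]\<close> substitutes \<open>w z\<close> and so scales the coefficient of index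
      \<open>l\<close> by \<open>w ^ l\<close>.\<close>
    have "(\<Sum>c<n. Polynomial.smult (M w $$ (a, c)) (q c b)) = Polynomial.smult (1 / w ^ K) (pcompose (q a b) [:0, w:])"
    proof (rule poly_eqI_infinite[OF inf'])
      fix z assume "z \<in> UNIV - {0 :: 'a}"
      then have z: "z \<noteq> 0" by simp
      have "poly (\<Sum>c<n. Polynomial.smult (M w $$ (a, c)) (q c b)) z
          = (\<Sum>c<n. M w $$ (a, c) * (z ^ K * M z $$ (c, b)))"
        using q[OF z] ab by (simp add: poly_sum)
      also have "\<dots> = z ^ K * (M w * M z) $$ (a, b)"
        using mi[OF M[OF w] M[OF z] ab] by (simp add: sum_distrib_left algebra_simps)
      also have "\<dots> = 1 / w ^ K * ((z * w) ^ K * M (z * w) $$ (a, b))"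
        using hom[OF z w] w by (simp add: field_simps power_mult_distrib)
      also have "\<dots> = poly (Polynomial.smult (1 / w ^ K) (pcompose (q a b) [:0, w:])) z"
        using q[of "z * w" a b] ab z w by (simp add: poly_pcompose mult.commute)
      finally show "poly (\<Sum>c<n. Polynomial.smult (M w $$ (a, c)) (q c b)) z = \<dots>" .
    qed
    then have "Polynomial.coeff (\<Sum>c<n. Polynomial.smult (M w $$ (a, c)) (q c b)) l
        = Polynomial.coeff (Polynomial.smult (1 / w ^ K) (pcompose (q a b) [:0, w:])) l" by simp
    then show "(M w * A l) $$ (a, b) = ((w ^ l / w ^ K) \<cdot>\<^sub>m A l) $$ (a, b)"
      using ab mi[OF M[OF w] A(1)[of l] ab]
      by (simp add: Polynomial.coeff_sum idx coeff_pcompose_linear mult.commute del: index_mult_mat(1))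
  qed (use M[OF w] in auto)
  have 3: "Y * A l = A l * Y"
    if Y: "Y \<in> carrier_mat n n" and comm: "\<And>z. z \<noteq> 0 \<Longrightarrow> Y * M z = M z * Y" for Y l
  proof (rule eq_matI)
    fix a b assume "a < dim_row (A l * Y)" "b < dim_col (A l * Y)"
    then have ab: "a < n" "b < n" using Y by auto
    \<comment> \<open>The same comparison of coefficients, now for \<open>Y * M z = M z * Y\<close>.
      It will let the weight vectors of one coordinate stay eigenvectors for the coordinates treated
      before.\<close>
    have "(\<Sum>c<n. Polynomial.smult (Y $$ (a, c)) (q c b)) = (\<Sum>c<n. Polynomial.smult (Y $$ (c, b)) (q a c))"
    proof (rule poly_eqI_infinite[OF inf'])
      fix z assume "z \<in> UNIV - {0 :: 'a}"
      then have z: "z \<noteq> 0" by simp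
      have "poly (\<Sum>c<n. Polynomial.smult (Y $$ (a, c)) (q c b)) z
          = (\<Sum>c<n. Y $$ (a, c) * (z ^ K * M z $$ (c, b)))"
        using q[OF z] ab by (simp add: poly_sum)
      also have "\<dots> = z ^ K * (Y * M z) $$ (a, b)"
        using mi[OF Y M[OF z] ab] by (simp add: sum_distrib_left algebra_simps)
      also have "\<dots> = z ^ K * (M z * Y) $$ (a, b)" by (simp only: comm[OF z])
      also have "\<dots> = (\<Sum>c<n. Y $$ (c, b) * (z ^ K * M z $$ (a, c)))"
        using mi[OF M[OF z] Y ab] by (simp add: sum_distrib_left algebra_simps)
      also have "\<dots> = poly (\<Sum>c<n. Polynomial.smult (Y $$ (c, b)) (q a c)) z"
        using q[OF z] ab by (simp add: poly_sum)
      finally show "poly (\<Sum>c<n. Polynomial.smult (Y $$ (a, c)) (q c b)) z = \<dots>" .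
    qed
    then have "Polynomial.coeff (\<Sum>c<n. Polynomial.smult (Y $$ (a, c)) (q c b)) l
        = Polynomial.coeff (\<Sum>c<n. Polynomial.smult (Y $$ (c, b)) (q a c)) l" by simp
    then show "(Y * A l) $$ (a, b) = (A l * Y) $$ (a, b)"
      using ab mi[OF Y A(1)[of l] ab] mi[OF A(1)[of l] Y ab]
      by (simp add: Polynomial.coeff_sum idx mult.commute del: index_mult_mat(1))
  qed (use Y in auto)
  show ?thesis using A(1) 1 2 3 by (intro exI[of _ A] exI[of _ d] conjI allI impI) blast+
qed

lemma is_torusE:
  assumes "is_torus n T"
  obtains r \<phi> where "subgroup T (GL n)" "T \<subseteq> carrier (GL n)" "closedin (zariski_GL n) T"
    and "bij_betw \<phi> (diag_group r) T"
    and "\<And>x y. x \<in> diag_group r \<Longrightarrow> y \<in> diag_group r \<Longrightarrow> \<phi> (x * y) = \<phi> x * \<phi> y"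
    and "\<phi> (1\<^sub>m r) = 1\<^sub>m n"
    and "regular_map r (diag_group r) n \<phi>" "regular_map n T r (inv_into (diag_group r) \<phi>)"
proof -
  obtain r \<phi> where T: "subgroup T (GL n)" "closedin (zariski_GL n) T"
    and iso: "\<phi> \<in> iso (GL r\<lparr>carrier := diag_group r\<rparr>) (GL n\<lparr>carrier := T\<rparr>)"
    and reg: "regular_map r (diag_group r) n \<phi>" "regular_map n T r (inv_into (diag_group r) \<phi>)"
    using assms unfolding is_torus_def by blast
  have TG: "T \<subseteq> carrier (GL n)" using T(1) by (rule subgroup.subset)
  have bij: "bij_betw \<phi> (diag_group r) T" using iso by (simp add: iso_def)
  have hom: "\<phi> (x * y) = \<phi> x * \<phi> y" if "x \<in> diag_group r" "y \<in> diag_group r" for x y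
    using iso that by (auto simp: iso_def hom_def)
  have one: "1\<^sub>m r \<in> diag_group r"
    using dmat_in_diag_group[of r "\<lambda>_. 1"] by (simp add: dmat_one)
  then have p: "\<phi> (1\<^sub>m r) \<in> carrier (GL n)" using bij TG by (auto simp: bij_betw_def)
  have "\<phi> (1\<^sub>m r) * \<phi> (1\<^sub>m r) = \<phi> (1\<^sub>m r) * 1\<^sub>m n"
    using hom[OF one one] GL_carrier_mat[OF p] by simp
  from GL_cancel_left[where k = n, OF p _ _ this] have "\<phi> (1\<^sub>m r) = 1\<^sub>m n"
    using GL_carrier_mat[OF p] by simp
  then show ?thesis using T TG bij hom reg that by blast
qed

text \<open>On the diagonal matrices with \<open>z\<close> in place \<open>s\<close> and 1 elsewhere
  the determinant is \<open>z\<close>, so regular functions restrict to Laurent polynomials in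
  \<open>z\<close>; one power of \<open>z\<close> clears the denominators of all entries.\<close>

lemma regular_map_poly_curve:
  fixes \<phi> :: "'a::field mat \<Rightarrow> 'a mat"
  assumes \<phi>: "regular_map r (diag_group r) n \<phi>" and s: "s < r"
  shows "\<exists>K q. \<forall>z. z \<noteq> 0 \<longrightarrow> (\<forall>a<n. \<forall>b<n.
    z ^ K * \<phi> (dmat r ((\<lambda>_. 1)(s := z))) $$ (a, b) = poly (q a b) z)"
proof -
  define L :: "'a \<Rightarrow> 'a mat" where "L z = dmat r ((\<lambda>_. 1)(s := z))" for z
  have detL: "det (L z) = z" for z
    unfolding L_def det_dmat using s by (subst prod.remove[of _ s]) auto
  have L: "L z \<in> diag_group r" if "z \<noteq> 0" for z
    unfolding L_def using that by (intro dmat_in_diag_group) auto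
  have "\<exists>p k. \<forall>z. z \<noteq> 0 \<longrightarrow> \<phi> (L z) $$ (a, b) = poly p z / z ^ k" if "a < n" "b < n" for a b
  proof -
    obtain P k where P: "P \<in> poly_funs r" "\<And>A. A \<in> diag_group r \<Longrightarrow> \<phi> A $$ (a, b) = P A / det A ^ k"
    proof -
      have "regular_fun r (diag_group r) (\<lambda>A. \<phi> A $$ (a, b))"
        using \<phi> \<open>a < n\<close> \<open>b < n\<close> by (simp add: regular_map_def)
      then obtain P k where P: "P \<in> poly_funs r"
        "\<forall>A\<in>diag_group r. \<phi> A $$ (a, b) = P A / det A ^ k"
        unfolding regular_fun_def by (elim bexE exE)
      show thesis by (rule that[OF P(1) P(2)[rule_format]])
    qed
    have "\<exists>p. \<forall>z\<in>UNIV. P (L z) = poly p z"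
    proof (rule poly_funs_on_curve[OF P(1)])
      fix i j assume "i < r" "j < r"
      then show "\<exists>q. \<forall>z\<in>UNIV. L z $$ (i, j) = poly q z"
        by (intro exI[of _ "if i = j then if i = s then [:0, 1:] else 1 else 0"])
          (simp add: L_def dmat_index)
    qed
    then obtain p where "\<And>z. P (L z) = poly p z" by auto
    then show ?thesis using P(2)[OF L] detL by auto
  qed
  then obtain p k where pk: "\<And>a b z. a < n \<Longrightarrow> b < n \<Longrightarrow> z \<noteq> 0 \<Longrightarrow>
      \<phi> (L z) $$ (a, b) = poly (p a b) z / z ^ k a b"
    by metis
  define K where "K = (\<Sum>a<n. \<Sum>b<n. k a b)"
  have K: "k a b \<le> K" if "a < n" "b < n" for a b
  proof -
    have "k a b \<le> (\<Sum>b<n. k a b)" using that by (intro member_le_sum) auto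
    also have "\<dots> \<le> K"
      unfolding K_def using that by (intro member_le_sum[of a "{..<n}" "\<lambda>a. \<Sum>b<n. k a b"]) auto
    finally show ?thesis .
  qed
  have "z ^ K * \<phi> (L z) $$ (a, b) = poly (p a b * [:0, 1:] ^ (K - k a b)) z"
    if "z \<noteq> 0" "a < n" "b < n" for z a b
  proof -
    have "z ^ K = z ^ (K - k a b) * z ^ k a b"
      using K[OF that(2,3)] by (simp flip: power_add)
    then show ?thesis using pk[OF that(2,3,1)] that(1) by (simp add: poly_power)
  qed
  then show ?thesis unfolding L_def
    by (intro exI[of _ K] exI[of _ "\<lambda>a b. p a b * [:0, 1:] ^ (K - k a b)"]) blast
qed

text \<open>Coordinates of the diagonal group are treated one at a time. What is carried along is
  that no nonzero functional \<open>w\<close> vanishes on all simultaneous eigenvectors: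
  \<open>v\<close> is the sum of its weight components \<open>A l v\<close>, so \<open>w v\<close>
  nonzero forces some \<open>w (A l v)\<close> nonzero. Such a separating set contains a basis,
  whose matrix is \<open>P\<close>.\<close>

lemma torus_diagonalizable:
  fixes T :: "'a::field mat set"
  assumes inf: "infinite (UNIV :: 'a set)" and T: "is_torus n T"
  shows "\<exists>P\<in>carrier (GL n). \<forall>t\<in>T. \<exists>c. t * P = P * dmat n c"
proof -
  obtain r \<phi> where TG: "T \<subseteq> carrier (GL n)" and bij: "bij_betw \<phi> (diag_group r) T"
    and hom: "\<And>x y. x \<in> diag_group r \<Longrightarrow> y \<in> diag_group r \<Longrightarrow> \<phi> (x * y) = \<phi> x * \<phi> y"
    and one: "\<phi> (1\<^sub>m r) = 1\<^sub>m n" and reg: "regular_map r (diag_group r) n \<phi>"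
    using is_torusE[OF T] by metis
  define \<psi> where "\<psi> f = \<phi> (dmat r f)" for f
  have \<psi>: "\<psi> f \<in> carrier_mat n n" if "\<And>i. f i \<noteq> 0" for f
    using bij TG dmat_in_diag_group[of r f] that GL_carrier_mat
    unfolding \<psi>_def bij_betw_def by blast
  have \<psi>_mult: "\<psi> (\<lambda>i. f i * g i) = \<psi> f * \<psi> g" if "\<And>i. f i \<noteq> 0" "\<And>i. g i \<noteq> 0" for f g
    unfolding \<psi>_def dmat_mult[symmetric] using that by (intro hom dmat_in_diag_group)
  have \<psi>_one: "\<psi> (\<lambda>_. 1) = 1\<^sub>m n" by (simp add: \<psi>_def dmat_one one)
  \<comment> \<open>Simultaneous eigenvectors for the first \<open>s\<close> coordinates:
    \<open>f\<close> may differ from 1 only below \<open>s\<close>. \<open>E 0\<close> contains the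
    unit vectors, and \<open>E r\<close> tests the whole torus.\<close>
  define E where "E s = {v \<in> carrier_vec n. \<forall>f. (\<forall>i. f i \<noteq> 0) \<and> (\<forall>i\<ge>s. f i = 1) \<longrightarrow>
    (\<exists>c. \<psi> f *\<^sub>v v = c \<cdot>\<^sub>v v)}" for s
  have sep: "\<exists>v\<in>E s. w \<bullet> v \<noteq> 0" if "s \<le> r" and w: "w \<in> carrier_vec n" "w \<noteq> 0\<^sub>v n" for s w
    using that(1)
  proof (induction s)
    case 0
    have "\<exists>i<n. w $ i \<noteq> 0"
    proof (rule ccontr)
      assume "\<not> (\<exists>i<n. w $ i \<noteq> 0)"
      then have "w = 0\<^sub>v n" using w(1) by (intro eq_vecI) auto
      then show False using w(2) by simp
    qed
    then obtain i where i: "i < n" "w $ i \<noteq> 0" by blast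
    have "unit_vec n i \<in> E 0"
      unfolding E_def
    proof (intro CollectI conjI allI impI)
      fix f :: "nat \<Rightarrow> 'a" assume "(\<forall>i. f i \<noteq> 0) \<and> (\<forall>i\<ge>0. f i = 1)"
      then have "f = (\<lambda>_. 1)" by auto
      then show "\<exists>c. \<psi> f *\<^sub>v unit_vec n i = c \<cdot>\<^sub>v unit_vec n i"
        by (intro exI[of _ 1]) (simp add: \<psi>_one)
    qed simp
    moreover have "w \<bullet> unit_vec n i = w $ i" using w(1) i(1) by simp
    ultimately show ?case using i(2) by metis
  next
    case (Suc s)
    then obtain v where v: "v \<in> E s" "w \<bullet> v \<noteq> 0" by auto
    have vn: "v \<in> carrier_vec n" using v by (simp add: E_def)
    define M where "M z = \<psi> ((\<lambda>_. 1)(s := z))" for z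
    have Mn: "M z \<in> carrier_mat n n" if "z \<noteq> 0" for z
      unfolding M_def using that by (intro \<psi>) auto
    have M1: "M 1 = 1\<^sub>m n" unfolding M_def using \<psi>_one by (simp add: fun_upd_idem)
    have Mh: "M (z * w) = M w * M z" if "z \<noteq> 0" "w \<noteq> 0" for z w
    proof -
      have "((\<lambda>_. 1)(s := z * w)) = (\<lambda>i. ((\<lambda>_. 1)(s := w)) i * ((\<lambda>_. 1)(s := z)) i)"
        by (auto simp: fun_eq_iff)
      then have "\<psi> ((\<lambda>_. 1)(s := z * w)) =
          \<psi> (\<lambda>i. ((\<lambda>_. 1)(s := w)) i * ((\<lambda>_. 1)(s := z)) i)" by (rule arg_cong)
      also have "\<dots> = M w * M z" unfolding M_def using that by (intro \<psi>_mult) auto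
      finally show ?thesis by (simp only: M_def)
    qed
    obtain K q where q: "\<And>z a b. z \<noteq> 0 \<Longrightarrow> a < n \<Longrightarrow> b < n \<Longrightarrow>
        z ^ K * M z $$ (a, b) = poly (q a b) z"
    proof -
      have "s < r" using Suc.prems by simp
      from regular_map_poly_curve[OF reg this]
      have "\<exists>K q. \<forall>z. z \<noteq> 0 \<longrightarrow> (\<forall>a<n. \<forall>b<n. z ^ K * M z $$ (a, b) = poly (q a b) z)"
        unfolding M_def \<psi>_def .
      then obtain K q where
        "\<forall>z. z \<noteq> 0 \<longrightarrow> (\<forall>a<n. \<forall>b<n. z ^ K * M z $$ (a, b) = poly (q a b) z)"
        by (elim exE)
      then show thesis using that by blast
    qed
    obtain A d where A: "\<And>l. A l \<in> carrier_mat n n"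
      and A1: "\<And>a b. a < n \<Longrightarrow> b < n \<Longrightarrow> (\<Sum>l\<le>d. A l $$ (a, b)) = 1\<^sub>m n $$ (a, b)"
      and AM: "\<And>w l. w \<noteq> 0 \<Longrightarrow> M w * A l = (w ^ l / w ^ K) \<cdot>\<^sub>m A l"
      and AY: "\<And>Y l. Y \<in> carrier_mat n n \<Longrightarrow> (\<And>z. z \<noteq> 0 \<Longrightarrow> Y * M z = M z * Y) \<Longrightarrow>
        Y * A l = A l * Y"
    proof -
      have "\<exists>A d. (\<forall>l. A l \<in> carrier_mat n n) \<and>
        (\<forall>a b. a < n \<longrightarrow> b < n \<longrightarrow> (\<Sum>l\<le>d. A l $$ (a, b)) = 1\<^sub>m n $$ (a, b)) \<and>
        (\<forall>w l. w \<noteq> 0 \<longrightarrow> M w * A l = (w ^ l / w ^ K) \<cdot>\<^sub>m A l) \<and>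
        (\<forall>Y l. Y \<in> carrier_mat n n \<longrightarrow> (\<forall>z. z \<noteq> 0 \<longrightarrow> Y * M z = M z * Y) \<longrightarrow> Y * A l = A l * Y)"
        by (rule one_parameter_weights[OF inf Mn M1 Mh q])
      then show thesis using that by blast
    qed
    have AE: "A l *\<^sub>v v \<in> E (Suc s)" for l
      unfolding E_def
    proof (intro CollectI conjI allI impI)
      show "A l *\<^sub>v v \<in> carrier_vec n" using A vn by (rule mult_mat_vec_carrier)
      fix f :: "nat \<Rightarrow> 'a" assume f: "(\<forall>i. f i \<noteq> 0) \<and> (\<forall>i\<ge>Suc s. f i = 1)"
      \<comment> \<open>Splits \<open>f\<close> into its part below \<open>s\<close>, for which
        \<open>v\<close> is already an eigenvector and which commutes with \<open>A l\<close>, and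
        its coordinate \<open>s\<close>, which acts on the image of \<open>A l\<close> by a
        scalar.\<close>
      define g where "g = f(s := 1)"
      have g: "g i \<noteq> 0" for i using f by (simp add: g_def)
      have "\<forall>i\<ge>s. g i = 1" using f by (auto simp: g_def)
      then obtain c where c: "\<psi> g *\<^sub>v v = c \<cdot>\<^sub>v v" using v(1) g unfolding E_def by blast
      have "f = (\<lambda>i. g i * ((\<lambda>_. 1)(s := f s)) i)" by (auto simp: g_def fun_eq_iff)
      then have fg: "\<psi> f = \<psi> g * M (f s)"
        using \<psi>_mult[of g "(\<lambda>_. 1)(s := f s)"] g f by (simp add: M_def)
      have comm: "\<psi> g * M z = M z * \<psi> g" if "z \<noteq> 0" for z
        using \<psi>_mult[of g "(\<lambda>_. 1)(s := z)"] \<psi>_mult[of "(\<lambda>_. 1)(s := z)" g] g that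
        by (simp add: M_def mult.commute)
      let ?k = "f s ^ l / f s ^ K"
      have gn: "\<psi> g \<in> carrier_mat n n" and fs: "f s \<noteq> 0" using g f by (auto intro: \<psi>)
      have "\<psi> f *\<^sub>v (A l *\<^sub>v v) = \<psi> g *\<^sub>v ((M (f s) * A l) *\<^sub>v v)"
        using gn Mn[OF fs] A[of l] vn mult_mat_vec_carrier[OF A[of l] vn]
        by (simp add: fg assoc_mult_mat_vec[of _ n n _ n])
      also have "\<dots> = ?k \<cdot>\<^sub>v ((\<psi> g * A l) *\<^sub>v v)"
        using gn A[of l] vn mult_mat_vec_carrier[OF A[of l] vn] by (simp add: AM[OF fs] smult_mat_mult_vec[of _ n n] mult_mat_vec[of _ n n]
            assoc_mult_mat_vec[of _ n n _ n])
      also have "\<psi> g * A l = A l * \<psi> g" using gn comm by (rule AY)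
      also have "(A l * \<psi> g) *\<^sub>v v = c \<cdot>\<^sub>v (A l *\<^sub>v v)"
        using gn A[of l] vn by (simp add: assoc_mult_mat_vec[of _ n n _ n] c mult_mat_vec[of _ n n])
      finally show "\<exists>c. \<psi> f *\<^sub>v (A l *\<^sub>v v) = c \<cdot>\<^sub>v (A l *\<^sub>v v)"
        by (auto simp: smult_smult_assoc)
    qed
    have exp: "w \<bullet> (B *\<^sub>v v) = (\<Sum>a<n. \<Sum>b<n. w $ a * B $$ (a, b) * v $ b)"
      if "B \<in> carrier_mat n n" for B
      using that w(1) vn
      by (simp add: scalar_prod_def lessThan_atLeast0 sum_distrib_left mult.assoc)
    have "(\<Sum>l\<le>d. w \<bullet> (A l *\<^sub>v v)) = (\<Sum>l\<le>d. \<Sum>a<n. \<Sum>b<n. w $ a * A l $$ (a, b) * v $ b)"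
      by (simp add: exp A)
    also have "\<dots> = (\<Sum>a<n. \<Sum>b<n. \<Sum>l\<le>d. w $ a * A l $$ (a, b) * v $ b)"
      by (subst sum.swap) (intro sum.cong refl sum.swap)
    also have "\<dots> = (\<Sum>a<n. \<Sum>b<n. w $ a * 1\<^sub>m n $$ (a, b) * v $ b)"
      by (intro sum.cong refl) (simp add: A1[symmetric] sum_distrib_left sum_distrib_right del: index_one_mat)
    also have "\<dots> = w \<bullet> v" using exp[of "1\<^sub>m n"] vn by simp
    finally have "(\<Sum>l\<le>d. w \<bullet> (A l *\<^sub>v v)) \<noteq> 0" using v(2) by simp
    then obtain l where "w \<bullet> (A l *\<^sub>v v) \<noteq> 0" by (meson sum.neutral)
    then show ?case using AE by blast
  qed
  have "E r \<subseteq> carrier_vec n" by (auto simp: E_def)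
  then obtain P where P: "P \<in> carrier (GL n)" "\<And>j. j < n \<Longrightarrow> col P j \<in> E r"
    using separating_set_contains_basis[of "E r" n] sep[of r] by auto
  have "\<exists>c. t * P = P * dmat n c" if "t \<in> T" for t
  proof -
    obtain A where A: "A \<in> diag_group r" "t = \<phi> A" using bij \<open>t \<in> T\<close> by (auto simp: bij_betw_def)
    from A(1) obtain f where f: "A = dmat r f" "\<And>i. f i \<noteq> 0" using diag_groupE by metis
    \<comment> \<open>Padding with 1 meets the condition of \<open>E r\<close> on indices from
      \<open>r\<close> on.\<close>
    define g where "g i = (if i < r then f i else 1)" for i
    have g: "\<forall>i. g i \<noteq> 0" "\<forall>i\<ge>r. g i = 1" using f by (auto simp: g_def)
    have "dmat r f = dmat r g" by (rule dmat_cong) (simp add: g_def)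
    then have tg: "t = \<psi> g" using A f by (simp add: \<psi>_def)
    have "\<exists>c. t *\<^sub>v col P j = c \<cdot>\<^sub>v col P j" if "j < n" for j
      using P(2)[OF that] g tg by (simp add: E_def)
    then obtain c where c: "\<And>j. j < n \<Longrightarrow> t *\<^sub>v col P j = c j \<cdot>\<^sub>v col P j" by metis
    have Pn: "P \<in> carrier_mat n n" "t \<in> carrier_mat n n"
      using P TG that by (auto simp: carrier_GL_iff)
    have "t * P = P * dmat n c"
    proof (rule eq_matI)
      fix i j assume "i < dim_row (P * dmat n c)" "j < dim_col (P * dmat n c)"
      then have ij: "i < n" "j < n" using Pn by auto
      have "(t * P) $$ (i, j) = (t *\<^sub>v col P j) $ i" using ij Pn by simp
      also have "\<dots> = P $$ (i, j) * c j" using ij Pn by (simp add: c)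
      finally show "(t * P) $$ (i, j) = (P * dmat n c) $$ (i, j)"
        using dmat_mult_index(2)[OF Pn(1) ij] by simp
    qed (use Pn in auto)
    then show ?thesis by (rule exI[where x = c])
  qed
  then show ?thesis using P(1) by blast
qed

text \<open>Square roots are taken in each diagonal coordinate and transported by the isomorphism.
  This is the property of a torus that later separates it from reflections.\<close>

lemma torus_square_root:
  fixes T :: "'a::alg_closed_field mat set"
  assumes T: "is_torus n T" and t: "t \<in> T"
  shows "\<exists>s\<in>T. s * s = t"
proof -
  obtain r and \<phi> :: "'a mat \<Rightarrow> 'a mat" where bij: "bij_betw \<phi> (diag_group r) T"
    and hom: "\<And>x y. x \<in> diag_group r \<Longrightarrow> y \<in> diag_group r \<Longrightarrow> \<phi> (x * y) = \<phi> x * \<phi> y"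
    using is_torusE[OF T] by metis
  obtain A where A: "A \<in> diag_group r" "t = \<phi> A" using bij t by (auto simp: bij_betw_def)
  from A(1) obtain f where f: "A = dmat r f" "\<And>i. f i \<noteq> 0" using diag_groupE by metis
  have "\<exists>y. y * y = f i" for i using nth_root_exists[of 2 "f i"] by (auto simp: power2_eq_square)
  then obtain g where g: "\<And>i. g i * g i = f i" by metis
  have "dmat r g \<in> diag_group r" using f(2) g by (intro dmat_in_diag_group) (metis mult_zero_left)
  then have "\<phi> (dmat r g) \<in> T" "\<phi> (dmat r g) * \<phi> (dmat r g) = t"
    using hom[of "dmat r g" "dmat r g"] bij A f g by (auto simp: dmat_mult bij_betw_def)
  then show ?thesis by blast
qed

section \<open>Conjugates and connectedness of tori\<close>

lemma topspace_zariski_GL: "topspace (zariski_GL n) = (carrier (GL n) :: 'a::field mat set)"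
proof (rule subset_antisym)
  have "openin (zariski_GL n) (topspace (zariski_GL n) :: 'a mat set)" by (rule openin_topspace)
  then show "topspace (zariski_GL n) \<subseteq> (carrier (GL n) :: 'a mat set)"
    by (simp only: openin_zariski_GL)
  have "zariski_closed n ({} :: 'a mat set)"
    unfolding zariski_closed_def
    by (rule exI[of _ "{\<lambda>_. 1}"]) (simp add: poly_funs.const)
  then have "openin (zariski_GL n) (carrier (GL n) :: 'a mat set)"
    by (simp add: openin_zariski_GL)
  then show "(carrier (GL n) :: 'a mat set) \<subseteq> topspace (zariski_GL n)" by (rule openin_subset)
qed

lemma closedin_zariski_GL:
  "closedin (zariski_GL n) V \<longleftrightarrow> V \<subseteq> carrier (GL n) \<and> zariski_closed n V"
  by (auto simp: closedin_def topspace_zariski_GL openin_zariski_GL double_diff)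

text \<open>Conjugation and its inverse \<open>d\<close> are linear in the matrix entries and
  preserve \<open>det\<close>, so every regularity condition carries over. The twisted centralizers
  will turn out to be conjugates of \<open>T\<close>.\<close>

lemma is_torus_conj:
  fixes T :: "'a::field mat set"
  assumes T: "is_torus n T" and g: "g \<in> carrier (GL n)"
  shows "is_torus n ((\<lambda>t. g * t * inv\<^bsub>GL n\<^esub> g) ` T)"
proof -
  define c where "c x = g * x * inv\<^bsub>GL n\<^esub> g" for x
  define d where "d x = inv\<^bsub>GL n\<^esub> g * x * g" for x
  note c = GL_conj[OF g, folded c_def d_def]
  have gn: "g \<in> carrier_mat n n" "inv\<^bsub>GL n\<^esub> g \<in> carrier_mat n n"
    using g inv_GL[OF g] GL_carrier_mat by auto
  obtain r and \<phi> :: "'a mat \<Rightarrow> 'a mat" where sub: "subgroup T (GL n)"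
    and TG: "T \<subseteq> carrier (GL n)" and cl: "closedin (zariski_GL n) T"
    and bij: "bij_betw \<phi> (diag_group r) T"
    and hom: "\<And>x y. x \<in> diag_group r \<Longrightarrow> y \<in> diag_group r \<Longrightarrow> \<phi> (x * y) = \<phi> x * \<phi> y"
    and reg: "regular_map r (diag_group r) n \<phi>" "regular_map n T r (inv_into (diag_group r) \<phi>)"
    using is_torusE[OF T] by metis
  have Tn: "T \<subseteq> carrier_mat n n" using TG GL_carrier_mat by blast
  have cG: "c x \<in> carrier (GL n)" if "x \<in> carrier (GL n)" for x
    using that c(1,5)[of x] by (simp add: carrier_GL_iff)
  have "group_hom (GL n) (GL n) c"
    by (intro group_hom.intro group_GL group_hom_axioms.intro)
      (auto simp: hom_def cG c(4) GL_carrier_mat)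
  then have sub': "subgroup (c ` T) (GL n)"
    using group_hom.subgroup_img_is_subgroup sub by blast
  have cT: "c ` T \<subseteq> carrier (GL n)" using TG cG by blast
  have dG: "d x \<in> carrier (GL n)" if "x \<in> carrier (GL n)" for x
    using that c(7)[of x] gn by (simp add: carrier_GL_iff d_def mult_carrier_mat[of _ n n _ n])
  have dreg: "regular_fun n V (\<lambda>A. d A $$ (i, j))" if "i < n" "j < n" "V \<subseteq> carrier (GL n)" for i j V
    unfolding d_def using that gn GL_carrier_mat
    by (intro regular_fun_conj_index regular_fun_coord) auto
  have cT_iff: "A \<in> c ` T \<longleftrightarrow> d A \<in> T" if "A \<in> carrier_mat n n" for A
    using c(2,3) that Tn by (metis (no_types, lifting) image_iff subsetD)
  obtain \<P> where \<P>: "\<P> \<subseteq> poly_funs n" "T = {A \<in> carrier (GL n). \<forall>P\<in>\<P>. P A = 0}"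
    using cl unfolding closedin_zariski_GL zariski_closed_def by blast
  \<comment> \<open>The equations of the conjugate are those of \<open>T\<close> composed with
    \<open>d\<close>. These are known here as regular functions, so their numerators are used; the
    powers of \<open>det\<close> do not vanish on \<open>GL n\<close>.\<close>
  define \<Q> where "\<Q> = {Q \<in> poly_funs n. \<exists>P\<in>\<P>. \<exists>k. \<forall>A\<in>carrier (GL n). P (d A) = Q A / det A ^ k}"
  have "c ` T = {A \<in> carrier (GL n). \<forall>Q\<in>\<Q>. Q A = 0}"
  proof (rule subset_antisym; rule subsetI)
    fix A assume A: "A \<in> c ` T"
    have AG: "A \<in> carrier (GL n)" using A cT by blast
    have dT: "d A \<in> T" using A AG cT_iff GL_carrier_mat by blast
    have "Q A = 0" if Q: "Q \<in> \<Q>" for Q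
    proof -
      obtain P k where "P \<in> \<P>" "P (d A) = Q A / det A ^ k" using Q AG by (auto simp: \<Q>_def)
      then show ?thesis using dT \<P>(2) AG by (auto simp: carrier_GL_iff)
    qed
    then show "A \<in> {A \<in> carrier (GL n). \<forall>Q\<in>\<Q>. Q A = 0}" using AG by simp
  next
    fix A assume "A \<in> {A \<in> carrier (GL n). \<forall>Q\<in>\<Q>. Q A = 0}"
    then have A: "A \<in> carrier (GL n)" "\<And>Q. Q \<in> \<Q> \<Longrightarrow> Q A = 0" by auto
    have "P (d A) = 0" if "P \<in> \<P>" for P
    proof -
      have "P \<in> poly_funs n" using that \<P>(1) by blast
      then have "regular_fun n (carrier (GL n)) (\<lambda>A. P (d A))"
        by (rule regular_fun_comp_poly[OF subset_refl _ dreg]) auto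
      then obtain Q k where Q: "Q \<in> poly_funs n"
        "\<forall>A\<in>carrier (GL n). P (d A) = Q A / det A ^ k"
        unfolding regular_fun_def by (elim bexE exE)
      then have "Q \<in> \<Q>" using that by (auto simp: \<Q>_def)
      then show ?thesis using Q(2) A by simp
    qed
    then have "d A \<in> T" using \<P>(2) dG[OF A(1)] by simp
    then show "A \<in> c ` T" using cT_iff A(1) GL_carrier_mat by blast
  qed
  then have "zariski_closed n (c ` T)"
    unfolding zariski_closed_def by (intro exI[of _ \<Q>]) (auto simp: \<Q>_def)
  then have cl': "closedin (zariski_GL n) (c ` T)" using cT by (simp add: closedin_zariski_GL)
  have \<phi>T: "\<phi> x \<in> T" if "x \<in> diag_group r" for x using bij that by (auto simp: bij_betw_def)
  have \<phi>n: "\<phi> x \<in> carrier_mat n n" if "x \<in> diag_group r" for x using \<phi>T[OF that] Tn by blast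
  have bc: "bij_betw c T (c ` T)"
    by (rule inj_on_imp_bij_betw, rule inj_on_inverseI[of _ d]) (use c(2) Tn in auto)
  have bij': "bij_betw (c \<circ> \<phi>) (diag_group r) (c ` T)"
    using bij bc by (rule bij_betw_trans)
  have iso': "c \<circ> \<phi> \<in> iso (GL r\<lparr>carrier := diag_group r\<rparr>) (GL n\<lparr>carrier := c ` T\<rparr>)"
    using bij' by (auto simp: iso_def hom_def \<phi>T hom c(4) \<phi>n)
  have reg1: "regular_map r (diag_group r) n (c \<circ> \<phi>)"
    unfolding regular_map_def
  proof (intro conjI allI impI)
    show "(c \<circ> \<phi>) ` diag_group r \<subseteq> carrier (GL n)" using \<phi>T TG cG by auto
    show "regular_fun r (diag_group r) (\<lambda>A. (c \<circ> \<phi>) A $$ (i, j))" if "i < n" "j < n" for i j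
      unfolding c_def o_def using that gn \<phi>n reg(1)
      by (intro regular_fun_conj_index diag_group_subset_GL) (auto simp: regular_map_def)
  qed
  \<comment> \<open>The inverse of \<open>c o \<phi>\<close> is the old inverse preceded by
    \<open>d\<close>, which reduces its regularity to that of the given chart.\<close>
  have inv: "inv_into (diag_group r) (c \<circ> \<phi>) A = inv_into (diag_group r) \<phi> (d A)"
    if "A \<in> c ` T" for A
  proof -
    obtain x where x: "x \<in> diag_group r" "A = c (\<phi> x)"
      using \<open>A \<in> c ` T\<close> bij by (auto simp: bij_betw_def)
    then show ?thesis
      using bij bij' c(2)[OF \<phi>n[OF x(1)]] by (auto simp: bij_betw_def inv_into_f_eq)
  qed
  have dT: "d A \<in> T" if "A \<in> c ` T" for A
    using that cT_iff cT GL_carrier_mat by blast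
  have reg2: "regular_map n (c ` T) r (inv_into (diag_group r) (c \<circ> \<phi>))"
    unfolding regular_map_def
  proof (intro conjI allI impI)
    show "inv_into (diag_group r) (c \<circ> \<phi>) ` c ` T \<subseteq> carrier (GL r)"
      using reg(2) dT inv by (force simp: regular_map_def)
    fix i j assume ij: "i < r" "j < r"
    have det: "regular_fun n (c ` T) (\<lambda>A. 1 / det (d A))"
      by (rule regular_fun_cong[THEN iffD2, OF _ regular_fun_inverse_det])
        (use c(7) cT GL_carrier_mat in auto)
    have "regular_fun n (c ` T) (\<lambda>A. inv_into (diag_group r) \<phi> (d A) $$ (i, j))"
      by (rule regular_fun_comp[OF cT _ dreg dT det, where g = "\<lambda>A. inv_into (diag_group r) \<phi> A $$ (i, j)"])
        (use reg(2) ij cT in \<open>auto simp: regular_map_def\<close>)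
    then show "regular_fun n (c ` T) (\<lambda>A. inv_into (diag_group r) (c \<circ> \<phi>) A $$ (i, j))"
      by (rule regular_fun_cong[THEN iffD2, rotated]) (simp add: inv)
  qed
  have "is_torus n (c ` T)"
    unfolding is_torus_def using sub' cl' iso' reg1 reg2 by blast
  then show ?thesis by (simp add: c_def[abs_def])
qed

text \<open>Any \<open>A\<close> in \<open>D\<^sub>r\<close> is joined to \<open>1\<close> by the part of the affine line
  \<open>1 + z (A - 1)\<close> that lies in \<open>D\<^sub>r\<close>, a cofinite subset of the line.\<close>

lemma identity_component_torus:
  fixes T :: "'a::field mat set"
  assumes inf: "infinite (UNIV :: 'a set)" and T: "is_torus n T"
  shows "identity_component n T = T"
proof -
  obtain r and \<phi> :: "'a mat \<Rightarrow> 'a mat" where TG: "T \<subseteq> carrier (GL n)"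
    and bij: "bij_betw \<phi> (diag_group r) T"
    and one: "\<phi> (1\<^sub>m r) = 1\<^sub>m n"
    and reg: "regular_map r (diag_group r) n \<phi>"
    using is_torusE[OF T] by metis
  have "connected_component_of (subtopology (zariski_GL n) T) (1\<^sub>m n) t" if "t \<in> T" for t
  proof -
    obtain A where A: "A \<in> diag_group r" "t = \<phi> A" using bij \<open>t \<in> T\<close> by (auto simp: bij_betw_def)
    from A(1) obtain f where f: "A = dmat r f" "\<And>i. f i \<noteq> 0" using diag_groupE by metis
    define L where "L z = dmat r (\<lambda>i. 1 + z * (f i - 1))" for z
    define Z where "Z = {z. \<forall>i<r. 1 + z * (f i - 1) \<noteq> 0}"
    have "- Z = (\<Union>i<r. {z. poly [:1, f i - 1:] z = 0})" by (auto simp: Z_def)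
    also have "finite \<dots>" by (intro finite_UN_I poly_roots_finite) auto
    finally have infZ: "infinite Z" using inf by (metis Compl_UNIV_eq finite_Un Un_Diff_cancel
          boolean_algebra.disj_cancel_right)
    have L: "L z \<in> diag_group r" if "z \<in> Z" for z
      using that unfolding L_def Z_def by (intro dmat_in_diag_group) auto
    have \<phi>L: "\<phi> (L z) \<in> T" if "z \<in> Z" for z using bij L[OF that] by (auto simp: bij_betw_def)
    \<comment> \<open>Pulled back to the line, a polynomial function becomes a polynomial in
      \<open>z\<close> over a function without zeros on \<open>Z\<close>, so its nonvanishing is
      decided by the numerator.\<close>
    have curve: "\<exists>q e. \<forall>z\<in>Z. e z \<noteq> 0 \<and> P (\<phi> (L z)) = poly q z / e z" if "P \<in> poly_funs n" for P
    proof -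
      have "regular_fun r (diag_group r) (\<lambda>A. P (\<phi> A))"
        by (rule regular_fun_comp_poly[OF diag_group_subset_GL that])
          (use reg in \<open>simp add: regular_map_def\<close>)
      then obtain Q k where Q: "Q \<in> poly_funs r" "\<forall>A\<in>diag_group r. P (\<phi> A) = Q A / det A ^ k"
        unfolding regular_fun_def by (elim bexE exE)
      have "\<exists>q. \<forall>z\<in>Z. Q (L z) = poly q z"
      proof (rule poly_funs_on_curve[OF Q(1)])
        fix i j assume "i < r" "j < r"
        then show "\<exists>q. \<forall>z\<in>Z. L z $$ (i, j) = poly q z"
          by (intro exI[of _ "if i = j then [:1, f i - 1:] else 0"]) (simp add: L_def dmat_index)
      qed
      then obtain q where q: "\<forall>z\<in>Z. Q (L z) = poly q z" ..
      have "det (L z) ^ k \<noteq> 0" if "z \<in> Z" for z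
        using subsetD[OF diag_group_subset_GL L[OF that]] by (simp add: carrier_GL_iff)
      then show ?thesis using q Q(2) L by (intro exI[of _ q] exI[of _ "\<lambda>z. det (L z) ^ k"]) auto
    qed
    define C where "C = (\<lambda>z. \<phi> (L z)) ` Z"
    have CT: "C \<subseteq> T" using \<phi>L by (auto simp: C_def)
    have "connectedin (zariski_GL n) C"
      unfolding connectedin
    proof (intro conjI notI)
      show "C \<subseteq> topspace (zariski_GL n)" using CT TG by (simp add: topspace_zariski_GL)
      assume "\<exists>E1 E2. openin (zariski_GL n) E1 \<and> openin (zariski_GL n) E2 \<and> C \<subseteq> E1 \<union> E2 \<and>
        E1 \<inter> E2 \<inter> C = {} \<and> E1 \<inter> C \<noteq> {} \<and> E2 \<inter> C \<noteq> {}"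
      then obtain E1 E2 where E: "openin (zariski_GL n) E1" "openin (zariski_GL n) E2"
        "E1 \<inter> E2 \<inter> C = {}" "E1 \<inter> C \<noteq> {}" "E2 \<inter> C \<noteq> {}" by blast
      \<comment> \<open>An open set meeting the curve contains all its points outside the zeros of
        one nonzero polynomial. For two open sets that are disjoint on the curve the product of
        these polynomials would vanish on the infinite set \<open>Z\<close>.\<close>
      have poly: "\<exists>q. q \<noteq> 0 \<and> (\<forall>z\<in>Z. poly q z \<noteq> 0 \<longrightarrow> \<phi> (L z) \<in> U)"
        if U: "openin (zariski_GL n) U" "U \<inter> C \<noteq> {}" for U
      proof -
        obtain \<P> where \<P>: "\<P> \<subseteq> poly_funs n"
          "carrier (GL n) - U = {A \<in> carrier (GL n). \<forall>P\<in>\<P>. P A = 0}"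
          using U(1) unfolding openin_zariski_GL zariski_closed_def by blast
        obtain z0 where z0: "z0 \<in> Z" "\<phi> (L z0) \<in> U" using U(2) by (auto simp: C_def)
        then have "\<phi> (L z0) \<notin> carrier (GL n) - U" "\<phi> (L z0) \<in> carrier (GL n)"
          using \<phi>L TG by auto
        then obtain P where P: "P \<in> \<P>" "P (\<phi> (L z0)) \<noteq> 0" unfolding \<P>(2) by blast
        then obtain q e where q: "\<forall>z\<in>Z. e z \<noteq> 0 \<and> P (\<phi> (L z)) = poly q z / e z"
          using curve[of P] \<P>(1) by blast
        have "q \<noteq> 0" using P(2) q z0(1) by auto
        moreover have "\<phi> (L z) \<in> U" if "z \<in> Z" "poly q z \<noteq> 0" for z
        proof (rule ccontr)
          assume "\<phi> (L z) \<notin> U"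
          then have "\<phi> (L z) \<in> carrier (GL n) - U" using \<phi>L[OF that(1)] TG by blast
          then have "P (\<phi> (L z)) = 0" using P(1) unfolding \<P>(2) by blast
          then show False using q that by auto
        qed
        ultimately show ?thesis by blast
      qed
      obtain q1 q2 where q: "q1 \<noteq> 0" "\<forall>z\<in>Z. poly q1 z \<noteq> 0 \<longrightarrow> \<phi> (L z) \<in> E1"
        "q2 \<noteq> 0" "\<forall>z\<in>Z. poly q2 z \<noteq> 0 \<longrightarrow> \<phi> (L z) \<in> E2"
        using poly[OF E(1,4)] poly[OF E(2,5)] by blast
      have "poly (q1 * q2) z = poly 0 z" if "z \<in> Z" for z
        using q(2,4) that E(3) by (auto simp: C_def)
      then have "q1 * q2 = 0" by (rule poly_eqI_infinite[OF infZ])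
      then show False using q(1,3) by simp
    qed
    then have "connectedin (subtopology (zariski_GL n) T) C"
      using CT by (simp add: connectedin_subtopology)
    moreover have "L 0 = 1\<^sub>m r" "L 1 = A" by (simp_all add: L_def dmat_one f)
    moreover have "0 \<in> Z" "1 \<in> Z" using f(2) by (auto simp: Z_def)
    ultimately show ?thesis
      unfolding connected_component_of_def using A(2) one
      by (intro exI[of _ C]) (auto simp: C_def image_iff intro: bexI[of _ 0] bexI[of _ 1])
  qed
  moreover have "t \<in> T" if "connected_component_of (subtopology (zariski_GL n) T) (1\<^sub>m n) t" for t
    using connected_component_in_topspace[OF that] by simp
  ultimately show ?thesis by (auto simp: identity_component_def)
qed

section \<open>Semisimplicity of the twisted automorphisms\<close>

text \<open>The eigenvalue is required to be nonzero because eigenfunctions of a square are later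
  split by dividing by a square root of it.\<close>

definition eigenfuns :: "nat \<Rightarrow> ('a::field mat \<Rightarrow> 'a mat) \<Rightarrow> ('a mat \<Rightarrow> 'a) set" where
  "eigenfuns n \<tau> = {h. regular_fun n (carrier (GL n)) h \<and>
     (\<exists>c. c \<noteq> 0 \<and> (\<forall>A\<in>carrier (GL n). h (\<tau> A) = c * h A))}"

text \<open>Lists can be concatenated without regard to repeated summands; the finite set that
  \<open>semisimple_aut\<close> demands is recovered at the end by
  \<open>eigenspan_set_sum\<close>.\<close>

definition eigenspan :: "nat \<Rightarrow> ('a::field mat \<Rightarrow> 'a mat) \<Rightarrow> ('a mat \<Rightarrow> 'a) set" where
  "eigenspan n \<tau> = {f. \<exists>hs. set hs \<subseteq> eigenfuns n \<tau> \<and>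
     (\<forall>A\<in>carrier (GL n). f A = (\<Sum>h\<leftarrow>hs. h A))}"

lemma eigenspan_cong:
  "f \<in> eigenspan n \<tau> \<Longrightarrow> (\<And>A. A \<in> carrier (GL n) \<Longrightarrow> g A = f A) \<Longrightarrow> g \<in> eigenspan n \<tau>"
  by (auto simp: eigenspan_def)

lemma eigenfuns_subset_eigenspan: "h \<in> eigenfuns n \<tau> \<Longrightarrow> h \<in> eigenspan n \<tau>"
  unfolding eigenspan_def by (intro CollectI exI[of _ "[h]"]) auto

lemma eigenspan_add:
  assumes "f \<in> eigenspan n \<tau>" "g \<in> eigenspan n \<tau>"
  shows "(\<lambda>A. f A + g A) \<in> eigenspan n \<tau>"
proof -
  obtain hs ks where "set hs \<subseteq> eigenfuns n \<tau>" "\<forall>A\<in>carrier (GL n). f A = (\<Sum>h\<leftarrow>hs. h A)"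
    "set ks \<subseteq> eigenfuns n \<tau>" "\<forall>A\<in>carrier (GL n). g A = (\<Sum>h\<leftarrow>ks. h A)"
    using assms unfolding eigenspan_def by blast
  then show ?thesis unfolding eigenspan_def by (intro CollectI exI[of _ "hs @ ks"]) auto
qed

lemma eigenfuns_mult:
  assumes "h \<in> eigenfuns n \<tau>" "k \<in> eigenfuns n \<tau>"
  shows "(\<lambda>A. h A * k A) \<in> eigenfuns n \<tau>"
proof -
  interpret function_algebra "{f. regular_fun n (carrier (GL n)) f}"
    by (rule function_algebra_regular_fun) simp
  obtain c d where "c \<noteq> 0" "\<forall>A\<in>carrier (GL n). h (\<tau> A) = c * h A"
    "d \<noteq> 0" "\<forall>A\<in>carrier (GL n). k (\<tau> A) = d * k A"
    using assms unfolding eigenfuns_def by blast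
  then have "c * d \<noteq> 0 \<and> (\<forall>A\<in>carrier (GL n). h (\<tau> A) * k (\<tau> A) = (c * d) * (h A * k A))"
    by (simp add: mult_ac)
  moreover have "regular_fun n (carrier (GL n)) (\<lambda>A. h A * k A)"
    using mult[of h k] assms by (simp add: eigenfuns_def)
  ultimately show ?thesis unfolding eigenfuns_def by blast
qed

text \<open>Products of eigenfunctions are eigenfunctions. Hence the span is an algebra, and
  membership of all regular functions need only be checked for the matrix entries and
  \<open>1 / det\<close>.\<close>

lemma function_algebra_eigenspan: "function_algebra (eigenspan n \<tau>)"
proof
  fix c
  have "(\<lambda>_. c) \<in> eigenfuns n \<tau>"
    unfolding eigenfuns_def using regular_fun_const
    by (intro CollectI conjI exI[of _ 1]) auto
  then show "(\<lambda>_. c) \<in> eigenspan n \<tau>" by (rule eigenfuns_subset_eigenspan)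
next
  fix f g assume fg: "f \<in> eigenspan n \<tau>" "g \<in> eigenspan n \<tau>"
  then show "(\<lambda>A. f A + g A) \<in> eigenspan n \<tau>" by (rule eigenspan_add)
  have hk: "(\<lambda>A. h A * g A) \<in> eigenspan n \<tau>" if h: "h \<in> eigenfuns n \<tau>" for h
  proof -
    obtain ks where ks: "set ks \<subseteq> eigenfuns n \<tau>" "\<forall>A\<in>carrier (GL n). g A = (\<Sum>k\<leftarrow>ks. k A)"
      using fg(2) unfolding eigenspan_def by blast
    then show ?thesis unfolding eigenspan_def using eigenfuns_mult[OF h]
      by (intro CollectI exI[of _ "map (\<lambda>k A. h A * k A) ks"])
        (auto simp: sum_list_const_mult o_def)
  qed
  obtain hs where hs: "set hs \<subseteq> eigenfuns n \<tau>" "\<forall>A\<in>carrier (GL n). f A = (\<Sum>h\<leftarrow>hs. h A)"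
    using fg(1) unfolding eigenspan_def by blast
  have "(\<lambda>A. (\<Sum>h\<leftarrow>hs. h A) * g A) \<in> eigenspan n \<tau>" using hs(1)
  proof (induction hs)
    case Nil
    show ?case unfolding eigenspan_def by (intro CollectI exI[of _ "[]"]) auto
  next
    case (Cons h hs)
    then have "h \<in> eigenfuns n \<tau>" "(\<lambda>A. (\<Sum>h\<leftarrow>hs. h A) * g A) \<in> eigenspan n \<tau>" by auto
    from eigenspan_add[OF hk[OF this(1)] this(2)] show ?case by (simp add: algebra_simps)
  qed
  then show "(\<lambda>A. f A * g A) \<in> eigenspan n \<tau>" by (rule eigenspan_cong) (simp add: hs(2))
qed

lemma eigenfuns_const_mult: "h \<in> eigenfuns n \<tau> \<Longrightarrow> (\<lambda>A. c * h A) \<in> eigenfuns n \<tau>"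
  by (rule eigenfuns_mult[of "\<lambda>_. c"]) (auto simp: eigenfuns_def regular_fun_const intro: exI[of _ 1])

text \<open>The set need not be disjoint from \<open>{g}\<close>: a repeated summand is doubled and
  absorbed again.\<close>

lemma eigenfuns_set_sum_insert:
  assumes "finite E" "E \<subseteq> eigenfuns n \<tau>" "g \<in> eigenfuns n \<tau>"
  shows "\<exists>E'. finite E' \<and> E' \<subseteq> eigenfuns n \<tau> \<and> (\<forall>A. (\<Sum>h\<in>E'. h A) = g A + (\<Sum>h\<in>E. h A))"
  using assms
proof (induction "card E" arbitrary: E g rule: less_induct)
  case less
  show ?case
  proof (cases "g \<in> E")
    case False
    then show ?thesis using less.prems by (intro exI[of _ "insert g E"]) auto
  next
    case True
    \<comment> \<open>The doubled function may again coincide with a member of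
      \<open>E - {g}\<close>, so the replacement is iterated, with the cardinality
      decreasing.\<close>
    have "card (E - {g}) < card E"
      using True less.prems(1) by (intro psubset_card_mono) auto
    moreover have "(\<lambda>A. 2 * g A) \<in> eigenfuns n \<tau>"
      using less.prems(3) by (rule eigenfuns_const_mult)
    ultimately obtain E' where E': "finite E'" "E' \<subseteq> eigenfuns n \<tau>"
      "\<forall>A. (\<Sum>h\<in>E'. h A) = 2 * g A + (\<Sum>h\<in>E - {g}. h A)"
      using less.hyps[of "E - {g}" "\<lambda>A. 2 * g A"] less.prems by blast
    have "(\<Sum>h\<in>E'. h A) = g A + (\<Sum>h\<in>E. h A)" for A
    proof -
      have "(\<Sum>h\<in>E. h A) = g A + (\<Sum>h\<in>E - {g}. h A)"
        by (rule sum.remove[OF less.prems(1) True])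
      moreover have "(\<Sum>h\<in>E'. h A) = 2 * g A + (\<Sum>h\<in>E - {g}. h A)" using E'(3) ..
      ultimately show ?thesis by (simp only: mult_2 add.assoc)
    qed
    then show ?thesis using E'(1,2) by (intro exI[of _ E']) simp
  qed
qed

lemma eigenspan_set_sum:
  assumes "f \<in> eigenspan n \<tau>"
  shows "\<exists>E. finite E \<and> E \<subseteq> eigenfuns n \<tau> \<and> (\<forall>A\<in>carrier (GL n). f A = (\<Sum>h\<in>E. h A))"
proof -
  obtain hs where hs: "set hs \<subseteq> eigenfuns n \<tau>" "\<forall>A\<in>carrier (GL n). f A = (\<Sum>h\<leftarrow>hs. h A)"
    using assms unfolding eigenspan_def by blast
  have "\<exists>E. finite E \<and> E \<subseteq> eigenfuns n \<tau> \<and> (\<forall>A. (\<Sum>h\<in>E. h A) = (\<Sum>h\<leftarrow>hs. h A))"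
    using hs(1)
  proof (induction hs)
    case Nil
    show ?case by (intro exI[of _ "{}"]) auto
  next
    case (Cons h hs)
    then obtain E where E: "finite E" "E \<subseteq> eigenfuns n \<tau>" "\<forall>A. (\<Sum>h\<in>E. h A) = (\<Sum>h\<leftarrow>hs. h A)"
      by auto
    then show ?case using eigenfuns_set_sum_insert[OF E(1,2), of h] Cons.prems by auto
  qed
  then obtain E where "finite E" "E \<subseteq> eigenfuns n \<tau>" "\<forall>A. (\<Sum>h\<in>E. h A) = (\<Sum>h\<leftarrow>hs. h A)"
    by blast
  then have "finite E" "E \<subseteq> eigenfuns n \<tau>" "\<forall>A\<in>carrier (GL n). f A = (\<Sum>h\<in>E. h A)"
    using hs(2) by simp_all
  then show ?thesis by (intro exI[of _ E] conjI)
qed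

text \<open>In the coordinates \<open>Q\<^sup>-\<^sup>1 A Q\<close> conjugation by \<open>Q D Q\<^sup>-\<^sup>1\<close> scales the
  \<open>(i, j)\<close> entry by \<open>d i / d j\<close>.\<close>

lemma regular_fun_in_eigenspan_conj:
  fixes Q :: "'a::field mat"
  assumes Q: "Q \<in> carrier (GL n)" and d: "\<And>i. i < n \<Longrightarrow> d i \<noteq> 0"
    and C: "C \<in> carrier (GL n)" and CQ: "C * Q = Q * dmat n d"
    and f: "regular_fun n (carrier (GL n)) f"
  shows "f \<in> eigenspan n (\<lambda>A. C * A * inv\<^bsub>GL n\<^esub> C)"
proof -
  let ?\<tau> = "\<lambda>A. C * A * inv\<^bsub>GL n\<^esub> C"
  let ?q = "inv\<^bsub>GL n\<^esub> Q"
  interpret function_algebra "eigenspan n ?\<tau>" by (rule function_algebra_eigenspan)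
  have Qn: "Q \<in> carrier_mat n n" and q: "?q \<in> carrier_mat n n" and Cn: "C \<in> carrier_mat n n"
    using GL_carrier_mat[OF Q] GL_carrier_mat[OF C] inv_GL(2)[OF Q] by auto
  have ci: "inv\<^bsub>GL n\<^esub> C \<in> carrier_mat n n" using inv_GL[OF C] by simp
  note [simp] = Qn q Cn ci assoc_mult_mat[of _ n n _ n _ n] mult_carrier_mat[of _ n n _ n]
  define y where "y A = ?q * A * Q" for A
  have yn: "y A \<in> carrier_mat n n" if "A \<in> carrier_mat n n" for A
    using that by (simp add: y_def)
  \<comment> \<open>Keeping the diagonal matrix on both sides, instead of inverting it, gives the
    scaling of each entry by comparing a column multiple with a row multiple.\<close>
  have y\<tau>: "y (?\<tau> A) * dmat n d = dmat n d * y A" if A [simp]: "A \<in> carrier_mat n n" for A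
  proof -
    have qC: "?q * C = dmat n d * ?q"
    proof -
      have "Q * (?q * C) * Q = Q * (dmat n d * ?q) * Q"
      proof -
        have "Q * (?q * C) * Q = C * Q"
          by (simp add: inv_GL_mult[OF Q, of _ n])
        also have "\<dots> = Q * (dmat n d * ?q) * Q"
          using inv_GL(4)[OF Q] by (simp add: CQ)
        finally show ?thesis .
      qed
      from GL_cancel_right[where k = n, OF Q _ _ this]
      have "Q * (?q * C) = Q * (dmat n d * ?q)" by simp
      from GL_cancel_left[where k = n, OF Q _ _ this] show ?thesis by simp
    qed
    have "y (?\<tau> A) * dmat n d = ?q * (C * (A * (inv\<^bsub>GL n\<^esub> C * (Q * dmat n d))))"
      by (simp add: y_def)
    also have "inv\<^bsub>GL n\<^esub> C * (Q * dmat n d) = Q"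
      unfolding CQ[symmetric] by (rule inv_GL_mult[OF C Qn])
    also have "?q * (C * (A * Q)) = (?q * C) * (A * Q)" by simp
    also have "\<dots> = dmat n d * y A" unfolding qC by (simp add: y_def)
    finally show ?thesis .
  qed
  have \<tau>G: "?\<tau> A \<in> carrier (GL n)" if "A \<in> carrier (GL n)" for A
    using that C inv_GL[OF C] by (intro mult_in_GL) auto
  have y: "(\<lambda>A. y A $$ (i, j)) \<in> eigenspan n ?\<tau>" if ij: "i < n" "j < n" for i j
  proof -
    have "regular_fun n (carrier (GL n)) (\<lambda>A. y A $$ (i, j))"
      unfolding y_def using ij GL_carrier_mat
      by (intro regular_fun_conj_index regular_fun_coord) auto
    moreover have "y (?\<tau> A) $$ (i, j) = d i / d j * y A $$ (i, j)" if "A \<in> carrier (GL n)" for A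
    proof -
      have A: "A \<in> carrier_mat n n" "?\<tau> A \<in> carrier_mat n n"
        using that \<tau>G[OF that] GL_carrier_mat by blast+
      have "(y (?\<tau> A) * dmat n d) $$ (i, j) = (dmat n d * y A) $$ (i, j)"
        using y\<tau>[OF A(1)] by simp
      then have "y (?\<tau> A) $$ (i, j) * d j = d i * y A $$ (i, j)"
        using dmat_mult_index(1)[OF yn[OF A(1)] ij, of d] dmat_mult_index(2)[OF yn[OF A(2)] ij, of d]
        by (simp only:)
      then show ?thesis using d[OF ij(2)] by (simp add: field_simps)
    qed
    ultimately have "(\<lambda>A. y A $$ (i, j)) \<in> eigenfuns n ?\<tau>"
      unfolding eigenfuns_def using d ij by (intro CollectI conjI exI[of _ "d i / d j"]) auto
    then show ?thesis by (rule eigenfuns_subset_eigenspan)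
  qed
  \<comment> \<open>\<open>A = Q (y A) Q^-1\<close> expresses the original entries as linear
    combinations of the eigenfunctions found above.\<close>
  have coord: "(\<lambda>A. A $$ (i, j)) \<in> eigenspan n ?\<tau>" if ij: "i < n" "j < n" for i j
  proof -
    have "(\<lambda>A. \<Sum>k<n. \<Sum>l<n. Q $$ (i, k) * y A $$ (k, l) * ?q $$ (l, j)) \<in> eigenspan n ?\<tau>"
      by (intro sum mult const y) auto
    then show ?thesis
    proof (rule eigenspan_cong)
      fix A :: "'a mat" assume "A \<in> carrier (GL n)"
      then have A [simp]: "A \<in> carrier_mat n n" by (rule GL_carrier_mat)
      have "A = Q * y A * ?q"
        using GL_conj(3)[OF Q A] by (simp only: y_def)
      then have "A $$ (i, j) = (Q * (y A * ?q)) $$ (i, j)"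
        using yn[OF A] by simp
      also have "\<dots> = (\<Sum>k<n. Q $$ (i, k) * (\<Sum>l<n. y A $$ (k, l) * ?q $$ (l, j)))"
        using ij carrier_matD[OF Qn] carrier_matD[OF q] carrier_matD[OF yn[OF A]]
        by (simp add: scalar_prod_def lessThan_atLeast0)
      also have "\<dots> = (\<Sum>k<n. \<Sum>l<n. Q $$ (i, k) * y A $$ (k, l) * ?q $$ (l, j))"
        by (simp add: sum_distrib_left mult.assoc)
      finally show "A $$ (i, j) = \<dots>" .
    qed
  qed
  have poly: "P \<in> eigenspan n ?\<tau>" if "P \<in> poly_funs n" for P
    using that by induction (auto intro: const coord add mult)
  \<comment> \<open>Conjugation preserves \<open>det\<close>, so the remaining generator
    \<open>1 / det\<close> has eigenvalue 1.\<close>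
  have "det (?\<tau> A) = det A" if "A \<in> carrier (GL n)" for A
    by (rule GL_conj(5)[OF C GL_carrier_mat[OF that]])
  then have "(\<lambda>A. 1 / det A) \<in> eigenfuns n ?\<tau>"
    unfolding eigenfuns_def using regular_fun_inverse_det by (intro CollectI conjI exI[of _ 1]) auto
  then have det: "(\<lambda>A. 1 / det A) \<in> eigenspan n ?\<tau>" by (rule eigenfuns_subset_eigenspan)
  obtain P k where P: "P \<in> poly_funs n" "\<forall>A\<in>carrier (GL n). f A = P A / det A ^ k"
    using f unfolding regular_fun_def by (elim bexE exE)
  have "(\<lambda>A. P A * (1 / det A) ^ k) \<in> eigenspan n ?\<tau>"
    by (intro mult power poly P det)
  then show ?thesis by (rule eigenspan_cong) (simp add: P(2) power_one_over)
qed

text \<open>If \<open>h \<circ> \<sigma>\<^sup>2 = e\<^sup>2 h\<close>, then \<open>h\<close> is the sum of the two eigenfunctions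
  \<open>(h \<plusminus> e\<^sup>-\<^sup>1 h \<circ> \<sigma>) / 2\<close> of \<open>\<sigma>\<close>.\<close>

lemma semisimple_aut_of_square:
  fixes \<sigma> :: "'a::{alg_closed_field, field_char_0} mat \<Rightarrow> 'a mat"
  assumes \<sigma>G: "\<And>A. A \<in> carrier (GL n) \<Longrightarrow> \<sigma> A \<in> carrier (GL n)"
    and \<sigma>r: "\<And>h. regular_fun n (carrier (GL n)) h \<Longrightarrow> regular_fun n (carrier (GL n)) (\<lambda>A. h (\<sigma> A))"
    and \<sigma>2: "\<And>A. A \<in> carrier (GL n) \<Longrightarrow> \<sigma> (\<sigma> A) = \<tau> A"
    and \<tau>: "\<And>f. regular_fun n (carrier (GL n)) f \<Longrightarrow> f \<in> eigenspan n \<tau>"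
  shows "semisimple_aut n (carrier (GL n)) \<sigma>"
  unfolding semisimple_aut_def
proof (intro allI impI)
  interpret R: function_algebra "{f. regular_fun n (carrier (GL n)) (f :: 'a mat \<Rightarrow> 'a)}"
    by (rule function_algebra_regular_fun) simp
  have split: "h \<in> eigenspan n \<sigma>" if h: "h \<in> eigenfuns n \<tau>" for h
  proof -
    obtain c where c: "c \<noteq> 0" "\<forall>A\<in>carrier (GL n). h (\<tau> A) = c * h A"
      and hr: "regular_fun n (carrier (GL n)) h"
      using h unfolding eigenfuns_def by blast
    obtain e where e: "e * e = c" using nth_root_exists[of 2 c] by (auto simp: power2_eq_square)
    have e0: "e \<noteq> 0" using e c by auto
    define k where "k s A = (1 / 2) * (h A + (s / e) * h (\<sigma> A))" for s A
    have k: "k s \<in> eigenfuns n \<sigma>" if s: "s * s = 1" for s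
    proof -
      have "regular_fun n (carrier (GL n)) (k s)"
      proof -
        have "h \<in> {f. regular_fun n (carrier (GL n)) f}"
          "(\<lambda>A. h (\<sigma> A)) \<in> {f. regular_fun n (carrier (GL n)) f}"
          using hr \<sigma>r[OF hr] by auto
        then have "(\<lambda>A. (1 / 2) * (h A + (s / e) * h (\<sigma> A))) \<in> {f. regular_fun n (carrier (GL n)) f}"
          by (intro R.mult R.add R.const)
        then show ?thesis by (simp add: k_def[abs_def])
      qed
      moreover have "k s (\<sigma> A) = (s * e) * k s A" if A: "A \<in> carrier (GL n)" for A
      proof -
        have "h (\<sigma> (\<sigma> A)) = e * e * h A" using \<sigma>2[OF A] c(2) A e by simp
        then have "k s (\<sigma> A) = (1 / 2) * (h (\<sigma> A) + s * e * h A)"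
          using e0 by (simp add: k_def)
        also have "\<dots> = (1 / 2) * (s * s * h (\<sigma> A) + s * e * h A)" using s by simp
        also have "\<dots> = (s * e) * k s A" using e0 by (simp add: k_def field_simps)
        finally show ?thesis .
      qed
      moreover have "s * e \<noteq> 0" using s e0 by auto
      ultimately show ?thesis unfolding eigenfuns_def by blast
    qed
    have "(\<lambda>A. k 1 A + k (- 1) A) \<in> eigenspan n \<sigma>"
      using k[of 1] k[of "- 1"] by (intro eigenspan_add eigenfuns_subset_eigenspan) auto
    then show ?thesis by (rule eigenspan_cong) (simp add: k_def field_simps)
  qed
  fix f :: "'a mat \<Rightarrow> 'a" assume "regular_fun n (carrier (GL n)) f"
  then obtain hs where hs: "set hs \<subseteq> eigenfuns n \<tau>" "\<forall>A\<in>carrier (GL n). f A = (\<Sum>h\<leftarrow>hs. h A)"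
    using \<tau>[of f] unfolding eigenspan_def by blast
  interpret E: function_algebra "eigenspan n \<sigma>" by (rule function_algebra_eigenspan)
  have "(\<lambda>A. \<Sum>h\<leftarrow>hs. h A) \<in> eigenspan n \<sigma>" using hs(1)
  proof (induction hs)
    case Nil
    show ?case using E.const[of 0] by simp
  next
    case (Cons h hs)
    then have "h \<in> eigenfuns n \<tau>" "(\<lambda>A. \<Sum>h\<leftarrow>hs. h A) \<in> eigenspan n \<sigma>" by auto
    from eigenspan_add[OF split[OF this(1)] this(2)] show ?case by simp
  qed
  then have "f \<in> eigenspan n \<sigma>" by (rule eigenspan_cong) (simp add: hs(2))
  from eigenspan_set_sum[OF this]
  obtain E where E: "finite E" "E \<subseteq> eigenfuns n \<sigma>" "\<forall>A\<in>carrier (GL n). f A = (\<Sum>h\<in>E. h A)"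
    by blast
  then show "\<exists>E. finite E \<and>
      (\<forall>h\<in>E. regular_fun n (carrier (GL n)) h \<and> (\<exists>c. \<forall>A\<in>carrier (GL n). h (\<sigma> A) = c * h A)) \<and>
      (\<forall>A\<in>carrier (GL n). f A = (\<Sum>h\<in>E. h A))"
  proof (intro exI[of _ E] conjI ballI)
    fix h assume "h \<in> E"
    then have "h \<in> eigenfuns n \<sigma>" using E(2) by auto
    then show "regular_fun n (carrier (GL n)) h" "\<exists>c. \<forall>A\<in>carrier (GL n). h (\<sigma> A) = c * h A"
      unfolding eigenfuns_def by auto
  qed (use E in auto)
qed

text \<open>The square of this automorphism is conjugation by \<open>B (B\<^sup>T)^-1\<close>, which
  by \<open>BC\<close> is \<open>C\<close> and by \<open>CQ\<close> is diagonalized by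
  \<open>Q\<close>. Thus the eigenfunctions of conjugation by \<open>C\<close> are available and the
  passage from a square to its root applies.\<close>

lemma semisimple_aut_transpose_inverse:
  fixes B :: "'a::{alg_closed_field, field_char_0} mat"
  assumes B: "B \<in> carrier (GL n)" and Q: "Q \<in> carrier (GL n)" and d: "\<And>i. i < n \<Longrightarrow> d i \<noteq> 0"
    and C: "C \<in> carrier (GL n)" and CQ: "C * Q = Q * dmat n d" and BC: "B = C * B\<^sup>T"
  shows "semisimple_aut n (carrier (GL n)) (\<lambda>A. B * (inv\<^bsub>GL n\<^esub> A)\<^sup>T * inv\<^bsub>GL n\<^esub> B)"
proof (rule semisimple_aut_of_square[OF _ _ _ regular_fun_in_eigenspan_conj[OF Q d C CQ]])
  let ?b = "inv\<^bsub>GL n\<^esub> B"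
  define \<sigma> where "\<sigma> A = B * (inv\<^bsub>GL n\<^esub> A)\<^sup>T * ?b" for A
  have [simp]: "B \<in> carrier_mat n n" "?b \<in> carrier_mat n n" "C \<in> carrier_mat n n"
    "inv\<^bsub>GL n\<^esub> C \<in> carrier_mat n n"
    using GL_carrier_mat[OF B] GL_carrier_mat[OF C] inv_GL(2)[OF B] inv_GL(2)[OF C] by auto
  note [simp] = assoc_mult_mat[of _ n n _ n _ n] mult_carrier_mat[of _ n n _ n]
    left_mult_one_mat[of _ n n] right_mult_one_mat[of _ n n]
  show \<sigma>G: "B * (inv\<^bsub>GL n\<^esub> A)\<^sup>T * ?b \<in> carrier (GL n)" if "A \<in> carrier (GL n)" for A
    using that B inv_GL(1) by (intro mult_in_GL transpose_in_GL) auto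
  have bb: "B * ?b = 1\<^sub>m n" "?b * B = 1\<^sub>m n" using inv_GL[OF B] by simp_all
  have "B\<^sup>T * ?b\<^sup>T = (?b * B)\<^sup>T"
    by (rule transpose_mult[of _ n n _ n, symmetric]) simp_all
  moreover have "?b\<^sup>T * B\<^sup>T = (B * ?b)\<^sup>T"
    by (rule transpose_mult[of _ n n _ n, symmetric]) simp_all
  ultimately have bbT: "B\<^sup>T * ?b\<^sup>T = 1\<^sub>m n" "?b\<^sup>T * B\<^sup>T = 1\<^sub>m n"
    unfolding bb by simp_all
  have Bb: "?b * (B * A) = A" if "A \<in> carrier_mat n n" for A
    using inv_GL_mult[OF B that] by simp
  have BbT: "B * ?b\<^sup>T = C"
  proof -
    have "B * ?b\<^sup>T = (C * B\<^sup>T) * ?b\<^sup>T" using BC by simp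
    also have "\<dots> = C" using bbT by simp
    finally show ?thesis .
  qed
  have invC: "inv\<^bsub>GL n\<^esub> C = B\<^sup>T * ?b"
  proof (rule inv_GL_unique[OF C])
    have "C * (B\<^sup>T * ?b) = (C * B\<^sup>T) * ?b" by simp
    then show "C * (B\<^sup>T * ?b) = 1\<^sub>m n" using BC bb by simp
  qed simp
  show "B * (inv\<^bsub>GL n\<^esub> (B * (inv\<^bsub>GL n\<^esub> A)\<^sup>T * ?b))\<^sup>T * ?b = C * A * inv\<^bsub>GL n\<^esub> C"
    if A: "A \<in> carrier (GL n)" for A
  proof -
    have [simp]: "A \<in> carrier_mat n n" "inv\<^bsub>GL n\<^esub> A \<in> carrier_mat n n"
      using GL_carrier_mat[OF A] inv_GL(2)[OF A] by auto
    have "(inv\<^bsub>GL n\<^esub> A)\<^sup>T * A\<^sup>T = (A * inv\<^bsub>GL n\<^esub> A)\<^sup>T"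
      by (rule transpose_mult[of _ n n _ n, symmetric]) simp_all
    then have ATA: "(inv\<^bsub>GL n\<^esub> A)\<^sup>T * A\<^sup>T = 1\<^sub>m n" unfolding inv_GL(3)[OF A] by simp
    have AT: "(inv\<^bsub>GL n\<^esub> A)\<^sup>T * (A\<^sup>T * Z) = Z" if "Z \<in> carrier_mat n n" for Z
    proof -
      have "(inv\<^bsub>GL n\<^esub> A)\<^sup>T * (A\<^sup>T * Z) = ((inv\<^bsub>GL n\<^esub> A)\<^sup>T * A\<^sup>T) * Z"
        using that by simp
      then show ?thesis unfolding ATA using that by simp
    qed
    have "inv\<^bsub>GL n\<^esub> (B * (inv\<^bsub>GL n\<^esub> A)\<^sup>T * ?b) = B * (A\<^sup>T * ?b)"
      by (rule inv_GL_unique[OF \<sigma>G[OF A]]) (simp_all add: Bb AT bb)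
    then have "(inv\<^bsub>GL n\<^esub> (B * (inv\<^bsub>GL n\<^esub> A)\<^sup>T * ?b))\<^sup>T = ?b\<^sup>T * (A * B\<^sup>T)"
      by (simp add: transpose_mult[of _ n n _ n])
    then have "B * (inv\<^bsub>GL n\<^esub> (B * (inv\<^bsub>GL n\<^esub> A)\<^sup>T * ?b))\<^sup>T * ?b = (B * ?b\<^sup>T) * (A * (B\<^sup>T * ?b))"
      by simp
    then show ?thesis unfolding BbT invC by simp
  qed
  have entry: "regular_fun n (carrier (GL n)) (\<lambda>A. (B * (inv\<^bsub>GL n\<^esub> A)\<^sup>T * ?b) $$ (i, j))"
    if ij: "i < n" "j < n" for i j
  proof (rule regular_fun_conj_index[OF _ _ subset_refl _ _ ij])
    fix i j assume ij: "i < n" "j < n"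
    show "regular_fun n (carrier (GL n)) (\<lambda>A. (inv\<^bsub>GL n\<^esub> A)\<^sup>T $$ (i, j) :: 'a)"
    proof (subst regular_fun_cong)
      show "(inv\<^bsub>GL n\<^esub> A)\<^sup>T $$ (i, j) = (inv\<^bsub>GL n\<^esub> A) $$ (j, i)" if "A \<in> carrier (GL n)" for A :: "'a mat"
        using carrier_matD[OF inv_GL(2)[OF that]] ij by simp
    qed (rule regular_fun_inv_GL[OF ij(2,1)])
  qed (use inv_GL(2) in auto)
  obtain D where D: "D \<in> poly_funs n" "\<forall>A\<in>carrier_mat n n. D A = det (A :: 'a mat)"
    using det_poly_fun by blast
  \<comment> \<open>The automorphism inverts determinants, so the reciprocal in question is just
    \<open>det A\<close>, a polynomial.\<close>
  have det: "regular_fun n (carrier (GL n)) (\<lambda>A. 1 / det (B * (inv\<^bsub>GL n\<^esub> A)\<^sup>T * ?b))"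
  proof (rule regular_fun_cong[THEN iffD2, OF _ regular_fun_poly[OF D(1)]])
    fix A :: "'a mat" assume A: "A \<in> carrier (GL n)"
    have An: "A \<in> carrier_mat n n" "inv\<^bsub>GL n\<^esub> A \<in> carrier_mat n n"
      using GL_carrier_mat[OF A] inv_GL(2)[OF A] by auto
    have dd: "det A * det (inv\<^bsub>GL n\<^esub> A) = 1"
      using det_mult[OF An] inv_GL(3)[OF A] by simp
    then have "det (inv\<^bsub>GL n\<^esub> A) \<noteq> 0" by auto
    then have "1 / det (inv\<^bsub>GL n\<^esub> A) = det A" using dd by (simp add: divide_eq_eq)
    moreover have "det (B * (inv\<^bsub>GL n\<^esub> A)\<^sup>T * ?b) = det (inv\<^bsub>GL n\<^esub> A)"
      using GL_conj(5)[OF B, of "(inv\<^bsub>GL n\<^esub> A)\<^sup>T"] An by (simp add: det_transpose[of _ n])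
    ultimately show "1 / det (B * (inv\<^bsub>GL n\<^esub> A)\<^sup>T * ?b) = D A"
      using bspec[OF D(2) An(1)] by simp
  qed
  show "regular_fun n (carrier (GL n)) (\<lambda>A. h (B * (inv\<^bsub>GL n\<^esub> A)\<^sup>T * ?b))"
    if "regular_fun n (carrier (GL n)) h" for h
    by (rule regular_fun_comp[OF subset_refl that entry \<sigma>G det])
qed

section \<open>Regular elements\<close>

lemma GL_congruence_cancel:
  assumes g: "g \<in> carrier (GL n)" and Y: "Y \<in> carrier_mat n n" and Z: "Z \<in> carrier_mat n n"
  shows "g * Y * g\<^sup>T = g * Z * g\<^sup>T \<longleftrightarrow> Y = Z"
proof
  note m = mult_carrier_mat[OF GL_carrier_mat[OF g]]
  assume "g * Y * g\<^sup>T = g * Z * g\<^sup>T"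
  from GL_cancel_right[where k = n, OF transpose_in_GL[OF g] m[OF Y] m[OF Z] this]
  have "g * Y = g * Z" .
  then show "Y = Z" by (rule GL_cancel_left[where k = n, OF g Y Z])
qed simp

lemma isom_group_conj:
  fixes J :: "'a::field mat"
  assumes g: "g \<in> carrier (GL n)" and J: "J \<in> carrier_mat n n" and h: "h \<in> carrier (GL n)"
  shows "g * h * inv\<^bsub>GL n\<^esub> g \<in> isom_group n (g * J * g\<^sup>T) \<longleftrightarrow> h \<in> isom_group n J"
proof -
  let ?i = "inv\<^bsub>GL n\<^esub> g"
  have [simp]: "g \<in> carrier_mat n n" "?i \<in> carrier_mat n n" "J \<in> carrier_mat n n" "h \<in> carrier_mat n n"
    using GL_carrier_mat[OF g] inv_GL(2)[OF g] GL_carrier_mat[OF h] J by auto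
  note [simp] = assoc_mult_mat[of _ n n _ n _ n] mult_carrier_mat[of _ n n _ n]
    left_mult_one_mat[of _ n n] right_mult_one_mat[of _ n n]
  have "g\<^sup>T * ?i\<^sup>T = (?i * g)\<^sup>T" by (rule transpose_mult[of _ n n _ n, symmetric]) simp_all
  then have giT: "g\<^sup>T * ?i\<^sup>T = 1\<^sub>m n" unfolding inv_GL(4)[OF g] by simp
  have giT': "g\<^sup>T * (?i\<^sup>T * Z) = Z" if "Z \<in> carrier_mat n n" for Z
  proof -
    have "g\<^sup>T * (?i\<^sup>T * Z) = (g\<^sup>T * ?i\<^sup>T) * Z" using that by simp
    then show ?thesis unfolding giT using that by simp
  qed
  have "g * h * ?i * (g * J * g\<^sup>T) * (g * h * ?i)\<^sup>T = g * (?i * g * (h * J * h\<^sup>T) * g\<^sup>T)"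
  proof -
    have "g * h * ?i * (g * J * g\<^sup>T) * (g * h * ?i)\<^sup>T
        = g * (h * (?i * (g * (J * (g\<^sup>T * (?i\<^sup>T * (h\<^sup>T * g\<^sup>T)))))))"
      by (simp add: transpose_mult[of _ n n _ n])
    also have "\<dots> = g * (h * (J * (h\<^sup>T * g\<^sup>T)))" by (simp add: giT' inv_GL_mult[OF g, of _ n])
    also have "\<dots> = g * (?i * g * (h * J * h\<^sup>T) * g\<^sup>T)" by (simp add: inv_GL_mult[OF g, of _ n])
    finally show ?thesis .
  qed
  then have eq: "g * h * ?i * (g * J * g\<^sup>T) * (g * h * ?i)\<^sup>T = g * (h * J * h\<^sup>T) * g\<^sup>T"
    using inv_GL_mult[OF g, of _ n] by simp
  have "g * (h * J * h\<^sup>T) * g\<^sup>T = g * J * g\<^sup>T \<longleftrightarrow> h * J * h\<^sup>T = J"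
    by (rule GL_congruence_cancel[OF g]) simp_all
  moreover have "g * h * ?i \<in> carrier (GL n)"
    using g h inv_GL(1)[OF g] by (intro mult_in_GL)
  ultimately show ?thesis unfolding isom_group_def mem_Collect_eq eq using h by blast
qed

lemma sum_indicator_mult:
  fixes f :: "nat \<Rightarrow> 'a::comm_ring_1"
  assumes "S \<subseteq> {..<n}"
  shows "(\<Sum>j<n. f j * (if j \<in> S then 1 else 0)) = (\<Sum>j\<in>S. f j)"
proof -
  have "(\<Sum>j<n. f j * (if j \<in> S then 1 else 0)) = (\<Sum>j\<in>S. f j * (if j \<in> S then 1 else 0))"
    using assms by (intro sum.mono_neutral_right) auto
  then show ?thesis by simp
qed

text \<open>With \<open>N = y y\<^sup>T\<close> and \<open>q = y\<^sup>T J y\<close>, the map \<open>1 + k J N\<close> is the reflection or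
  transvection in the direction \<open>J y\<close>.\<close>

lemma rank_one_isometry:
  fixes J :: "'a::field mat"
  assumes J: "J \<in> carrier (GL n)" and JT: "J\<^sup>T = e \<cdot>\<^sub>m J"
    and N: "N \<in> carrier_mat n n" and NT: "N\<^sup>T = N" and NJN: "N * J * N = q \<cdot>\<^sub>m N"
    and k: "k + k * e + k * k * e * q = 0"
  shows "1\<^sub>m n + k \<cdot>\<^sub>m (J * N) \<in> isom_group n J"
proof -
  have [simp]: "J \<in> carrier_mat n n" "N \<in> carrier_mat n n" using GL_carrier_mat[OF J] N by auto
  note [simp] = assoc_mult_mat[of _ n n _ n _ n] mult_carrier_mat[of _ n n _ n]
    left_mult_one_mat[of _ n n] right_mult_one_mat[of _ n n]
  let ?h = "1\<^sub>m n + k \<cdot>\<^sub>m (J * N)"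
  let ?R = "J * (N * J)"
  have hT: "?h\<^sup>T = 1\<^sub>m n + (k * e) \<cdot>\<^sub>m (N * J)"
  proof -
    have "(J * N)\<^sup>T = N\<^sup>T * J\<^sup>T" by (rule transpose_mult[of _ n n _ n]) simp_all
    also have "\<dots> = e \<cdot>\<^sub>m (N * J)" unfolding NT JT by (rule mult_smult_distrib[of _ n n _ n]) simp_all
    finally have *: "(J * N)\<^sup>T = e \<cdot>\<^sub>m (N * J)" .
    have "?h\<^sup>T = (1\<^sub>m n)\<^sup>T + (k \<cdot>\<^sub>m (J * N))\<^sup>T" by (rule transpose_add[of _ n n]) simp_all
    also have "(k \<cdot>\<^sub>m (J * N))\<^sup>T = k \<cdot>\<^sub>m (J * N)\<^sup>T" by (rule eq_matI) simp_all
    also have "\<dots> = (k * e) \<cdot>\<^sub>m (N * J)" unfolding * by (rule eq_matI) (simp_all add: mult.assoc)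
    finally show ?thesis by simp
  qed
  have hJ: "?h * J = J + k \<cdot>\<^sub>m ?R"
    by (simp add: add_mult_distrib_mat[of _ n n _ _ n] mult_smult_assoc_mat[of _ n n _ n])
  have JNJ: "J * (N * J) * (N * J) = q \<cdot>\<^sub>m ?R"
  proof -
    have "J * (N * J) * (N * J) = J * ((N * J * N) * J)" by simp
    also have "\<dots> = q \<cdot>\<^sub>m ?R" unfolding NJN
      by (simp add: mult_smult_assoc_mat[of _ n n _ n] mult_smult_distrib[of _ n n _ n])
    finally show ?thesis .
  qed
  \<comment> \<open>Altogether the product is \<open>J + (k + k e + k k e q) J N J\<close>; this is
    where the equation imposed on \<open>k\<close> comes from.\<close>
  have "?h * J * ?h\<^sup>T = (J + k \<cdot>\<^sub>m ?R) + (k * e) \<cdot>\<^sub>m ((J + k \<cdot>\<^sub>m ?R) * (N * J))"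
    unfolding hJ hT
    by (simp add: mult_add_distrib_mat[of _ n n _ n] mult_smult_distrib[of _ n n _ n])
  also have "(J + k \<cdot>\<^sub>m ?R) * (N * J) = ?R + k \<cdot>\<^sub>m (q \<cdot>\<^sub>m ?R)"
    unfolding JNJ[symmetric]
    by (simp add: add_mult_distrib_mat[of _ n n _ _ n] mult_smult_assoc_mat[of _ n n _ n])
  also have "(J + k \<cdot>\<^sub>m ?R) + (k * e) \<cdot>\<^sub>m (?R + k \<cdot>\<^sub>m (q \<cdot>\<^sub>m ?R)) = J"
  proof (rule eq_matI)
    fix i j assume "i < dim_row J" "j < dim_col J"
    then have ij: "i < n" "j < n" by (auto simp: carrier_matD[of J n n])
    have R: "?R \<in> carrier_mat n n" by simp
    define r where "r = ?R $$ (i, j)"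
    have "((J + k \<cdot>\<^sub>m ?R) + (k * e) \<cdot>\<^sub>m (?R + k \<cdot>\<^sub>m (q \<cdot>\<^sub>m ?R))) $$ (i, j)
        = (J $$ (i, j) + k * r) + (k * e) * (r + k * (q * r))"
      using ij carrier_matD[OF R] carrier_matD[of J n n] by (simp add: r_def del: index_mult_mat(1))
    also have "\<dots> = J $$ (i, j) + (k + k * e + k * k * e * q) * r" by (simp add: algebra_simps)
    finally show "((J + k \<cdot>\<^sub>m ?R) + (k * e) \<cdot>\<^sub>m (?R + k \<cdot>\<^sub>m (q \<cdot>\<^sub>m ?R))) $$ (i, j) = J $$ (i, j)"
      using k by simp
  qed (simp_all add: carrier_matD[of J n n])
  finally have *: "?h * J * ?h\<^sup>T = J" .
  have hn: "?h \<in> carrier_mat n n" by simp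
  have "det (?h * J * ?h\<^sup>T) = det ?h * det J * det ?h"
    using det_mult[of "?h * J" n "?h\<^sup>T"] det_mult[OF hn, of J] det_transpose[OF hn] hn by simp
  then have "det ?h \<noteq> 0" using * J by (auto simp: carrier_GL_iff)
  then show ?thesis using * hn by (simp add: isom_group_def carrier_GL_iff)
qed

text \<open>If \<open>\<gamma>\<close> fixes a vector, then a reflection or a transvection commutes with \<open>\<gamma>\<close>
  but does not lie in the group \<open>T\<close> of squares of commuting diagonal matrices.\<close>

lemma diagonal_regular_minus_one:
  fixes J :: "'a::field_char_0 mat"
  assumes J: "J \<in> carrier (GL n)" and JT: "J\<^sup>T = e \<cdot>\<^sub>m J" and e: "e = 1 \<or> e = - 1"
    and T: "T \<subseteq> isom_group n J" "\<And>t. t \<in> T \<Longrightarrow> \<exists>c. t = dmat n c"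
    and sq: "\<And>t. t \<in> T \<Longrightarrow> \<exists>s\<in>T. s * s = t"
    and g: "g \<in> T" and cent: "\<And>h. h \<in> isom_group n J \<Longrightarrow> h * g = g * h \<Longrightarrow> h \<in> T"
  shows "g - 1\<^sub>m n \<in> carrier (GL n)"
proof (rule ccontr)
  assume "g - 1\<^sub>m n \<notin> carrier (GL n)"
  obtain d where d: "g = dmat n d" using T(2)[OF g] by blast
  have "g - 1\<^sub>m n = dmat n (\<lambda>i. d i - 1)" unfolding d by (rule eq_matI) (auto simp: dmat_index)
  then obtain a where a: "a < n" "d a = 1"
    using \<open>g - 1\<^sub>m n \<notin> carrier (GL n)\<close> by (auto simp: dmat_in_GL)
  have Jn: "J \<in> carrier_mat n n" using J by (rule GL_carrier_mat)
  have dJ: "f i * J $$ (i, j) * f j = J $$ (i, j)"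
    if "dmat n f \<in> isom_group n J" "i < n" "j < n" for f i j
  proof -
    have "dmat n f * J * (dmat n f)\<^sup>T = J" using that(1) by (rule isom_groupD)
    moreover have "(dmat n f)\<^sup>T = dmat n f" by (rule eq_matI) (auto simp: dmat_index)
    ultimately have "(dmat n f * J * dmat n f) $$ (i, j) = J $$ (i, j)" by simp
    moreover have "dmat n f * J \<in> carrier_mat n n" by (rule mult_carrier_mat[OF dmat_carrier Jn])
    ultimately show ?thesis
      using dmat_mult_index(2)[of "dmat n f * J" n i j f] dmat_mult_index(1)[OF Jn that(2,3), of f] that
      by simp
  qed
  have gI: "dmat n d \<in> isom_group n J" using g T(1) d by auto
  have Jsym: "J $$ (j, i) = e * J $$ (i, j)" if "i < n" "j < n" for i j
  proof -
    have "J $$ (j, i) = J\<^sup>T $$ (i, j)" using Jn that by simp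
    then show ?thesis unfolding JT using Jn that by simp
  qed
  have "\<exists>b<n. J $$ (a, b) \<noteq> 0"
  proof (rule ccontr)
    assume *: "\<not> (\<exists>b<n. J $$ (a, b) \<noteq> 0)"
    have "(J * inv\<^bsub>GL n\<^esub> J) $$ (a, a) = (\<Sum>b<n. J $$ (a, b) * (inv\<^bsub>GL n\<^esub> J) $$ (b, a))"
      using Jn inv_GL(2)[OF J] a by (simp add: scalar_prod_def lessThan_atLeast0)
    also have "\<dots> = 0" using * by (intro sum.neutral) simp
    finally show False unfolding inv_GL(3)[OF J] using a by simp
  qed
  then obtain b where b: "b < n" "J $$ (a, b) \<noteq> 0" by blast
  \<comment> \<open>Entries of \<open>J\<close> can link only eigenvalues with product 1, so the
    partner \<open>b\<close> of a fixed coordinate \<open>a\<close> is fixed as well.\<close>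
  have db: "d b = 1" using dJ[OF gI a(1) b(1)] a b by simp
  \<comment> \<open>A vector \<open>y\<close> supported on the fixed coordinates gives a rank-one
    isometry commuting with \<open>g\<close>, and by regularity of \<open>g\<close> it lies in
    \<open>T\<close>. The number \<open>q\<close> is the value of the form \<open>J\<close> at
    \<open>y\<close>.\<close>
  have key: "1\<^sub>m n + k \<cdot>\<^sub>m (J * mat n n (\<lambda>(i, j). y i * y j)) \<in> T"
    if y: "\<And>i. y i \<noteq> 0 \<Longrightarrow> d i = 1" and k: "k + k * e + k * k * e * q = 0"
      and q: "q = (\<Sum>i<n. y i * (\<Sum>j<n. J $$ (i, j) * y j))" for y :: "nat \<Rightarrow> 'a" and k q
  proof -
    define N where "N = mat n n (\<lambda>(i, j). y i * y j)"
    have [simp]: "N \<in> carrier_mat n n" "J \<in> carrier_mat n n" using Jn by (simp_all add: N_def)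
    note [simp] = assoc_mult_mat[of _ n n _ n _ n] mult_carrier_mat[of _ n n _ n]
      left_mult_one_mat[of _ n n] right_mult_one_mat[of _ n n]
    have NT: "N\<^sup>T = N" by (rule eq_matI) (auto simp: N_def mult.commute)
    have NJN: "N * J * N = q \<cdot>\<^sub>m N"
    proof (rule eq_matI)
      fix i j assume "i < dim_row (q \<cdot>\<^sub>m N)" "j < dim_col (q \<cdot>\<^sub>m N)"
      then have ij: "i < n" "j < n" by (auto simp: N_def)
      have "(N * (J * N)) $$ (i, j) = (\<Sum>k<n. N $$ (i, k) * (\<Sum>l<n. J $$ (k, l) * N $$ (l, j)))"
        using ij carrier_matD[of N n n] carrier_matD[OF Jn]
        by (simp add: scalar_prod_def lessThan_atLeast0)
      also have "\<dots> = (\<Sum>k<n. y i * (y k * (\<Sum>l<n. J $$ (k, l) * y l)) * y j)"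
        using ij by (intro sum.cong refl) (simp add: N_def sum_distrib_left sum_distrib_right mult.assoc)
      also have "\<dots> = y i * q * y j" unfolding q by (simp add: sum_distrib_left sum_distrib_right)
      finally show "(N * J * N) $$ (i, j) = (q \<cdot>\<^sub>m N) $$ (i, j)"
        using ij by (simp add: N_def mult_ac del: index_mult_mat(1))
    qed (simp_all add: carrier_matD[of N n n])
    have h: "1\<^sub>m n + k \<cdot>\<^sub>m (J * N) \<in> isom_group n J"
      by (rule rank_one_isometry[OF J JT _ NT NJN k]) simp
    have gn: "g \<in> carrier_mat n n" by (simp add: d)
    have gN: "g * N = N" "N * g = N"
    proof -
      have "(g * N) $$ (i, j) = N $$ (i, j)" "(N * g) $$ (i, j) = N $$ (i, j)"
        if ij: "i < n" "j < n" for i j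
        unfolding d using dmat_mult_index[of N n i j d] ij y[of i] y[of j]
        by (cases "y i = 0"; cases "y j = 0"; simp add: N_def)+
      then show "g * N = N" "N * g = N"
        using gn carrier_matD[of N n n] by (auto intro!: eq_matI simp del: index_mult_mat(1))
    qed
    \<comment> \<open>Since \<open>g\<close> is diagonal it equals its transpose, and the isometry
      condition lets \<open>g\<close> pass through \<open>J\<close> as its inverse; together with
      \<open>gN\<close> this yields commutation with \<open>J N\<close>.\<close>
    have gJg: "g * (J * g) = J"
    proof (rule eq_matI)
      fix i j assume "i < dim_row J" "j < dim_col J"
      then have ij: "i < n" "j < n" using carrier_matD[OF Jn] by auto
      show "(g * (J * g)) $$ (i, j) = J $$ (i, j)"
        unfolding d using dJ[OF gI ij] dmat_mult_index(1)[of "J * dmat n d" n i j d]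
          dmat_mult_index(2)[OF Jn ij, of d] ij by (simp add: mult.assoc del: index_mult_mat(1))
    qed (use gn carrier_matD[OF Jn] in simp_all)
    have "g * (J * N) = g * (J * (g * N))" by (simp add: gN)
    also have "\<dots> = (g * (J * g)) * N" using gn by simp
    also have "\<dots> = (J * N) * g" using gn by (simp add: gJg gN)
    finally have "(1\<^sub>m n + k \<cdot>\<^sub>m (J * N)) * g = g * (1\<^sub>m n + k \<cdot>\<^sub>m (J * N))"
      using gn by (simp add: add_mult_distrib_mat[of _ n n _ _ n] mult_add_distrib_mat[of _ n n _ n]
          mult_smult_assoc_mat[of _ n n _ n] mult_smult_distrib[of _ n n _ n])
    with h show ?thesis unfolding N_def by (rule cent)
  qed
  have entry: "(1\<^sub>m n + k \<cdot>\<^sub>m (J * mat n n (\<lambda>(i, j). y i * y j))) $$ (i, j)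
      = (if i = j then 1 else 0) + k * ((\<Sum>l<n. J $$ (i, l) * y l) * y j)"
    if "i < n" "j < n" for k i j and y :: "nat \<Rightarrow> 'a"
    using that carrier_matD[OF Jn]
    by (simp add: scalar_prod_def lessThan_atLeast0 sum_distrib_left sum_distrib_right mult.assoc)
  have diag: "(\<Sum>l<n. J $$ (i, l) * y l) * y j = 0"
    if hT: "1\<^sub>m n + k \<cdot>\<^sub>m (J * mat n n (\<lambda>(i, j). y i * y j)) \<in> T"
      and ij: "k \<noteq> 0" "i < n" "j < n" "i \<noteq> j"
    for k i j and y :: "nat \<Rightarrow> 'a"
  proof -
    obtain c where "1\<^sub>m n + k \<cdot>\<^sub>m (J * mat n n (\<lambda>(i, j). y i * y j)) = dmat n c"
      using T(2)[OF hT] by blast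
    then have "dmat n c $$ (i, j) = 0 + k * ((\<Sum>l<n. J $$ (i, l) * y l) * y j)"
      using entry[OF ij(2,3), of k y] ij(4) by simp
    then show ?thesis using ij by (simp add: dmat_index)
  qed
  define ind where "ind S i = (if i \<in> S then 1 else 0 :: 'a)" for S :: "nat set" and i
  have Jind: "(\<Sum>l<n. J $$ (i, l) * ind S l) = (\<Sum>l\<in>S. J $$ (i, l))" if "S \<subseteq> {..<n}" for S i
    unfolding ind_def using that by (rule sum_indicator_mult)
  have qind: "(\<Sum>i<n. ind S i * (\<Sum>j<n. J $$ (i, j) * ind S j)) = (\<Sum>i\<in>S. \<Sum>j\<in>S. J $$ (i, j))"
    if S: "S \<subseteq> {..<n}" for S
  proof -
    have "(\<Sum>i<n. ind S i * (\<Sum>j<n. J $$ (i, j) * ind S j))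
        = (\<Sum>i<n. (\<Sum>j\<in>S. J $$ (i, j)) * (if i \<in> S then 1 else 0))"
      unfolding Jind[OF S] by (simp add: ind_def mult.commute)
    also have "\<dots> = (\<Sum>i\<in>S. \<Sum>j\<in>S. J $$ (i, j))" by (rule sum_indicator_mult[OF S])
    finally show ?thesis .
  qed
  show False
  proof (cases "e = 1")
    case False
    then have e1: "e = - 1" using e by simp
    have Jaa: "J $$ (a, a) = 0" using Jsym[OF a(1) a(1)] e1 by simp
    then have ba: "b \<noteq> a" using b by auto
    \<comment> \<open>Transvection: \<open>q = 0\<close> and \<open>1 + e = 0\<close> leave
      \<open>k\<close> free, so 1 is taken. Its entry at \<open>(b, a)\<close> is
      \<open>J $$ (b, a)\<close>, nonzero off the diagonal.\<close>
    have "1\<^sub>m n + 1 \<cdot>\<^sub>m (J * mat n n (\<lambda>(i, j). ind {a} i * ind {a} j)) \<in> T"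
    proof (rule key[of "ind {a}" 1 0])
      show "d i = 1" if "ind {a} i \<noteq> 0" for i using that a by (simp add: ind_def split: if_splits)
      show "0 = (\<Sum>i<n. ind {a} i * (\<Sum>j<n. J $$ (i, j) * ind {a} j))"
        using qind[of "{a}"] a Jaa by simp
    qed (simp add: e1)
    from diag[OF this _ b(1) a(1) ba] have "J $$ (b, a) = 0"
      using Jind[of "{a}" b] a by (simp add: ind_def)
    then show False using Jsym[OF a(1) b(1)] b e1 by simp
  next
    case True
    \<comment> \<open>A fixed vector with nonzero value of the form is needed. If both
      \<open>a\<close> and \<open>b\<close> are isotropic, their sum has value
      \<open>2 * J $$ (a, b)\<close>, nonzero in characteristic 0.\<close>
    have "\<exists>S. S \<subseteq> {..<n} \<and> (\<forall>i\<in>S. d i = 1) \<and> (\<Sum>i\<in>S. \<Sum>j\<in>S. J $$ (i, j)) \<noteq> 0"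
    proof (cases "J $$ (a, a) = 0 \<and> J $$ (b, b) = 0")
      case True
      then have "a \<noteq> b" using b by auto
      then have "(\<Sum>i\<in>{a, b}. \<Sum>j\<in>{a, b}. J $$ (i, j)) = 2 * J $$ (a, b)"
        using True Jsym[OF a(1) b(1)] \<open>e = 1\<close> by simp
      then show ?thesis using a b db by (intro exI[of _ "{a, b}"]) auto
    next
      case False
      then show ?thesis
        using a b db by (cases "J $$ (a, a) = 0") (auto intro: exI[of _ "{a}"] exI[of _ "{b}"])
    qed
    then obtain S where S: "S \<subseteq> {..<n}" "\<forall>i\<in>S. d i = 1" "(\<Sum>i\<in>S. \<Sum>j\<in>S. J $$ (i, j)) \<noteq> 0"
      by blast
    define y where "y = ind S"
    define z where "z i = (\<Sum>l<n. J $$ (i, l) * y l)" for i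
    define q where "q = (\<Sum>i<n. y i * z i)"
    \<comment> \<open>The nonzero solution of \<open>2 k + k k q = 0\<close>, which gives a
      reflection.\<close>
    define k where "k = - 2 / q"
    have q: "q \<noteq> 0" using qind[OF S(1)] S(3) by (simp add: q_def z_def y_def)
    then have k0: "k \<noteq> 0" by (simp add: k_def)
    have "k + k * e + k * k * e * q = 0" using q True by (simp add: k_def field_simps)
    then have hT: "1\<^sub>m n + k \<cdot>\<^sub>m (J * mat n n (\<lambda>(i, j). y i * y j)) \<in> T"
      using S(2) by (intro key[of y k q]) (auto simp: y_def ind_def q_def z_def split: if_splits)
    \<comment> \<open>Being in \<open>T\<close>, the reflection is diagonal, so its off-diagonal
      entries \<open>k * z i * y j\<close> vanish. This forces \<open>y\<close> to have a single
      nonzero coordinate \<open>i\<close>, and the reflection has entry -1 there.\<close>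
    have zy: "z i * y j = 0" if "i < n" "j < n" "i \<noteq> j" for i j
      using diag[OF hT k0 that] by (simp add: z_def)
    have "\<exists>i<n. y i * z i \<noteq> 0"
    proof (rule ccontr)
      assume "\<not> (\<exists>i<n. y i * z i \<noteq> 0)"
      then have "q = 0" unfolding q_def by (intro sum.neutral) auto
      then show False using q by simp
    qed
    then obtain i where i: "i < n" "y i * z i \<noteq> 0" by blast
    have yj: "y j = 0" if "j < n" "j \<noteq> i" for j
      using zy[OF i(1) that(1)] that(2) i(2) by auto
    have "q = y i * z i"
      unfolding q_def using i(1) yj by (subst sum.remove[of _ i]) auto
    moreover have zi: "z i = J $$ (i, i) * y i"
      unfolding z_def using i(1) yj by (subst sum.remove[of _ i]) auto
    ultimately have J0: "J $$ (i, i) \<noteq> 0" and kq: "k * (z i * y i) = - 2"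
      using i(2) by (auto simp: k_def mult.commute)
    \<comment> \<open>The square root has at \<open>i\<close> an entry with square -1, but as an
      isometry with \<open>J $$ (i, i)\<close> nonzero it needs square 1 there.\<close>
    obtain s where s: "s \<in> T" "s * s = 1\<^sub>m n + k \<cdot>\<^sub>m (J * mat n n (\<lambda>(i, j). y i * y j))"
      using sq[OF hT] by blast
    obtain f where f: "s = dmat n f" using T(2)[OF s(1)] by blast
    have "f i * f i = 1 + k * (z i * y i)"
    proof -
      have "dmat n (\<lambda>i. f i * f i) $$ (i, i) = 1 + k * (z i * y i)"
        using entry[OF i(1) i(1), of k y] s(2) unfolding f dmat_mult z_def by simp
      then show ?thesis using i(1) by (simp add: dmat_index)
    qed
    then have "f i * f i = - 1" using kq by simp
    moreover have "f i * J $$ (i, i) * f i = J $$ (i, i)"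
      using s(1) T(1) i(1) unfolding f by (intro dJ) auto
    then have "f i * f i = 1" using J0 by (simp add: mult.commute mult.left_commute)
    ultimately show False by simp
  qed
qed

section \<open>The forms of the orthogonal and symplectic cases\<close>

lemma antidiagonal_mult:
  fixes f g :: "nat \<Rightarrow> 'a::field"
  assumes "i < n" "j < n"
  shows "(mat n n (\<lambda>(i, j). if i + j + 1 = n then f i else 0) *
      mat n n (\<lambda>(i, j). if i + j + 1 = n then g i else 0)) $$ (i, j)
    = (if i = j then f i * g (n - 1 - i) else 0)"
proof -
  have "(mat n n (\<lambda>(i, j). if i + j + 1 = n then f i else 0) *
      mat n n (\<lambda>(i, j). if i + j + 1 = n then g i else 0)) $$ (i, j)
    = (\<Sum>k<n. (if i + k + 1 = n then f i else 0) * (if k + j + 1 = n then g k else 0))"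
    using assms by (simp add: scalar_prod_def lessThan_atLeast0)
  also have "\<dots> = (\<Sum>k\<in>{n - 1 - i}. (if i + k + 1 = n then f i else 0) * (if k + j + 1 = n then g k else 0))"
    using assms by (intro sum.mono_neutral_right) auto
  also have "\<dots> = (if i = j then f i * g (n - 1 - i) else 0)"
    using assms by auto
  finally show ?thesis .
qed

lemma w_mat_in_GL: "(w_mat n :: 'a::field mat) \<in> carrier (GL n)"
proof (rule GL_I)
  show "w_mat n * w_mat n = (1\<^sub>m n :: 'a mat)"
  proof (rule eq_matI)
    fix i j assume "i < dim_row (1\<^sub>m n)" "j < dim_col (1\<^sub>m n)"
    then have ij: "i < n" "j < n" by auto
    have "(w_mat n * w_mat n :: 'a mat) $$ (i, j) = (if i = j then 1 * 1 else 0)"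
      unfolding w_mat_def by (rule antidiagonal_mult[OF ij, of "\<lambda>_. 1" "\<lambda>_. 1"])
    then show "(w_mat n * w_mat n :: 'a mat) $$ (i, j) = 1\<^sub>m n $$ (i, j)" using ij by simp
  qed (simp_all add: w_mat_def)
qed (simp_all add: w_mat_def)

lemma u_mat_in_GL: "(u_mat n :: 'a::field mat) \<in> carrier (GL n)"
proof (rule GL_I)
  \<comment> \<open>Inverting an antidiagonal matrix moves the entry of row \<open>i\<close> to row
    \<open>n - 1 - i\<close>, hence the reflected exponent.\<close>
  let ?v = "mat n n (\<lambda>(i, j). if i + j + 1 = n then (-1) ^ (n - 1 - i) else 0) :: 'a mat"
  show "u_mat n * ?v = 1\<^sub>m n"
  proof (rule eq_matI)
    fix i j assume "i < dim_row (1\<^sub>m n)" "j < dim_col (1\<^sub>m n)"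
    then have ij: "i < n" "j < n" by auto
    have "(u_mat n * ?v) $$ (i, j) = (if i = j then (-1) ^ i * (-1) ^ (n - 1 - (n - 1 - i)) else 0)"
      unfolding u_mat_def
      by (rule antidiagonal_mult[OF ij, of "\<lambda>i. (-1) ^ i" "\<lambda>i. (-1) ^ (n - 1 - i)"])
    also have "n - 1 - (n - 1 - i) = i" using ij by simp
    also have "(if i = j then (-1) ^ i * (-1) ^ i else 0) = (1\<^sub>m n :: 'a mat) $$ (i, j)"
      using ij by (simp flip: power_mult_distrib)
    finally show "(u_mat n * ?v) $$ (i, j) = 1\<^sub>m n $$ (i, j)" .
  qed (simp_all add: u_mat_def)
qed (simp_all add: u_mat_def)

text \<open>On the antidiagonal \<open>i + j = n - 1\<close> is odd, so transposition exchanges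
  entries of opposite sign.\<close>

lemma transpose_u_mat:
  assumes "even n"
  shows "(u_mat n :: 'a::field mat)\<^sup>T = (- 1) \<cdot>\<^sub>m u_mat n"
proof (rule eq_matI)
  fix i j assume "i < dim_row ((- 1) \<cdot>\<^sub>m u_mat n :: 'a mat)" "j < dim_col ((- 1) \<cdot>\<^sub>m u_mat n :: 'a mat)"
  then have ij: "i < n" "j < n" by (auto simp: u_mat_def)
  have "(- 1) ^ j = - ((- 1 :: 'a) ^ i)" if "i + j + 1 = n"
  proof -
    have "odd (i + j)" using that assms by (metis even_plus_one_iff)
    then show ?thesis by (cases "even i") auto
  qed
  then show "(u_mat n :: 'a mat)\<^sup>T $$ (i, j) = ((- 1) \<cdot>\<^sub>m u_mat n) $$ (i, j)"
    using ij by (auto simp: u_mat_def add.commute)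
qed (simp_all add: u_mat_def)

lemma map_mat_to_ac_in_GL:
  assumes "\<Lambda> \<in> carrier (GL n)"
  shows "map_mat to_ac \<Lambda> \<in> carrier (GL n)"
proof (rule GL_I)
  let ?L = "inv\<^bsub>GL n\<^esub> \<Lambda>"
  have c: "\<Lambda> \<in> carrier_mat n n" "?L \<in> carrier_mat n n"
    using GL_carrier_mat[OF assms] inv_GL(2)[OF assms] by auto
  show "map_mat to_ac \<Lambda> \<in> carrier_mat n n" "map_mat to_ac ?L \<in> carrier_mat n n"
    using c by simp_all
  show "map_mat to_ac \<Lambda> * map_mat to_ac ?L = 1\<^sub>m n"
  proof (rule eq_matI)
    fix i j assume "i < dim_row (1\<^sub>m n)" "j < dim_col (1\<^sub>m n)"
    then have ij: "i < n" "j < n" by auto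
    have "to_ac (\<Sum>k = 0..<n. \<Lambda> $$ (i, k) * ?L $$ (k, j)) = to_ac ((\<Lambda> * ?L) $$ (i, j))"
      using ij carrier_matD[OF c(1)] carrier_matD[OF c(2)] by (simp add: scalar_prod_def)
    also have "\<dots> = 1\<^sub>m n $$ (i, j)"
      unfolding inv_GL(3)[OF assms] using ij by simp
    finally have "(\<Sum>k = 0..<n. to_ac (\<Lambda> $$ (i, k)) * to_ac (?L $$ (k, j))) = 1\<^sub>m n $$ (i, j)"
      by (simp add: to_ac_sum)
    then show "(map_mat to_ac \<Lambda> * map_mat to_ac ?L) $$ (i, j) = 1\<^sub>m n $$ (i, j)"
      using ij carrier_matD[OF c(1)] carrier_matD[OF c(2)] by (simp add: scalar_prod_def)
  qed (use c in auto)
qed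

text \<open>The antidiagonal part is its own inverse and does not interact with the middle block, so
  the inverse is the same matrix built from the inverse of \<open>\<Lambda>\<close>. The bound
  \<open>m \<ge> 1\<close> makes \<open>m - 1\<close> and \<open>m\<close> distinct indices.\<close>

lemma J_mat_in_GL:
  fixes \<Lambda> :: "'a::field mat"
  assumes m: "m \<ge> 1" and L: "\<Lambda> \<in> carrier (GL 2)"
  shows "J_mat m \<Lambda> \<in> carrier (GL (2 * m))"
proof (rule GL_I)
  let ?L = "inv\<^bsub>GL 2\<^esub> \<Lambda>"
  have c: "\<Lambda> \<in> carrier_mat 2 2" "?L \<in> carrier_mat 2 2"
    using GL_carrier_mat[OF L] inv_GL(2)[OF L] by auto
  let ?M = "{m - 1, m}"
  have LL: "(\<Sum>k\<in>?M. \<Lambda> $$ (i - (m - 1), k - (m - 1)) * ?L $$ (k - (m - 1), j - (m - 1))) = (if i = j then 1 else 0)"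
    if "i \<in> ?M" "j \<in> ?M" for i j
  proof -
    have ij: "i - (m - 1) < 2" "j - (m - 1) < 2" "(i - (m - 1) = j - (m - 1)) = (i = j)"
      using that m by auto
    have "(\<Sum>k\<in>?M. \<Lambda> $$ (i - (m - 1), k - (m - 1)) * ?L $$ (k - (m - 1), j - (m - 1)))
        = (\<Sum>k = 0..<2. \<Lambda> $$ (i - (m - 1), k) * ?L $$ (k, j - (m - 1)))"
      using m by (simp add: numeral_2_eq_2)
    also have "\<dots> = (\<Lambda> * ?L) $$ (i - (m - 1), j - (m - 1))"
      using ij carrier_matD[OF c(1)] carrier_matD[OF c(2)] by (simp add: scalar_prod_def)
    finally show ?thesis unfolding inv_GL(3)[OF L] using ij by simp
  qed
  show "J_mat m \<Lambda> * J_mat m ?L = 1\<^sub>m (2 * m)"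
  proof (rule eq_matI)
    fix i j assume "i < dim_row (1\<^sub>m (2 * m))" "j < dim_col (1\<^sub>m (2 * m))"
    then have ij: "i < 2 * m" "j < 2 * m" by auto
    define J where "J \<Lambda> i j = (if i \<in> ?M \<and> j \<in> ?M then \<Lambda> $$ (i - (m - 1), j - (m - 1))
      else if i + j + 1 = 2 * m then 1 else 0)" for \<Lambda> :: "'a mat" and i j
    have *: "(J_mat m \<Lambda> * J_mat m ?L) $$ (i, j) = (\<Sum>k<2 * m. J \<Lambda> i k * J ?L k j)"
      using ij by (simp add: J_mat_def J_def scalar_prod_def lessThan_atLeast0)
    show "(J_mat m \<Lambda> * J_mat m ?L) $$ (i, j) = 1\<^sub>m (2 * m) $$ (i, j)"
    proof (cases "i \<in> ?M")
      case True
      have "J \<Lambda> i k = 0" if "k \<notin> ?M" for k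
        using that True m by (auto simp: J_def)
      then have "(\<Sum>k<2 * m. J \<Lambda> i k * J ?L k j) = (\<Sum>k\<in>?M. J \<Lambda> i k * J ?L k j)"
        using m by (intro sum.mono_neutral_right) auto
      also have "\<dots> = (if i = j then 1 else 0)"
      proof (cases "j \<in> ?M")
        case jM: True
        have "(\<Sum>k\<in>?M. J \<Lambda> i k * J ?L k j) =
            (\<Sum>k\<in>?M. \<Lambda> $$ (i - (m - 1), k - (m - 1)) * ?L $$ (k - (m - 1), j - (m - 1)))"
          using True jM by (intro sum.cong refl) (simp only: J_def simp_thms if_True)
        then show ?thesis using LL[OF True jM] by simp
      next
        case False
        then have "J ?L k j = 0" if "k \<in> ?M" for k using that m by (auto simp: J_def)
        then have "(\<Sum>k\<in>?M. J \<Lambda> i k * J ?L k j) = 0" by (intro sum.neutral) simp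
        then show ?thesis using True False by auto
      qed
      finally show ?thesis using * ij by simp
    next
      case False
      let ?k = "2 * m - 1 - i"
      have "J \<Lambda> i k = 0" if "k < 2 * m" "k \<noteq> ?k" for k
        using that False ij by (auto simp: J_def)
      then have "(\<Sum>k<2 * m. J \<Lambda> i k * J ?L k j) = (\<Sum>k\<in>{?k}. J \<Lambda> i k * J ?L k j)"
        using ij by (intro sum.mono_neutral_right) auto
      also have "\<dots> = J ?L ?k j" using False ij by (simp add: J_def)
      also have "\<dots> = (if i = j then 1 else 0)"
      proof -
        have "?k \<notin> ?M" using False ij m by auto
        then show ?thesis using ij by (auto simp: J_def)
      qed
      finally show ?thesis using * ij by simp
    qed
  qed (simp_all add: J_mat_def)
qed (simp_all add: J_mat_def)

lemma transpose_J_mat: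
  assumes "\<Lambda> \<in> carrier_mat 2 2" "\<Lambda>\<^sup>T = \<Lambda>" "m \<ge> 1"
  shows "(J_mat m \<Lambda>)\<^sup>T = J_mat m \<Lambda>"
proof (rule eq_matI)
  have sym: "\<Lambda> $$ (j, i) = \<Lambda> $$ (i, j)" if "i < 2" "j < 2" for i j
    using assms that by (metis carrier_matD index_transpose_mat(1))
  fix i j assume "i < dim_row (J_mat m \<Lambda>)" "j < dim_col (J_mat m \<Lambda>)"
  then show "(J_mat m \<Lambda>)\<^sup>T $$ (i, j) = J_mat m \<Lambda> $$ (i, j)"
    using assms(3) sym[of "i - (m - 1)" "j - (m - 1)"] by (auto simp: J_mat_def add.commute)
qed (simp_all add: J_mat_def)

definition vdash_mat :: "nat \<Rightarrow> 'f::field case_type \<Rightarrow> 'f alg_closure mat" where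
  "vdash_mat m c = (case c of Orthogonal \<Lambda> \<Rightarrow> w_mat (2 * m) | Symplectic \<Rightarrow> u_mat (2 * m))"

lemma vdash_mat_in_GL: "vdash_mat m c \<in> carrier (GL (2 * m))"
  by (simp add: vdash_mat_def w_mat_in_GL u_mat_in_GL split: case_type.split)

lemma vdash_eq: "vdash m c g = vdash_mat m c * g\<^sup>T * inv\<^bsub>GL (2 * m)\<^esub> (vdash_mat m c)"
  by (simp add: vdash_def vdash_mat_def Let_def)

lemma form_mat_in_GL:
  assumes "m \<ge> 1" "wf_case c"
  shows "form_mat m c \<in> carrier (GL (2 * m))"
  using assms by (auto simp: form_mat_def wf_case_def u_mat_in_GL
      intro!: J_mat_in_GL map_mat_to_ac_in_GL split: case_type.splits)

lemma transpose_form_mat: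
  assumes "m \<ge> 1" "wf_case c"
  shows "\<exists>e. (e = 1 \<or> e = - 1) \<and> (form_mat m c)\<^sup>T = e \<cdot>\<^sub>m form_mat m c"
proof (cases c)
  case (Orthogonal \<Lambda>)
  then have L: "\<Lambda> \<in> carrier_mat 2 2" "\<Lambda>\<^sup>T = \<Lambda>"
    using assms(2) GL_carrier_mat by (auto simp: wf_case_def)
  have "(map_mat to_ac \<Lambda>)\<^sup>T = map_mat to_ac (\<Lambda>\<^sup>T)" by (rule eq_matI) auto
  then have "(J_mat m (map_mat to_ac \<Lambda>))\<^sup>T = J_mat m (map_mat to_ac \<Lambda>)"
    using L assms(1) by (intro transpose_J_mat) auto
  then show ?thesis using Orthogonal by (intro exI[of _ 1]) (auto simp: form_mat_def intro: eq_matI)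
next
  case Symplectic
  then show ?thesis
    using transpose_u_mat[of "2 * m"] by (intro exI[of _ "- 1"]) (simp add: form_mat_def)
qed

text \<open>In the symplectic case \<open>v\<close> and the form are both \<open>u\<close>, so
  \<open>v J^-1 = 1\<close> and the two definitions of \<open>S\<close> become one formula.\<close>

lemma S_map_eq:
  assumes "\<gamma> \<in> carrier_mat (2 * m) (2 * m)"
  shows "S_map m c \<gamma> = vdash_mat m c * inv\<^bsub>GL (2 * m)\<^esub> (form_mat m c) * (\<gamma> - 1\<^sub>m (2 * m))"
proof (cases c)
  case Symplectic
  have "u_mat (2 * m) * inv\<^bsub>GL (2 * m)\<^esub> u_mat (2 * m) * (\<gamma> - 1\<^sub>m (2 * m)) = \<gamma> - 1\<^sub>m (2 * m)"
    unfolding inv_GL(3)[OF u_mat_in_GL] by (rule left_mult_one_mat[of _ _ "2 * m"])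
      (rule minus_carrier_mat, rule one_carrier_mat)
  then show ?thesis using Symplectic by (simp add: S_map_def vdash_mat_def form_mat_def)
qed (simp add: S_map_def vdash_mat_def)

lemma H_plus_eq: "H_plus m c = isom_group (2 * m) (form_mat m c)"
  by (simp add: H_plus_def isom_group_def)

lemma H_group_subset_H_plus: "H_group m c \<subseteq> H_plus m c"
proof (cases c)
  case (Orthogonal \<Lambda>)
  have "h \<in> H_plus m c" if "connected_component_of (subtopology (zariski_GL (2 * m)) (H_plus m c)) (1\<^sub>m (2 * m)) h" for h
    using connected_component_in_topspace[OF that] by simp
  then show ?thesis using Orthogonal by (auto simp: H_group_def identity_component_def)
qed (simp add: H_group_def)

section \<open>The fibres of the map\<close>

text \<open>Treats both cases together: the orthogonal case supplies \<open>e = 1\<close> and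
  \<open>v = w\<close>, the symplectic one \<open>e = - 1\<close> and \<open>v = J = u\<close>.
  \<open>T\<close> is placed in the full isometry group because that is where regularity measures
  centralizers.\<close>

locale twisted_form =
  fixes n :: nat and J v :: "'a::{alg_closed_field, field_char_0} mat" and e :: 'a
    and T :: "'a mat set"
  assumes J: "J \<in> carrier (GL n)" and JT: "J\<^sup>T = e \<cdot>\<^sub>m J" and e: "e = 1 \<or> e = - 1"
    and v: "v \<in> carrier (GL n)" and T: "is_torus n T" and TJ: "T \<subseteq> isom_group n J"
begin

definition S where "S g = v * inv\<^bsub>GL n\<^esub> J * (g - 1\<^sub>m n)"

definition flip where "flip g = v * g\<^sup>T * inv\<^bsub>GL n\<^esub> v"

definition Tr where "Tr = {g \<in> T. {h \<in> isom_group n J. h * g = g * h} = T}"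

definition B where "B g = inv\<^bsub>GL n\<^esub> (g - 1\<^sub>m n) * J"

definition \<tau> where "\<tau> x g = x * inv\<^bsub>GL n\<^esub> (S g) * flip x"

lemmas [simp] = assoc_mult_mat[of _ n n _ n _ n] mult_carrier_mat[of _ n n _ n]
  left_mult_one_mat[of _ n n] right_mult_one_mat[of _ n n] minus_carrier_mat[of _ n n]

lemma carrier [simp]: "J \<in> carrier_mat n n" "v \<in> carrier_mat n n" "inv\<^bsub>GL n\<^esub> J \<in> carrier_mat n n"
  "inv\<^bsub>GL n\<^esub> v \<in> carrier_mat n n"
  using GL_carrier_mat[OF J] GL_carrier_mat[OF v] inv_GL(2)[OF J] inv_GL(2)[OF v] by auto

lemma infinite_UNIV: "infinite (UNIV :: 'a set)"
  by (rule infinite_UNIV_char_0)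

lemma T_GL: "T \<subseteq> carrier (GL n)" "subgroup T (GL n)"
  using T subgroup.subset unfolding is_torus_def by blast+

lemma Tr_T: "g \<in> Tr \<Longrightarrow> g \<in> T" "g \<in> Tr \<Longrightarrow> g \<in> carrier (GL n)" "g \<in> Tr \<Longrightarrow> g \<in> carrier_mat n n"
  "g \<in> Tr \<Longrightarrow> g \<in> isom_group n J"
  using T_GL(1) TJ GL_carrier_mat unfolding Tr_def by blast+

lemma Tr_centralizer: "g \<in> Tr \<Longrightarrow> h \<in> T \<longleftrightarrow> h \<in> isom_group n J \<and> h * g = g * h"
  unfolding Tr_def by blast

text \<open>In a basis diagonalizing \<open>T\<close>, that is after conjugation by
  \<open>p = P^-1\<close> and replacing \<open>J\<close> by the congruent form
  \<open>p J p\<^sup>T\<close>, the diagonal case applies. Conjugation preserves the determinant of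
  \<open>g - 1\<close>.\<close>

lemma minus_one_GL:
  assumes g: "g \<in> Tr"
  shows "g - 1\<^sub>m n \<in> carrier (GL n)"
proof -
  obtain P where P: "P \<in> carrier (GL n)" "\<forall>t\<in>T. \<exists>c. t * P = P * dmat n c"
    using torus_diagonalizable[OF infinite_UNIV T] by blast
  define p where "p = inv\<^bsub>GL n\<^esub> P"
  have p: "p \<in> carrier (GL n)" unfolding p_def by (rule inv_GL(1)[OF P(1)])
  have pn: "p \<in> carrier_mat n n" "P \<in> carrier_mat n n" using p P GL_carrier_mat by auto
  have ip: "inv\<^bsub>GL n\<^esub> p = P"
    by (rule inv_GL_unique[OF p pn(2)]) (simp add: p_def inv_GL(4)[OF P(1)])
  define c where "c x = p * x * inv\<^bsub>GL n\<^esub> p" for x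
  define d where "d x = inv\<^bsub>GL n\<^esub> p * x * p" for x
  note c = GL_conj[OF p, folded c_def d_def]
  have Tn: "t \<in> carrier_mat n n" if "t \<in> T" for t using that T_GL(1) GL_carrier_mat by blast
  have gn: "g \<in> carrier_mat n n" and gT: "g \<in> T" using Tr_T[OF g] by auto
  let ?J = "p * J * p\<^sup>T"
  have "c g - 1\<^sub>m n \<in> carrier (GL n)"
  proof (rule diagonal_regular_minus_one[of ?J n e "c ` T"])
    show "?J \<in> carrier (GL n)" using p J by (intro mult_in_GL transpose_in_GL)
    have "?J\<^sup>T = p * (J\<^sup>T * p\<^sup>T)" using pn by (simp add: transpose_mult[of _ n n _ n])
    also have "\<dots> = e \<cdot>\<^sub>m ?J" unfolding JT using pn
      by (simp add: mult_smult_assoc_mat[of _ n n _ n] mult_smult_distrib[of _ n n _ n])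
    finally show "?J\<^sup>T = e \<cdot>\<^sub>m ?J" .
    show "c ` T \<subseteq> isom_group n ?J"
      using isom_group_conj[OF p carrier(1)] T_GL(1) TJ unfolding c_def by blast
    show "\<exists>f. t = dmat n f" if t: "t \<in> c ` T" for t
    proof -
      obtain s where s: "s \<in> T" "t = c s" using t by blast
      obtain f where "s * P = P * dmat n f" using P(2) s(1) by blast
      then have "p * (s * P) = dmat n f"
        unfolding p_def using inv_GL_mult[OF P(1), of "dmat n f" n] by simp
      then have "t = dmat n f" using s pn Tn[OF s(1)] by (simp add: c_def ip)
      then show ?thesis by (rule exI[where x = f])
    qed
    show "\<exists>s\<in>c ` T. s * s = t" if tc: "t \<in> c ` T" for t
    proof -
      obtain t' where t: "t' \<in> T" "t = c t'" using tc by blast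
      obtain s where s: "s \<in> T" "s * s = t'" using torus_square_root[OF T t(1)] by blast
      then have "c s * c s = t" using c(4)[OF Tn[OF s(1)] Tn[OF s(1)]] t by simp
      then show ?thesis using s(1) by blast
    qed
    show "c g \<in> c ` T" using gT by blast
    show "h \<in> c ` T" if h: "h \<in> isom_group n ?J" "h * c g = c g * h" for h
    proof -
      have hn: "h \<in> carrier (GL n)" "h \<in> carrier_mat n n" using isom_groupD[OF h(1)] by auto
      have hd: "h = c (d h)" using c(3)[OF hn(2)] by simp
      have dG: "d h \<in> carrier (GL n)" unfolding d_def ip using P(1) hn p by (intro mult_in_GL)
      then have dn: "d h \<in> carrier_mat n n" by (rule GL_carrier_mat)
      have "d h \<in> isom_group n J"
        using isom_group_conj[OF p carrier(1) dG] h(1) hd by (simp add: c_def)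
      moreover have "d h * g = g * d h"
      proof -
        have "c (d h * g) = c (g * d h)" using h(2) hd c(4)[OF dn gn] c(4)[OF gn dn] by simp
        then have "d (c (d h * g)) = d (c (g * d h))" by simp
        then show ?thesis using c(2)[of "d h * g"] c(2)[of "g * d h"] dn gn by simp
      qed
      ultimately have "d h \<in> T" using Tr_centralizer[OF g] by blast
      then show ?thesis using hd by blast
    qed
  qed (use e in auto)
  moreover have "c g - 1\<^sub>m n = c (g - 1\<^sub>m n)"
  proof -
    have "c (g - 1\<^sub>m n) = p * ((g - 1\<^sub>m n) * P)" using pn gn by (simp add: c_def ip)
    also have "\<dots> = p * (g * P) - p * P"
      using pn gn by (simp add: minus_one_mult_mat[of _ n] mult_minus_distrib_mat[of _ n n _ n])
    also have "p * P = 1\<^sub>m n" unfolding p_def by (rule inv_GL(4)[OF P(1)])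
    finally show ?thesis using pn gn by (simp add: c_def ip)
  qed
  moreover have "g - 1\<^sub>m n \<in> carrier_mat n n" by simp
  ultimately show ?thesis using c(5)[of "g - 1\<^sub>m n"] by (simp add: carrier_GL_iff)
qed

lemma B_props:
  assumes g: "g \<in> Tr"
  shows "B g \<in> carrier_mat n n" "(g - 1\<^sub>m n) * B g = J" "B g \<in> carrier (GL n)"
proof -
  have N: "g - 1\<^sub>m n \<in> carrier (GL n)" by (rule minus_one_GL[OF g])
  show "B g \<in> carrier (GL n)" unfolding B_def using N J by (intro mult_in_GL inv_GL(1))
  then show "B g \<in> carrier_mat n n" by (rule GL_carrier_mat)
  show "(g - 1\<^sub>m n) * B g = J" unfolding B_def by (rule inv_GL_mult[OF N carrier(1)])
qed

lemma inv_S: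
  assumes g: "g \<in> Tr"
  shows "inv\<^bsub>GL n\<^esub> (S g) = B g * inv\<^bsub>GL n\<^esub> v"
proof (rule inv_GL_unique)
  have N: "g - 1\<^sub>m n \<in> carrier (GL n)" by (rule minus_one_GL[OF g])
  have Nn: "g - 1\<^sub>m n \<in> carrier_mat n n" by (rule GL_carrier_mat[OF N])
  note b = B_props[OF g]
  show "S g \<in> carrier (GL n)" unfolding S_def using N J v by (intro mult_in_GL inv_GL(1))
  show "B g * inv\<^bsub>GL n\<^esub> v \<in> carrier_mat n n" using b by simp
  have "S g * (B g * inv\<^bsub>GL n\<^esub> v) = v * (inv\<^bsub>GL n\<^esub> J * (((g - 1\<^sub>m n) * B g) * inv\<^bsub>GL n\<^esub> v))"
    unfolding S_def using Nn b(1) by simp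
  also have "\<dots> = 1\<^sub>m n"
    unfolding b(2) using inv_GL_mult[OF J, of "inv\<^bsub>GL n\<^esub> v" n] inv_GL(3)[OF v] by simp
  finally show "S g * (B g * inv\<^bsub>GL n\<^esub> v) = 1\<^sub>m n" .
qed

text \<open>The \<open>v^-1\<close> at the end of the inverse of \<open>S g\<close> cancels the
  \<open>v\<close> that opens \<open>flip x\<close>, leaving a congruence followed by a fixed
  factor.\<close>

lemma \<tau>_eq:
  assumes g: "g \<in> Tr" and x: "x \<in> carrier (GL n)"
  shows "\<tau> x g = x * B g * x\<^sup>T * inv\<^bsub>GL n\<^esub> v"
  using GL_carrier_mat[OF x] B_props(1)[OF g] inv_GL_mult[OF v, of "x\<^sup>T * inv\<^bsub>GL n\<^esub> v" n]
  by (simp add: \<tau>_def inv_S[OF g] flip_def)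

lemma \<tau>_in_GL:
  assumes "g \<in> Tr" "x \<in> carrier (GL n)"
  shows "\<tau> x g \<in> carrier (GL n)"
  unfolding \<tau>_eq[OF assms] using assms B_props(3) v by (intro mult_in_GL transpose_in_GL inv_GL(1))

lemma \<tau>_eq_iff:
  assumes g: "g1 \<in> Tr" "g2 \<in> Tr" and x: "x1 \<in> carrier (GL n)" "x2 \<in> carrier (GL n)"
  defines "h \<equiv> inv\<^bsub>GL n\<^esub> x2 * x1"
  shows "\<tau> x1 g1 = \<tau> x2 g2 \<longleftrightarrow> h \<in> isom_group n J \<and> h * g1 = g2 * h"
proof -
  have xn: "x1 \<in> carrier_mat n n" "x2 \<in> carrier_mat n n" using x GL_carrier_mat by auto
  have h: "h \<in> carrier (GL n)" unfolding h_def using x by (intro mult_in_GL inv_GL(1))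
  have hn: "h \<in> carrier_mat n n" by (rule GL_carrier_mat[OF h])
  note b1 = B_props[OF g(1)] and b2 = B_props[OF g(2)]
  have x1: "x1 = x2 * h" unfolding h_def using inv_GL_mult[OF x(2) xn(1)] by simp
  have "\<tau> x1 g1 = \<tau> x2 g2 \<longleftrightarrow> x1 * B g1 * x1\<^sup>T = x2 * B g2 * x2\<^sup>T"
  proof
    assume "\<tau> x1 g1 = \<tau> x2 g2"
    then have "(x1 * B g1 * x1\<^sup>T) * inv\<^bsub>GL n\<^esub> v = (x2 * B g2 * x2\<^sup>T) * inv\<^bsub>GL n\<^esub> v"
      by (simp only: \<tau>_eq[OF g(1) x(1)] \<tau>_eq[OF g(2) x(2)])
    then show "x1 * B g1 * x1\<^sup>T = x2 * B g2 * x2\<^sup>T"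
      by (rule GL_cancel_right[where k = n, OF inv_GL(1)[OF v], rotated 2]) (use xn b1 b2 in simp_all)
  qed (simp only: \<tau>_eq[OF g(1) x(1)] \<tau>_eq[OF g(2) x(2)])
  also have "x1 * B g1 * x1\<^sup>T = x2 * (h * B g1 * h\<^sup>T) * x2\<^sup>T"
    unfolding x1 using xn hn b1 by (simp add: transpose_mult[of _ n n _ n])
  also have "\<dots> = x2 * B g2 * x2\<^sup>T \<longleftrightarrow> h * B g1 * h\<^sup>T = B g2"
    by (rule GL_congruence_cancel[OF x(2)]) (use hn b1 b2 in simp_all)
  also have "\<dots> \<longleftrightarrow> h \<in> isom_group n J \<and> h * g1 = g2 * h"
    using e b1 b2 h by (intro cayley_form_equiv_iff[OF carrier(1) JT _ J Tr_T(4)[OF g(1)]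
        minus_one_GL[OF g(1)] _ _ Tr_T(4)[OF g(2)] minus_one_GL[OF g(2)]]) auto
  finally show ?thesis .
qed

lemma \<tau>_eq_iff_T:
  assumes g: "g \<in> Tr" and x: "x1 \<in> carrier (GL n)" "x2 \<in> carrier (GL n)"
  shows "\<tau> x1 g = \<tau> x2 g \<longleftrightarrow> inv\<^bsub>GL n\<^esub> x2 * x1 \<in> T"
  unfolding \<tau>_eq_iff[OF g g x] using Tr_centralizer[OF g] by blast

lemma \<tau>_coset:
  assumes g: "g \<in> Tr" and x: "x \<in> carrier (GL n)" and y: "y \<in> x <#\<^bsub>GL n\<^esub> T"
  shows "\<tau> y g = \<tau> x g"
proof -
  obtain t where t: "t \<in> T" "y = x * t" using y by (auto simp: l_coset_def)
  have tG: "t \<in> carrier (GL n)" using t(1) T_GL(1) by blast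
  have "inv\<^bsub>GL n\<^esub> x * y = t" unfolding t(2) by (rule inv_GL_mult[OF x GL_carrier_mat[OF tG]])
  then show ?thesis
    unfolding t(2) using t mult_in_GL[OF x tG] by (subst \<tau>_eq_iff_T[OF g _ x]) auto
qed

text \<open>As \<open>flip\<close> reverses products, \<open>y\<close> moves
  \<open>\<tau> x g\<close> to \<open>\<tau> (y * x) g\<close>. So \<open>y\<close> fixes it exactly
  if \<open>y * x\<close> and \<open>x\<close> represent the same coset of \<open>T\<close>.\<close>

lemma twisted_centralizer_\<tau>:
  assumes g: "g \<in> Tr" and x: "x \<in> carrier (GL n)"
  shows "{y \<in> carrier (GL n). y * \<tau> x g * flip y = \<tau> x g} = (\<lambda>t. x * t * inv\<^bsub>GL n\<^esub> x) ` T"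
proof -
  have xn: "x \<in> carrier_mat n n" "inv\<^bsub>GL n\<^esub> x \<in> carrier_mat n n"
    using GL_carrier_mat[OF x] inv_GL(2)[OF x] by auto
  have "y * \<tau> x g * flip y = \<tau> x g \<longleftrightarrow> inv\<^bsub>GL n\<^esub> x * (y * x) \<in> T" if y: "y \<in> carrier (GL n)" for y
  proof -
    have yn: "y \<in> carrier_mat n n" by (rule GL_carrier_mat[OF y])
    have "y * \<tau> x g * flip y = \<tau> (y * x) g"
      unfolding \<tau>_eq[OF g x] \<tau>_eq[OF g mult_in_GL[OF y x]] flip_def
      using xn yn B_props(1)[OF g] inv_GL_mult[OF v, of "y\<^sup>T * inv\<^bsub>GL n\<^esub> v" n]
      by (simp add: transpose_mult[of _ n n _ n])
    then show ?thesis using \<tau>_eq_iff_T[OF g mult_in_GL[OF y x] x] by simp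
  qed
  moreover have "inv\<^bsub>GL n\<^esub> x * (y * x) \<in> T \<longleftrightarrow> y \<in> (\<lambda>t. x * t * inv\<^bsub>GL n\<^esub> x) ` T"
    if "y \<in> carrier (GL n)" for y
  proof -
    have yn: "y \<in> carrier_mat n n" by (rule GL_carrier_mat[OF that])
    have "y = x * (inv\<^bsub>GL n\<^esub> x * (y * x)) * inv\<^bsub>GL n\<^esub> x"
      using GL_conj(3)[OF x yn] xn yn by simp
    moreover have "inv\<^bsub>GL n\<^esub> x * ((x * t * inv\<^bsub>GL n\<^esub> x) * x) = t" if "t \<in> T" for t
    proof -
      have tn: "t \<in> carrier_mat n n" using that T_GL(1) GL_carrier_mat by blast
      then show ?thesis using GL_conj(2)[OF x tn] xn by simp
    qed
    ultimately show ?thesis by (metis (no_types, lifting) image_iff)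
  qed
  moreover have "x * t * inv\<^bsub>GL n\<^esub> x \<in> carrier (GL n)" if "t \<in> T" for t
    using that T_GL(1) x by (intro mult_in_GL inv_GL(1)) auto
  ultimately show ?thesis by auto
qed

lemma torus_twisted_centralizer:
  assumes g: "g \<in> Tr" and x: "x \<in> carrier (GL n)"
  shows "is_torus n (identity_component n {y \<in> carrier (GL n). y * \<tau> x g * flip y = \<tau> x g})"
proof -
  have "is_torus n ((\<lambda>t. x * t * inv\<^bsub>GL n\<^esub> x) ` T)" by (rule is_torus_conj[OF T x])
  then show ?thesis
    unfolding twisted_centralizer_\<tau>[OF assms]
    by (simp only: identity_component_torus[OF infinite_UNIV])
qed

text \<open>With \<open>D = x (B g) x\<^sup>T\<close> the factors \<open>v\<close> cancel and the
  automorphism is \<open>A -> D A^-T D^-1\<close>. The asymmetry \<open>D (D\<^sup>T)^-1\<close> is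
  \<open>C = x (- e g^-1) x^-1\<close>, and it is diagonalized by \<open>x * P\<close> because
  \<open>g^-1\<close> lies in \<open>T\<close>.\<close>

lemma semisimple_\<tau>:
  assumes g: "g \<in> Tr" and x: "x \<in> carrier (GL n)"
  shows "semisimple_aut n (carrier (GL n))
    (\<lambda>A. \<tau> x g * flip (inv\<^bsub>GL n\<^esub> A) * inv\<^bsub>GL n\<^esub> (\<tau> x g))"
proof -
  let ?x = "inv\<^bsub>GL n\<^esub> x" and ?g = "inv\<^bsub>GL n\<^esub> g"
  have gn: "g \<in> carrier_mat n n" "?g \<in> carrier_mat n n" and xn: "x \<in> carrier_mat n n" "?x \<in> carrier_mat n n"
    using Tr_T[OF g] inv_GL(2)[OF Tr_T(2)[OF g]] GL_carrier_mat[OF x] inv_GL(2)[OF x] by auto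
  note b = B_props[OF g]
  define D where "D = x * B g * x\<^sup>T"
  have DG: "D \<in> carrier (GL n)" unfolding D_def using x b by (intro mult_in_GL transpose_in_GL)
  have Dn: "D \<in> carrier_mat n n" "inv\<^bsub>GL n\<^esub> D \<in> carrier_mat n n"
    using GL_carrier_mat[OF DG] inv_GL(2)[OF DG] by auto
  have \<tau>D: "\<tau> x g = D * inv\<^bsub>GL n\<^esub> v" unfolding D_def by (rule \<tau>_eq[OF assms])
  have inv\<tau>: "inv\<^bsub>GL n\<^esub> (\<tau> x g) = v * inv\<^bsub>GL n\<^esub> D"
    by (rule inv_GL_unique[OF \<tau>_in_GL[OF assms]])
      (use Dn inv_GL_mult[OF v, of "inv\<^bsub>GL n\<^esub> D" n] inv_GL(3)[OF DG] in \<open>simp_all add: \<tau>D\<close>)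
  have eq: "\<tau> x g * flip (inv\<^bsub>GL n\<^esub> A) * inv\<^bsub>GL n\<^esub> (\<tau> x g) = D * (inv\<^bsub>GL n\<^esub> A)\<^sup>T * inv\<^bsub>GL n\<^esub> D"
    if "A \<in> carrier (GL n)" for A
  proof -
    have An: "inv\<^bsub>GL n\<^esub> A \<in> carrier_mat n n" by (rule inv_GL(2)[OF that])
    show ?thesis
      unfolding inv\<tau> unfolding \<tau>D flip_def
      using Dn An inv_GL_mult[OF v, of "inv\<^bsub>GL n\<^esub> D" n]
        inv_GL_mult[OF v, of "(inv\<^bsub>GL n\<^esub> A)\<^sup>T * inv\<^bsub>GL n\<^esub> D" n]
      by simp
  qed
  have e2: "e * e = 1" using e by auto
  \<comment> \<open>Combines \<open>g B = J + B\<close> with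
    \<open>J = - (B + e B\<^sup>T)\<close>.\<close>
  have asym: "g * B g = (- e) \<cdot>\<^sub>m (B g)\<^sup>T"
  proof -
    have bt: "B g \<in> carrier_mat n n" "(B g)\<^sup>T \<in> carrier_mat n n" using b by simp_all
    have "B g + e \<cdot>\<^sub>m (B g)\<^sup>T = - J"
      by (rule sum_transpose_cayley_form[OF carrier(1) JT e2 Tr_T(4)[OF g] minus_one_GL[OF g] b(1,2)])
    then have J': "J = - (B g + e \<cdot>\<^sub>m (B g)\<^sup>T)" by (simp only: uminus_uminus_mat)
    have "g * B g = J + B g"
      using b(1,2) gn by (intro mat_diff_eqD[of _ n n]) (simp_all add: minus_one_mult_mat[of _ n])
    also have "\<dots> = - (B g + e \<cdot>\<^sub>m (B g)\<^sup>T) + B g" by (rule arg_cong[OF J'])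
    also have "\<dots> = (- e) \<cdot>\<^sub>m (B g)\<^sup>T"
      using carrier_matD[OF bt(1)] by (intro eq_matI) auto
    finally show ?thesis .
  qed
  have gB: "B g = (- e) \<cdot>\<^sub>m (?g * (B g)\<^sup>T)"
  proof -
    have "?g * (g * B g) = (- e) \<cdot>\<^sub>m (?g * (B g)\<^sup>T)"
      unfolding asym using gn b(1) by (simp add: mult_smult_distrib[of _ n n _ n])
    then show ?thesis using inv_GL_mult(1)[OF Tr_T(2)[OF g] b(1)] by simp
  qed
  obtain P where P: "P \<in> carrier (GL n)" "\<forall>t\<in>T. \<exists>c. t * P = P * dmat n c"
    using torus_diagonalizable[OF infinite_UNIV T] by blast
  have Pn: "P \<in> carrier_mat n n" by (rule GL_carrier_mat[OF P(1)])
  have "?g \<in> T" using Tr_T(1)[OF g] T_GL(2) by (simp add: subgroup.m_inv_closed)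
  then obtain d where d: "?g * P = P * dmat n d" using P(2) by blast
  have "det ?g * det P = det (P * dmat n d)"
    unfolding d[symmetric] by (rule det_mult[OF gn(2) Pn, symmetric])
  also have "\<dots> = det P * det (dmat n d)" by (rule det_mult[OF Pn dmat_carrier])
  finally have "det ?g * det P = det P * det (dmat n d)" .
  \<comment> \<open>Invertibility of \<open>g^-1\<close> passes to its diagonal form, so the
    eigenvalues are nonzero, as the eigenfunction argument demands.\<close>
  then have "det (dmat n d) \<noteq> 0"
    using inv_GL(1)[OF Tr_T(2)[OF g]] P(1) by (auto simp: carrier_GL_iff)
  then have d0: "d i \<noteq> 0" if "i < n" for i using that by (simp add: det_dmat)
  define C where "C = x * ((- e) \<cdot>\<^sub>m ?g) * ?x"
  have Cn: "C \<in> carrier_mat n n" unfolding C_def using xn gn by simp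
  have DC: "D = C * D\<^sup>T"
  proof -
    have DT: "D\<^sup>T = x * ((B g)\<^sup>T * x\<^sup>T)"
      unfolding D_def using xn b(1) by (simp add: transpose_mult[of _ n n _ n])
    have "C * D\<^sup>T = x * (((- e) \<cdot>\<^sub>m ?g) * ((B g)\<^sup>T * x\<^sup>T))"
      unfolding C_def DT using xn gn b(1) inv_GL_mult[OF x, of "(B g)\<^sup>T * x\<^sup>T" n] by simp
    also have "\<dots> = x * (((- e) \<cdot>\<^sub>m (?g * (B g)\<^sup>T)) * x\<^sup>T)"
      using gn b(1) xn by (simp add: mult_smult_assoc_mat[of _ n n _ n])
    also have "\<dots> = D" unfolding gB[symmetric] D_def using xn b(1) by simp
    finally show ?thesis by simp
  qed
  have CG: "C \<in> carrier (GL n)"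
  proof -
    have "det D = det C * det (D\<^sup>T)" using det_mult[OF Cn, of "D\<^sup>T"] DC Dn by simp
    then show ?thesis using DG Cn by (auto simp: carrier_GL_iff)
  qed
  have CQ: "C * (x * P) = (x * P) * dmat n (\<lambda>i. - e * d i)"
  proof -
    have "C * (x * P) = x * (((- e) \<cdot>\<^sub>m ?g) * P)"
      unfolding C_def using xn gn Pn inv_GL_mult[OF x Pn] by simp
    also have "((- e) \<cdot>\<^sub>m ?g) * P = (- e) \<cdot>\<^sub>m (P * dmat n d)"
      using gn Pn by (simp add: mult_smult_assoc_mat[of _ n n _ n] d)
    also have "\<dots> = P * ((- e) \<cdot>\<^sub>m dmat n d)"
      using Pn by (simp add: mult_smult_distrib[of _ n n _ n])
    also have "(- e) \<cdot>\<^sub>m dmat n d = dmat n (\<lambda>i. - e * d i)"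
      by (rule eq_matI) (auto simp: dmat_index)
    finally show ?thesis using xn Pn by simp
  qed
  have "semisimple_aut n (carrier (GL n)) (\<lambda>A. D * (inv\<^bsub>GL n\<^esub> A)\<^sup>T * inv\<^bsub>GL n\<^esub> D)"
    by (rule semisimple_aut_transpose_inverse[OF DG mult_in_GL[OF x P(1)] _ CG CQ DC])
      (use d0 e2 in auto)
  then show ?thesis by (simp add: semisimple_aut_def eq)
qed

text \<open>Members of the fibre have conjugate second components, hence with the same eigenvalues,
  and there are finitely many such elements in a diagonalizable group; the second component
  determines the coset because its centralizer is \<open>T\<close>.\<close>

lemma finite_fibre:
  assumes \<beta>: "\<And>x g. x \<in> carrier (GL n) \<Longrightarrow> g \<in> Tr \<Longrightarrow> \<beta> (x <#\<^bsub>GL n\<^esub> T, g) = \<tau> x g"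
  shows "finite {y \<in> (lcosets\<^bsub>GL n\<^esub> T) \<times> Tr. \<beta> y = \<delta>}"
proof -
  let ?F = "{y \<in> (lcosets\<^bsub>GL n\<^esub> T) \<times> Tr. \<beta> y = \<delta>}"
  have F: "\<exists>x\<in>carrier (GL n). C = x <#\<^bsub>GL n\<^esub> T \<and> g \<in> Tr \<and> \<tau> x g = \<delta>" if "(C, g) \<in> ?F" for C g
    using that \<beta> unfolding LCOSETS_def by fastforce
  have inj: "inj_on snd ?F"
  proof (rule inj_onI)
    fix y z assume yz: "y \<in> ?F" "z \<in> ?F" "snd y = snd z"
    obtain g where g: "y = (fst y, g)" "z = (fst z, g)" using yz(3) by (metis prod.collapse)
    obtain x1 where x1: "x1 \<in> carrier (GL n)" "fst y = x1 <#\<^bsub>GL n\<^esub> T" "g \<in> Tr" "\<tau> x1 g = \<delta>"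
      using F[of "fst y" g] yz(1) g(1) by metis
    obtain x2 where x2: "x2 \<in> carrier (GL n)" "fst z = x2 <#\<^bsub>GL n\<^esub> T" "\<tau> x2 g = \<delta>"
      using F[of "fst z" g] yz(2) g(2) by metis
    interpret group "GL n :: 'a mat monoid" by (rule group_GL)
    have h: "inv\<^bsub>GL n\<^esub> x2 * x1 \<in> T" using \<tau>_eq_iff_T[OF x1(3) x1(1) x2(1)] x1 x2 by simp
    have "x1 = x2 * (inv\<^bsub>GL n\<^esub> x2 * x1)"
      using inv_GL_mult(2)[OF x2(1) GL_carrier_mat[OF x1(1)]] by simp
    then have "x1 \<in> x2 <#\<^bsub>GL n\<^esub> T" using h by (auto simp: l_coset_def)
    then have "x1 <#\<^bsub>GL n\<^esub> T = x2 <#\<^bsub>GL n\<^esub> T"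
      using l_repr_independence[OF _ x2(1) T_GL(2)] by metis
    then show "y = z" using g x1(2) x2(2) by metis
  qed
  have "finite (snd ` ?F)"
  proof (cases "?F = {}")
    case False
    then obtain C0 g0 where "(C0, g0) \<in> ?F" by auto
    then obtain x0 where x0: "x0 \<in> carrier (GL n)" "g0 \<in> Tr" "\<tau> x0 g0 = \<delta>" using F by blast
    obtain P where P: "P \<in> carrier (GL n)" "\<forall>t\<in>T. \<exists>c. t * P = P * dmat n c"
      using torus_diagonalizable[OF infinite_UNIV T] by blast
    have Pn: "P \<in> carrier_mat n n" "inv\<^bsub>GL n\<^esub> P \<in> carrier_mat n n"
      using GL_carrier_mat[OF P(1)] inv_GL(2)[OF P(1)] by auto
    obtain d0 where d0: "g0 * P = P * dmat n d0" using P(2) Tr_T(1)[OF x0(2)] by blast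
    \<comment> \<open>Candidates for the diagonal of \<open>g\<close> in the eigenbasis: functions
      on the \<open>n\<close> indices with values among the eigenvalues of one fixed
      \<open>g0\<close> from the fibre.\<close>
    let ?E = "{..<n} \<rightarrow>\<^sub>E d0 ` {..<n}"
    have "snd ` ?F \<subseteq> (\<lambda>d. P * dmat n d * inv\<^bsub>GL n\<^esub> P) ` ?E"
    proof
      fix g assume "g \<in> snd ` ?F"
      then obtain C where "(C, g) \<in> ?F" by auto
      then obtain x where x: "x \<in> carrier (GL n)" "g \<in> Tr" "\<tau> x g = \<delta>" using F by blast
      have gn: "g \<in> carrier_mat n n" "g0 \<in> carrier_mat n n" using Tr_T(3) x x0 by auto
      define h where "h = inv\<^bsub>GL n\<^esub> x0 * x"
      have h: "h \<in> carrier (GL n)" "h * g = g0 * h"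
        using \<tau>_eq_iff[OF x(2) x0(2) x(1) x0(1)] x x0 isom_groupD(1) unfolding h_def by auto
      have hn: "h \<in> carrier_mat n n" by (rule GL_carrier_mat[OF h(1)])
      obtain d where d: "g * P = P * dmat n d" using P(2) Tr_T(1)[OF x(2)] by blast
      \<comment> \<open>\<open>K\<close> is the conjugating element \<open>h\<close> in the
        eigenbasis and intertwines the two diagonal matrices. A nonzero entry at
        \<open>(i, j)\<close> forces \<open>d j = d0 i\<close>, and each column of an invertible
        matrix has one.\<close>
      define K where "K = inv\<^bsub>GL n\<^esub> P * h * P"
      have KG: "K \<in> carrier (GL n)" unfolding K_def using P(1) h by (intro mult_in_GL inv_GL(1))
      have Kn: "K \<in> carrier_mat n n" by (rule GL_carrier_mat[OF KG])
      have PK: "P * K = h * P"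
        unfolding K_def using Pn hn inv_GL_mult(2)[OF P(1), of "h * P" n] by simp
      have "P * (K * dmat n d) = (P * K) * dmat n d" using Pn Kn by simp
      also have "\<dots> = h * (g * P)" unfolding PK d using hn Pn by simp
      also have "\<dots> = (g0 * h) * P" using h(2) hn gn Pn by (simp flip: h(2))
      also have "\<dots> = (g0 * P) * K" using PK hn gn Pn Kn by simp
      also have "\<dots> = P * (dmat n d0 * K)" unfolding d0 using Pn Kn by simp
      finally have KD: "K * dmat n d = dmat n d0 * K"
        by (rule GL_cancel_left[where k = n, OF P(1), rotated 2]) (use Kn in simp_all)
      have ex: "d j \<in> d0 ` {..<n}" if j: "j < n" for j
      proof -
        have "\<exists>i<n. K $$ (i, j) \<noteq> 0"
        proof (rule ccontr)
          assume *: "\<not> (\<exists>i<n. K $$ (i, j) \<noteq> 0)"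
          have "(inv\<^bsub>GL n\<^esub> K * K) $$ (j, j) = (\<Sum>i<n. (inv\<^bsub>GL n\<^esub> K) $$ (j, i) * K $$ (i, j))"
            using carrier_matD[OF Kn] carrier_matD[OF inv_GL(2)[OF KG]] j
            by (simp add: scalar_prod_def lessThan_atLeast0)
          also have "\<dots> = 0" using * by (intro sum.neutral) simp
          finally show False unfolding inv_GL(4)[OF KG] using j by simp
        qed
        then obtain i where i: "i < n" "K $$ (i, j) \<noteq> 0" by blast
        have "K $$ (i, j) * d j = d0 i * K $$ (i, j)"
          using dmat_mult_index[OF Kn i(1) j] KD by metis
        then have "d j = d0 i" using i(2) by simp
        then show ?thesis using i(1) by blast
      qed
      \<comment> \<open>Restriction makes the function extensional, as membership in
        \<open>?E\<close> requires, without changing the matrix.\<close>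
      define d' where "d' = restrict d {..<n}"
      have "d' \<in> ?E" using ex by (auto simp: d'_def)
      moreover have "dmat n d = dmat n d'" by (rule dmat_cong) (simp add: d'_def)
      then have "g * P = P * dmat n d'" using d by simp
      then have "g * P * inv\<^bsub>GL n\<^esub> P = P * dmat n d' * inv\<^bsub>GL n\<^esub> P" by simp
      then have "g = P * dmat n d' * inv\<^bsub>GL n\<^esub> P" using gn Pn inv_GL(3)[OF P(1)] by simp
      ultimately show "g \<in> (\<lambda>d. P * dmat n d * inv\<^bsub>GL n\<^esub> P) ` ?E" by blast
    qed
    moreover have "finite ((\<lambda>d. P * dmat n d * inv\<^bsub>GL n\<^esub> P) ` ?E)"
      by (intro finite_imageI finite_PiE) auto
    ultimately show ?thesis by (rule finite_subset)
  next
    case True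
    then show ?thesis by (simp only: image_empty finite.emptyI)
  qed
  then show ?thesis using inj by (rule finite_imageD)
qed

end

theorem proposition1:
  fixes m :: nat and c :: "'f::field_char_0 case_type" and T :: "'f alg_closure mat set"
  assumes "p_adic_field TYPE('f)" and "m \<ge> 1" and "wf_case c"
    and "maximal_torus (2 * m) (H_group m c) T"
  shows "(\<forall>g\<in>carrier (GL (2 * m)). \<forall>\<gamma>\<in>regular_elements m c T.
            beta m c (g <#\<^bsub>GL (2 * m)\<^esub> T, \<gamma>)
              = g * inv\<^bsub>GL (2 * m)\<^esub> (S_map m c \<gamma>) * vdash m c g) \<and>
         beta m c \<in> (lcosets\<^bsub>GL (2 * m)\<^esub> T) \<times> regular_elements m c T \<rightarrow> G_eps_rs m c \<and>
         (\<forall>\<delta>\<in>G_eps_rs m c.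
            finite {x \<in> (lcosets\<^bsub>GL (2 * m)\<^esub> T) \<times> regular_elements m c T. beta m c x = \<delta>})"
proof -
  have T: "is_torus (2 * m) T" "T \<subseteq> isom_group (2 * m) (form_mat m c)"
    using assms(4) H_group_subset_H_plus[of m c] unfolding maximal_torus_def H_plus_eq by blast+
  obtain e where e: "e = 1 \<or> e = - 1" "(form_mat m c)\<^sup>T = e \<cdot>\<^sub>m form_mat m c"
    using transpose_form_mat[OF assms(2,3)] by blast
  interpret twisted_form "2 * m" "form_mat m c" "vdash_mat m c" e T
    using form_mat_in_GL[OF assms(2,3)] e vdash_mat_in_GL T by unfold_locales
  have Tr: "regular_elements m c T = Tr"
    by (simp add: regular_elements_def Tr_def H_plus_eq)
  have flip: "vdash m c g = flip g" for g by (simp add: vdash_eq flip_def)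
  have \<tau>: "g * inv\<^bsub>GL (2 * m)\<^esub> (S_map m c \<gamma>) * vdash m c g = \<tau> g \<gamma>" if "\<gamma> \<in> Tr" for g \<gamma>
    unfolding \<tau>_def flip S_def S_map_eq[OF Tr_T(3)[OF that]] ..
  have beta: "beta m c (g <#\<^bsub>GL (2 * m)\<^esub> T, \<gamma>) = \<tau> g \<gamma>"
    if g: "g \<in> carrier (GL (2 * m))" and \<gamma>: "\<gamma> \<in> Tr" for g \<gamma>
  proof -
    have "\<one>\<^bsub>GL (2 * m)\<^esub> \<in> T" using T_GL(2) by (rule subgroup.one_closed)
    moreover have "g = g \<otimes>\<^bsub>GL (2 * m)\<^esub> \<one>\<^bsub>GL (2 * m)\<^esub>"
      using GL_carrier_mat[OF g] by simp
    \<comment> \<open>The coset is nonempty because it contains \<open>g\<close>; this gives the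
      uniqueness demanded by the definite description in \<open>beta\<close>.\<close>
    ultimately have mem: "g \<in> g <#\<^bsub>GL (2 * m)\<^esub> T"
      unfolding l_coset_def by blast
    show ?thesis
      unfolding beta_def prod.case \<tau>[OF \<gamma>]
    proof (rule the_equality)
      show "\<forall>x\<in>g <#\<^bsub>GL (2 * m)\<^esub> T. \<tau> x \<gamma> = \<tau> g \<gamma>" using \<tau>_coset[OF \<gamma> g] by blast
      show "\<delta> = \<tau> g \<gamma>" if "\<forall>x\<in>g <#\<^bsub>GL (2 * m)\<^esub> T. \<tau> x \<gamma> = \<delta>" for \<delta>
        using bspec[OF that mem] by (rule sym)
    qed
  qed
  have rs: "\<tau> g \<gamma> \<in> G_eps_rs m c" if "g \<in> carrier (GL (2 * m))" "\<gamma> \<in> Tr" for g \<gamma>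
    unfolding G_eps_rs_def twisted_centralizer_def eps_def flip
    using \<tau>_in_GL[OF that(2,1)] semisimple_\<tau>[OF that(2,1)] torus_twisted_centralizer[OF that(2,1)]
    by simp
  show ?thesis
    unfolding Tr
  proof (intro conjI ballI)
    fix g \<gamma> :: "'f alg_closure mat" assume "g \<in> carrier (GL (2 * m))" "\<gamma> \<in> Tr"
    then show "beta m c (g <#\<^bsub>GL (2 * m)\<^esub> T, \<gamma>)
        = g * inv\<^bsub>GL (2 * m)\<^esub> (S_map m c \<gamma>) * vdash m c g"
      using beta \<tau> by simp
  next
    show "beta m c \<in> (lcosets\<^bsub>GL (2 * m)\<^esub> T) \<times> Tr \<rightarrow> G_eps_rs m c"
      using beta rs by (auto simp: LCOSETS_def)
  next
    fix \<delta>
    show "finite {x \<in> (lcosets\<^bsub>GL (2 * m)\<^esub> T) \<times> Tr. beta m c x = \<delta>}"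
      using beta by (rule finite_fibre)
  qed
qed

end
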